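(* Let $\mathcal{A}=\{A_1,\dots,A_m\}\subseteq\mathbb{R}^{n\times n}$ be a switched linear system. Let $\beta\in(0,1)$, $\delta\ge 1$, $d=n(n+1)/2$, $N\in\mathbb{N}$ with $N\ge d$, and $W\ge 0$. For each sample set $\omega_N=\{(x_i,j_i,w_i)\}_{i=1}^N\in\Delta^N$, let $\gamma_\star(\omega_N,\delta)$ and $P_\star(\omega_N,\delta)$ be the optimal value and optimal matrix of the scenario program $$\min_{\gamma\ge 0,\;P\succ 0}\ \gamma\quad\text{s.t.}\quad I\preceq P\preceq\delta I,\qquad\|A_{j_i}x_i+w_i\|_P\le\gamma\|x_i\|_P\ \ \forall i\in[N].$$ Assume that there is $\alpha>0$ with $\mu^{\mathrm{mode}}(j)\ge\alpha$ for all $j\in[m]$; that $\mu^{\mathrm{noise}}(\{w\in\mathbb{R}^n:\|w\|_2>W'\})\le p(W')$ for all $W'\ge 0$; and that $\mu^{\mathrm{noise}}$ is absolutely continuous with respect to the Lebesgue measure on $\mathbb{R}^n$. Then $$\pi^N\big(\{\omega_N\in\Delta^N:\rho(\mathcal{A})\le\overline\rho(\omega_N)\}\big)\ge 1-\beta,$$ where $$\overline\rho(\omega_N)=\frac{\overline\gamma(\omega_N,\delta)}{\zeta\!\left(\frac{\epsilon(\beta,N)\,\kappa(P_\star(\omega_N,\delta))}{2\alpha\left(1-\frac12p(W)\right)}\right)},\qquad\overline\gamma(\omega_N,\delta)=\gamma_\star(\omega_N,\delta)+W\sqrt{\overline\kappa(P_\star(\omega_N,\delta))},$$ $\epsilon(\beta,N)$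 is the unique $q\in[0,1]$ such that $\sum_{l=0}^{d-1}\binom{N}{l}q^l(1-q)^{N-l}=\beta$, $\overline\kappa(P)=\lambda_{\max}(P)/\lambda_{\min}(P)$, and $\kappa(P)=\sqrt{\det(P)/\lambda_{\min}(P)^n}$.
   Context: Let $n\ge 2$, $m\ge 1$, $[m]=\{1,\dots,m\}$, and $\mathbb{S}^{n-1}$ the Euclidean unit sphere of $\mathbb{R}^n$. For a symmetric positive definite $P$, $\|x\|_P=(x^\top Px)^{1/2}$. A trajectory of $\mathcal{A}$ is a function $\xi:\mathbb{N}\to\mathbb{R}^n$ with $\xi(t+1)\in\{A\xi(t):A\in\mathcal{A}\}$ for all $t$. The joint spectral radius $\rho(\mathcal{A})$ is the infimum of all $r\ge 0$ for which there is $C\ge 1$ such that every trajectory satisfies $\|\xi(t)\|\le Cr^t\|\xi(0)\|$ for all $t\in\mathbb{N}$. Probability setting: $\Delta=\mathbb{S}^{n-1}\times[m]\times\mathcal{W}$ with $\mathcal{W}\subseteq\mathbb{R}^n$ the set of noise values, and $\pi=\mu^{\mathrm{state}}\times\mu^{\mathrm{mode}}\times\mu^{\mathrm{noise}}$ is a product probability distribution on $\Delta$, where $\mu^{\mathrm{state}}$ is the uniform distribution on $\mathbb{S}^{n-1}$, $\mu^{\mathrm{mode}}$ is a distribution on $[m]$ and $\mu^{\mathrm{noise}}$ is a distribution on $\mathcal{W}$. Sample sets $\omega_N$ are drawn i.i.d. from $\pi$, i.e. from $\pi^N$. The function $p:[0,\infty)\to[0,1]$ is a given tail bound. Optimal solution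 of the scenario program: its existence and uniqueness are a standing assumption; if the optimal $P$ is not unique, $P_\star(\omega_N,\delta)$ is the optimal $P$ selected by a tie-breaking rule, namely minimization of a fixed strictly convex continuous function (e.g. the squared Frobenius norm) over the convex set of optimal $P$. $\zeta(x)=\sqrt{1-I^{-1}(2x;(n-1)/2;1/2)}$, where $I(x;a;b)=\int_0^xt^{a-1}(1-t)^{b-1}\,dt\big/\int_0^1t^{a-1}(1-t)^{b-1}\,dt$ is the regularized incomplete beta function and $I^{-1}(\cdot;a;b):[0,1]\to[0,1]$ is its inverse in the first variable; thus $\zeta$ is defined for $0\le x\le 1/2$. Convention: $\overline\rho(\omega_N)=+\infty$ if the argument of $\zeta$ is $\ge 1/2$. *)

theory Defs
  imports "HOL-Probability.Probability"
begin

definition is_trajectory :: "(real^'n^'n) set \<Rightarrow> (nat \<Rightarrow> real^'n) \<Rightarrow> bool" where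
  "is_trajectory \<A> \<xi> \<longleftrightarrow> (\<forall>t. \<xi> (Suc t) \<in> (\<lambda>B. B *v \<xi> t) ` \<A>)"

definition joint_spectral_radius :: "(real^'n^'n) set \<Rightarrow> real" where
  "joint_spectral_radius \<A> =
     Inf {r. 0 \<le> r \<and> (\<exists>C\<ge>1. \<forall>\<xi>. is_trajectory \<A> \<xi> \<longrightarrow>
                (\<forall>t. norm (\<xi> t) \<le> C * r ^ t * norm (\<xi> 0)))}"

definition pos_def :: "real^'n^'n \<Rightarrow> bool" where
  "pos_def P \<longleftrightarrow> transpose P = P \<and> (\<forall>x. x \<noteq> 0 \<longrightarrow> 0 < x \<bullet> (P *v x))"

definition pos_semidef :: "real^'n^'n \<Rightarrow> bool" where
  "pos_semidef P \<longleftrightarrow> transpose P = P \<and> (\<forall>x. 0 \<le> x \<bullet> (P *v x))"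

definition loewner_le :: "real^'n^'n \<Rightarrow> real^'n^'n \<Rightarrow> bool" where
  "loewner_le P Q \<longleftrightarrow> pos_semidef (Q - P)"

definition pnorm :: "real^'n^'n \<Rightarrow> real^'n \<Rightarrow> real" where
  "pnorm P x = sqrt (x \<bullet> (P *v x))"

definition eigenvals :: "real^'n^'n \<Rightarrow> real set" where
  "eigenvals P = {c. \<exists>v. v \<noteq> 0 \<and> P *v v = c *\<^sub>R v}"

definition lambda_max :: "real^'n^'n \<Rightarrow> real" where
  "lambda_max P = Max (eigenvals P)"

definition lambda_min :: "real^'n^'n \<Rightarrow> real" where
  "lambda_min P = Min (eigenvals P)"

definition kappa_bar :: "real^'n^'n \<Rightarrow> real" where
  "kappa_bar P = lambda_max P / lambda_min P"

definition kappa :: "real^'n^'n \<Rightarrow> real" where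
  "kappa P = sqrt (det P / lambda_min P ^ CARD('n))"

definition reg_inc_beta :: "real \<Rightarrow> real \<Rightarrow> real \<Rightarrow> real" where
  "reg_inc_beta x a b =
     integral {0..x} (\<lambda>t. t powr (a - 1) * (1 - t) powr (b - 1)) /
     integral {0..1} (\<lambda>t. t powr (a - 1) * (1 - t) powr (b - 1))"

definition inv_reg_inc_beta :: "real \<Rightarrow> real \<Rightarrow> real \<Rightarrow> real" where
  "inv_reg_inc_beta y a b = the_inv_into {0..1} (\<lambda>x. reg_inc_beta x a b) y"

definition zeta :: "nat \<Rightarrow> real \<Rightarrow> real" where
  "zeta n x = sqrt (1 - inv_reg_inc_beta (2 * x) ((real n - 1) / 2) (1 / 2))"

text \<open>
  The uniform distribution on the unit sphere, as the normalized cone measure: the radial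
  projection of the normalized Lebesgue measure on the unit ball. The origin, a null set, is
  removed because \<^term>\<open>sgn 0 = 0\<close> does not lie on the sphere.
\<close>

definition uniform_sphere :: "(real^'n) measure" where
  "uniform_sphere =
     distr (uniform_measure (restrict_space lborel (cball 0 1 - {0})) (cball 0 1 - {0}))
           (restrict_space borel (sphere 0 1)) sgn"

lemma sets_uniform_sphere: "sets uniform_sphere = sets (restrict_space borel (sphere 0 1))"
  by (simp add: uniform_sphere_def)

lemma space_uniform_sphere: "space uniform_sphere = sphere 0 1"
  by (simp add: uniform_sphere_def space_restrict_space)

lemma emeasure_uniform_sphere:
  fixes S :: "(real^'n) set"
  assumes "S \<in> sets borel" "S \<subseteq> sphere 0 1"
  shows "emeasure uniform_sphere S =
           emeasure lborel {x \<in> cball 0 1 - {0}. sgn x \<in> S} /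
           emeasure lborel (cball 0 1 :: (real^'n) set)"
proof -
  let ?B = "cball 0 1 - {0} :: (real^'n) set"
  let ?R = "restrict_space lborel ?B"
  let ?U = "uniform_measure ?R ?B"
  have meas: "sgn \<in> measurable ?U (restrict_space borel (sphere 0 1))"
    by (intro measurable_restrict_space2)
       (auto simp: space_restrict_space norm_sgn measurable_restrict_space1 cong: measurable_cong_sets)
  have S: "S \<in> sets (restrict_space borel (sphere 0 1))"
    using assms by (auto simp: sets_restrict_space)
  have pre: "{x \<in> ?B. sgn x \<in> S} \<in> sets borel"
  proof -
    have "?B \<inter> (sgn -` S \<inter> space borel) \<in> sets borel"
      using assms(1) by (intro sets.Int measurable_sets[OF borel_measurable_sgn]) auto
    also have "?B \<inter> (sgn -` S \<inter> space borel) = {x \<in> ?B. sgn x \<in> S}" by auto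
    finally show ?thesis .
  qed
  have eq: "sgn -` S \<inter> space ?U = {x \<in> ?B. sgn x \<in> S}"
    by (auto simp: space_restrict_space)
  have emR: "emeasure ?R X = emeasure lborel X" if "X \<subseteq> ?B" for X
    using that by (intro emeasure_restrict_space) auto
  have BR: "?B \<in> sets ?R"
    by (subst sets_restrict_space_iff) simp_all
  have XR: "{x \<in> ?B. sgn x \<in> S} \<in> sets ?R"
    unfolding sets_restrict_space using pre by (intro image_eqI[where x="{x \<in> ?B. sgn x \<in> S}"]) auto
  have "emeasure uniform_sphere S = emeasure ?U {x \<in> ?B. sgn x \<in> S}"
    unfolding uniform_sphere_def using emeasure_distr[OF meas S] eq by simp
  also have "\<dots> = emeasure ?R (?B \<inter> {x \<in> ?B. sgn x \<in> S}) / emeasure ?R ?B"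
    by (rule emeasure_uniform_measure[OF BR XR])
  also have "?B \<inter> {x \<in> ?B. sgn x \<in> S} = {x \<in> ?B. sgn x \<in> S}" by auto
  also have "emeasure ?R ?B = emeasure lborel (cball 0 1 :: (real^'n) set)"
  proof -
    have "emeasure lborel ?B = emeasure lborel (cball 0 1 :: (real^'n) set)"
      by (rule emeasure_Diff_null_set) (simp_all add: finite_imp_null_set_lborel)
    then show ?thesis using emR[of ?B] by simp
  qed
  also have "emeasure ?R {x \<in> ?B. sgn x \<in> S} = emeasure lborel {x \<in> ?B. sgn x \<in> S}"
    by (rule emR) blast
  finally show ?thesis .
qed

lemma prob_space_uniform_sphere: "prob_space (uniform_sphere :: (real^'n) measure)"
proof
  let ?C = "cball 0 1 :: (real^'n) set"
  have "{x \<in> ?C - {0}. sgn x \<in> sphere 0 1} = ?C - {0}"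
    by (auto simp: norm_sgn)
  moreover have "emeasure lborel (?C - {0}) = emeasure lborel ?C"
    by (rule emeasure_Diff_null_set) (simp_all add: finite_imp_null_set_lborel)
  moreover have "emeasure lborel ?C \<noteq> \<infinity>"
    using emeasure_lborel_cball_finite[of "0 :: real^'n" 1] by simp
  moreover have "emeasure lborel ?C \<noteq> 0"
  proof -
    have "0 < measure lborel ?C" by (rule content_cball_pos) simp
    then show ?thesis by (auto simp: measure_def)
  qed
  ultimately show "emeasure (uniform_sphere :: (real^'n) measure) (space uniform_sphere) = 1"
    using emeasure_uniform_sphere[of "sphere 0 1 :: (real^'n) set"]
    by (simp add: space_uniform_sphere less_top)
qed

definition sample_measure ::
  "'m::finite pmf \<Rightarrow> (real^'n) measure \<Rightarrow> ((real^'n) \<times> 'm \<times> (real^'n)) measure" where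
  "sample_measure \<mu>_mode \<mu>_noise = uniform_sphere \<Otimes>\<^sub>M (measure_pmf \<mu>_mode \<Otimes>\<^sub>M \<mu>_noise)"

definition samples_measure ::
  "nat \<Rightarrow> 'm::finite pmf \<Rightarrow> (real^'n) measure \<Rightarrow> (nat \<Rightarrow> (real^'n) \<times> 'm \<times> (real^'n)) measure" where
  "samples_measure N \<mu>_mode \<mu>_noise = PiM {1..N} (\<lambda>_. sample_measure \<mu>_mode \<mu>_noise)"

definition scenario_feasible ::
  "('m \<Rightarrow> real^'n^'n) \<Rightarrow> real \<Rightarrow> nat \<Rightarrow> (nat \<Rightarrow> (real^'n) \<times> 'm \<times> (real^'n)) \<Rightarrow>
   real \<Rightarrow> real^'n^'n \<Rightarrow> bool" where
  "scenario_feasible A \<delta> N \<omega> \<gamma> P \<longleftrightarrow>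
     0 \<le> \<gamma> \<and> pos_def P \<and> loewner_le (mat 1) P \<and> loewner_le P (\<delta> *\<^sub>R mat 1) \<and>
     (\<forall>i\<in>{1..N}. case \<omega> i of (x, j, w) \<Rightarrow> pnorm P (A j *v x + w) \<le> \<gamma> * pnorm P x)"

definition gamma_star ::
  "('m \<Rightarrow> real^'n^'n) \<Rightarrow> real \<Rightarrow> nat \<Rightarrow> (nat \<Rightarrow> (real^'n) \<times> 'm \<times> (real^'n)) \<Rightarrow> real" where
  "gamma_star A \<delta> N \<omega> = Inf {\<gamma>. \<exists>P. scenario_feasible A \<delta> N \<omega> \<gamma> P}"

definition optimal_matrices ::
  "('m \<Rightarrow> real^'n^'n) \<Rightarrow> real \<Rightarrow> nat \<Rightarrow> (nat \<Rightarrow> (real^'n) \<times> 'm \<times> (real^'n)) \<Rightarrow>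
   (real^'n^'n) set" where
  "optimal_matrices A \<delta> N \<omega> = {P. scenario_feasible A \<delta> N \<omega> (gamma_star A \<delta> N \<omega>) P}"

text \<open>Among several optimal matrices, the minimizer of the tie-breaking function \<open>\<phi>\<close> is selected.\<close>

definition P_star ::
  "('m \<Rightarrow> real^'n^'n) \<Rightarrow> real \<Rightarrow> (real^'n^'n \<Rightarrow> real) \<Rightarrow> nat \<Rightarrow>
   (nat \<Rightarrow> (real^'n) \<times> 'm \<times> (real^'n)) \<Rightarrow> real^'n^'n" where
  "P_star A \<delta> \<phi> N \<omega> =
     (THE P. P \<in> optimal_matrices A \<delta> N \<omega> \<and> (\<forall>Q\<in>optimal_matrices A \<delta> N \<omega>. \<phi> P \<le> \<phi> Q))"

definition strictly_convex_on :: "'a::real_vector set \<Rightarrow> ('a \<Rightarrow> real) \<Rightarrow> bool" where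
  "strictly_convex_on S f \<longleftrightarrow> convex S \<and>
     (\<forall>x\<in>S. \<forall>y\<in>S. \<forall>u\<in>{0<..<1}. x \<noteq> y \<longrightarrow>
        f ((1 - u) *\<^sub>R x + u *\<^sub>R y) < (1 - u) * f x + u * f y)"

definition scenario_eps :: "nat \<Rightarrow> real \<Rightarrow> nat \<Rightarrow> real" where
  "scenario_eps d \<beta> N =
     (THE q. q \<in> {0..1} \<and> (\<Sum>l=0..d-1. real (N choose l) * q ^ l * (1 - q) ^ (N - l)) = \<beta>)"

definition gamma_bar ::
  "('m \<Rightarrow> real^'n^'n) \<Rightarrow> real \<Rightarrow> (real^'n^'n \<Rightarrow> real) \<Rightarrow> nat \<Rightarrow> real \<Rightarrow>
   (nat \<Rightarrow> (real^'n) \<times> 'm \<times> (real^'n)) \<Rightarrow> real" where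
  "gamma_bar A \<delta> \<phi> N W \<omega> =
     gamma_star A \<delta> N \<omega> + W * sqrt (kappa_bar (P_star A \<delta> \<phi> N \<omega>))"

definition rho_bar ::
  "('m \<Rightarrow> real^'n^'n) \<Rightarrow> real \<Rightarrow> (real^'n^'n \<Rightarrow> real) \<Rightarrow> nat \<Rightarrow> real \<Rightarrow> real \<Rightarrow> real \<Rightarrow> (real \<Rightarrow> real) \<Rightarrow>
   (nat \<Rightarrow> (real^'n) \<times> 'm \<times> (real^'n)) \<Rightarrow> ereal" where
  "rho_bar A \<delta> \<phi> N W \<alpha> \<beta> p \<omega> =
     (let n = CARD('n);
          d = n * (n + 1) div 2;
          s = scenario_eps d \<beta> N * kappa (P_star A \<delta> \<phi> N \<omega>) / (2 * \<alpha> * (1 - p W / 2))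
      in if s \<ge> 1 / 2 then \<infinity> else ereal (gamma_bar A \<delta> \<phi> N W \<omega> / zeta n s))"

end

theory Submission
  imports Defs
begin

text \<open>
  The theorem combines a statement about convex optimization from random samples with a statement
  about the geometry of the sphere.

  Call a sample \<open>(x, j, w)\<close> violated by \<open>(\<gamma>, P)\<close> if its constraint fails there, and let the risk of
  \<open>\<omega>\<close> be the probability that a fresh sample is violated by the optimum \<open>(\<gamma>\<^sub>\<star>, P\<^sub>\<star>)\<close> for \<open>\<omega>\<close>.
  \<^emph>\<open>First half: with probability at least \<open>1 - \<beta>\<close> the risk is at most \<open>\<epsilon>(\<beta>, N)\<close>.\<close> The squared
  constraint \<open>u \<le> \<gamma>\<^sup>2 v\<close> compares two linear functions of \<open>P\<close>. It is homogeneous in \<open>P\<close>, so a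
  linear dependence between \<open>d + 1\<close> optima, split into its positive and its negative part, plays the
  role of a Radon partition and shows that at most \<open>d = n(n+1)/2\<close> constraints can be essential, the
  dimension of the space of symmetric matrices (\<open>card_support_le_dim\<close>, \<open>dim_spectral_body\<close>); the
  homogeneity is what saves one dimension over the general bound for \<open>d\<close> variables and a level. A constraint that is essential is active at the optimum that includes it
  (\<open>violated_imp_active\<close>). The noise has no mass on the boundary of an ellipsoid, so a sample is
  almost surely not active at the optimum for the other samples, and therefore the set of samples that
  determines the optimum is almost surely unique (\<open>AE_basis_unique\<close>). Splitting the sample space
  according to this set, for every number \<open>m\<close> of samples, yields a system of moment equations for the law of the risk;
  these force the risk to lie stochastically below a Beta distribution with parameters \<open>d\<close> and
  \<open>N - d + 1\<close>, whose tail is the binomial sum that defines \<open>\<epsilon>(\<beta>, N)\<close>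
  (\<open>moment_tail_bound\<close>, \<open>risk_tail\<close>).

  \<^emph>\<open>Second half: if the risk is at most \<open>\<epsilon>(\<beta>, N)\<close>, then \<open>\<rho>(\<A>)\<close> is at most the stated bound.\<close>
  Call a state \<open>x\<close> bad for the mode \<open>j\<close> if \<open>A\<^sub>j\<close> expands \<open>x\<close> by more than \<open>\<gamma>-bar\<close> in the norm of \<open>P\<^sub>\<star>\<close>.
  At a bad state every noise of norm at most \<open>W\<close> leads to a violation, and any noise does so at \<open>x\<close>
  or at \<open>-x\<close>. Averaging over \<open>x\<close> and \<open>-x\<close> gives the factor \<open>1 - p(W)/2\<close>, and the mode contributes the
  factor \<open>\<alpha>\<close> (\<open>bad_states_le_violation\<close>). So the bad states have small measure. Were \<open>A\<^sub>j\<close> not a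
  contraction with factor \<open>\<gamma>-bar / \<zeta>\<close>, then in coordinates in which \<open>P\<^sub>\<star>\<close> is the identity the bad
  states would contain a double cap around one direction. The measure of a double cap is an
  incomplete beta function, \<open>\<kappa>\<close> bounds the distortion of the measure by the change of coordinates, and
  \<open>\<zeta>\<close> is the height at which the cap has exactly the critical measure
  (\<open>contraction_defect_measure\<close>). A common contraction factor of all modes in one norm bounds the
  joint spectral radius.

  The event in question has to be measurable for its measure to be meaningful. The selected optimum
  is a measurable function of the samples because minimization of a continuous function over a compact
  set reduces to a countable dense subset (\<open>measurable_opt_point\<close>).
\<close>

section \<open>The binomial tail and a moment problem\<close>

text \<open>
  The probability that a binomial variable with parameters \<open>N\<close> and \<open>q\<close> is smaller than \<open>d\<close>.
\<close>

definition binomial_tail :: "nat \<Rightarrow> nat \<Rightarrow> real \<Rightarrow> real" where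
  "binomial_tail d N q = (\<Sum>l<d. real (N choose l) * q ^ l * (1 - q) ^ (N - l))"

text \<open>
  The derivatives of consecutive summands telescope. What remains is minus the density of a Beta
  distribution, so the binomial tail is a Beta tail.
\<close>

lemma binomial_tail_deriv:
  assumes "d < N"
  shows "(binomial_tail (Suc d) N has_real_derivative
           - (real (Suc d) * real (N choose Suc d) * q ^ d * (1 - q) ^ (N - Suc d))) (at q)"
  using assms
proof (induction d)
  case 0
  have "((\<lambda>q. (1 - q) ^ N) has_real_derivative - (real N * (1 - q) ^ (N - 1))) (at q)"
    by (auto intro!: derivative_eq_intros)
  then show ?case by (simp add: binomial_tail_def)
next
  case (Suc d)
  let ?D = "Suc d" let ?c = "real (N choose ?D)"
  have eq: "binomial_tail (Suc ?D) N = (\<lambda>q. binomial_tail ?D N q + ?c * (q ^ ?D * (1 - q) ^ (N - ?D)))"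
    by (simp add: binomial_tail_def fun_eq_iff)
  have "((\<lambda>q. binomial_tail ?D N q + ?c * (q ^ ?D * (1 - q) ^ (N - ?D))) has_real_derivative
     - (real ?D * ?c * q ^ d * (1 - q) ^ (N - ?D)) +
     ?c * (real ?D * q ^ d * (1 - q) ^ (N - ?D) - real (N - ?D) * (1 - q) ^ (N - Suc ?D) * q ^ ?D)) (at q)"
    by (rule DERIV_add[OF Suc.IH]) (use Suc.prems in \<open>auto intro!: derivative_eq_intros simp: algebra_simps simp del: power_Suc\<close>)
  moreover have "real (Suc ?D) * real (N choose Suc ?D) = real (N - ?D) * ?c"
    using binomial_absorb_comp[of N ?D] Suc_times_binomial_eq
    by (metis Suc.prems binomial_absorption binomial_absorb_comp of_nat_mult diff_Suc_1)
  ultimately show ?case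
    unfolding eq by (simp add: algebra_simps)
qed

lemma binomial_tail_0: "0 < d \<Longrightarrow> binomial_tail d N 0 = 1"
  unfolding binomial_tail_def by (subst sum.remove[of _ 0]) (auto simp: power_0_left)

lemma binomial_tail_1: "d \<le> N \<Longrightarrow> binomial_tail d N 1 = 0"
  unfolding binomial_tail_def by (intro sum.neutral) auto

lemma continuous_on_binomial_tail: "continuous_on S (binomial_tail d N)"
  unfolding binomial_tail_def by (intro continuous_intros)

lemma binomial_tail_strict_anti:
  assumes "0 < d" "d \<le> N" "0 \<le> x" "x < y" "y \<le> 1"
  shows "binomial_tail d N y < binomial_tail d N x"
proof (rule DERIV_neg_imp_decreasing_open[OF assms(4)])
  obtain e where d: "d = Suc e" using assms(1) by (cases d) auto
  fix q assume q: "x < q" "q < y"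
  have "(binomial_tail d N has_real_derivative
           - (real (Suc e) * real (N choose Suc e) * q ^ e * (1 - q) ^ (N - Suc e))) (at q)"
    unfolding d by (rule binomial_tail_deriv) (use assms d in auto)
  moreover have "0 < real (Suc e) * real (N choose Suc e) * q ^ e * (1 - q) ^ (N - Suc e)"
    using q assms d by (intro mult_pos_pos zero_less_power) auto
  ultimately show "\<exists>l. (binomial_tail d N has_real_derivative l) (at q) \<and> l < 0"
    by (intro exI conjI) auto
qed (rule continuous_on_binomial_tail)

lemma binomial_tail_integral:
  assumes "d < N" "0 \<le> e" "e \<le> 1"
  shows "((\<lambda>q. real (Suc d) * real (N choose Suc d) * q ^ d * (1 - q) ^ (N - Suc d))
           has_integral binomial_tail (Suc d) N e) {e..1}"
proof -
  have "((\<lambda>q. real (Suc d) * real (N choose Suc d) * q ^ d * (1 - q) ^ (N - Suc d))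
           has_integral (- binomial_tail (Suc d) N 1 - (- binomial_tail (Suc d) N e))) {e..1}"
    by (rule fundamental_theorem_of_calculus[OF assms(3)])
       (use DERIV_minus[OF binomial_tail_deriv[OF assms(1)]] in
         \<open>auto simp: has_real_derivative_iff_has_vector_derivative[symmetric] intro: has_field_derivative_at_within\<close>)
  then show ?thesis using binomial_tail_1[of "Suc d" N] assms by simp
qed

text \<open>
  The mean of \<open>f\<close> at the maximum of \<open>j\<close> independent uniform points of the unit interval, with
  the value at 0 if there are no points. It serves to treat a basis with only \<open>d - j\<close> elements as if
  it had \<open>d\<close> elements.
\<close>

definition pad :: "nat \<Rightarrow> (real \<Rightarrow> real) \<Rightarrow> real" where
  "pad j f = (if j = 0 then f 0 else integral {0..1} (\<lambda>t. real j * t ^ (j - 1) * f t))"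

text \<open>
  Integration by parts trades a factor \<open>1 - t\<close> for a factor \<open>t\<close>.
\<close>

lemma power_beta_integral:
  "((\<lambda>t. real (Suc j) * t ^ j * (1 - t) ^ m) has_integral 1 / real ((m + Suc j) choose Suc j)) {0..1::real}"
proof (induction m arbitrary: j)
  case 0
  have "((\<lambda>t. real (Suc j) * t ^ j) has_integral (1 ^ Suc j - 0 ^ Suc j)) {0..1::real}"
    by (rule fundamental_theorem_of_calculus)
       (auto simp: has_real_derivative_iff_has_vector_derivative[symmetric] simp del: power_Suc of_nat_Suc intro!: derivative_eq_intros)
  then show ?case by simp
next
  case (Suc m)
  have "((\<lambda>t. real (Suc j) * t ^ j * (1 - t) ^ Suc m - real (Suc m) * (1 - t) ^ m * t ^ Suc j)
      has_integral ((1 - 1) ^ Suc m * 1 ^ Suc j - (1 - 0) ^ Suc m * 0 ^ Suc j)) {0..1::real}"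
    by (rule fundamental_theorem_of_calculus)
       (auto simp: has_real_derivative_iff_has_vector_derivative[symmetric] algebra_simps simp del: power_Suc of_nat_Suc
         intro!: derivative_eq_intros)
  then have A: "((\<lambda>t. real (Suc j) * t ^ j * (1 - t) ^ Suc m - real (Suc m) * (1 - t) ^ m * t ^ Suc j)
      has_integral 0) {0..1::real}" by simp
  have "((\<lambda>t. (real (Suc m) / real (Suc (Suc j))) * (real (Suc (Suc j)) * t ^ Suc j * (1 - t) ^ m)) has_integral
     (real (Suc m) / real (Suc (Suc j))) * (1 / real ((m + Suc (Suc j)) choose Suc (Suc j)))) {0..1::real}"
    by (rule has_integral_mult_right[OF Suc.IH])
  moreover have "(real (Suc m) / real (Suc (Suc j))) * (1 / real ((m + Suc (Suc j)) choose Suc (Suc j))) =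
      1 / real ((Suc m + Suc j) choose Suc j)"
  proof -
    have "Suc (Suc j) * ((m + Suc (Suc j)) choose Suc (Suc j)) = (m + Suc (Suc j) - Suc j) * ((m + Suc (Suc j)) choose Suc j)"
      using binomial_absorb_comp[of "m + Suc (Suc j)" "Suc j"] binomial_absorption[of "Suc j" "m + Suc (Suc j)"]
      by simp
    then have "real (Suc (Suc j)) * real ((m + Suc (Suc j)) choose Suc (Suc j)) = real (Suc m) * real ((m + Suc (Suc j)) choose Suc j)"
      by (metis (no_types, lifting) of_nat_mult add_diff_cancel_right' add_Suc_shift)
    moreover have "Suc m + Suc j = m + Suc (Suc j)" by simp
    moreover have "0 < real ((m + Suc (Suc j)) choose Suc (Suc j))" "0 < real ((m + Suc (Suc j)) choose Suc j)"
      by (simp_all add: zero_less_binomial_iff del: binomial_Suc_Suc)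
    ultimately show ?thesis by (simp add: field_simps del: binomial_Suc_Suc of_nat_Suc)
  qed
  ultimately have B: "((\<lambda>t. real (Suc m) * (1 - t) ^ m * t ^ Suc j) has_integral 1 / real ((Suc m + Suc j) choose Suc j)) {0..1::real}"
    by (simp del: binomial_Suc_Suc of_nat_Suc add: mult_ac)
  show ?case using has_integral_add[OF A B] by (simp del: binomial_Suc_Suc of_nat_Suc)
qed

lemma pad_sum_power:
  "pad j (\<lambda>t. \<Sum>m\<le>n. c m * (1 - t) ^ m) = (\<Sum>m\<le>n. c m / real ((m + j) choose j))"
proof (cases "j = 0")
  case False
  have "((\<lambda>t. \<Sum>m\<le>n. c m * (real j * t ^ (j - 1) * (1 - t) ^ m)) has_integral (\<Sum>m\<le>n. c m * (1 / real ((m + j) choose j)))) {0..1}"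
    using power_beta_integral[of "j - 1"] False
    by (intro has_integral_sum has_integral_mult_right) auto
  from integral_unique[OF this] show ?thesis using False
    by (simp add: pad_def sum_distrib_left mult_ac)
qed (simp add: pad_def)

lemma pad_add:
  assumes "continuous_on {0..1} f" "continuous_on {0..1} g"
  shows "pad j (\<lambda>t. f t + g t) = pad j f + pad j g"
proof -
  have "integral {0..1} (\<lambda>t. real j * t ^ (j - 1) * f t + real j * t ^ (j - 1) * g t) =
     integral {0..1} (\<lambda>t. real j * t ^ (j - 1) * f t) + integral {0..1} (\<lambda>t. real j * t ^ (j - 1) * g t)"
    using assms by (intro integral_add integrable_continuous_interval continuous_intros)
  then show ?thesis by (simp add: pad_def distrib_left)
qed

lemma pad_mono:
  assumes "continuous_on {0..1} f" "continuous_on {0..1} g" "\<And>t. t \<in> {0..1} \<Longrightarrow> f t \<le> g t"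
  shows "pad j f \<le> pad j g"
  unfolding pad_def using assms
  by (auto intro!: integral_le integrable_continuous_interval continuous_intros mult_left_mono)


text \<open>
  An upper approximation suffices below, so the function is raised by \<open>h\<close> before Weierstrass is
  applied with tolerance \<open>h\<close>. Powers of \<open>1 - v\<close> are the functions whose integrals the moment equations
  know.
\<close>

lemma polynomial_approximation:
  fixes g :: "real \<Rightarrow> real"
  assumes "continuous_on {0..1} g" "0 < h"
  obtains c n where "\<And>v. v \<in> {0..1} \<Longrightarrow> g v \<le> (\<Sum>m\<le>n. c m * (1 - v) ^ m)"
    "\<And>v. v \<in> {0..1} \<Longrightarrow> (\<Sum>m\<le>n. c m * (1 - v) ^ m) \<le> g v + 2 * h"
proof -
  have "continuous_on {0..1} (\<lambda>y. g (1 - y) + h)"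
    by (intro continuous_intros continuous_on_compose2[OF assms(1)]) auto
  from Stone_Weierstrass_real_polynomial_function[OF compact_Icc this assms(2)]
  obtain q where q: "real_polynomial_function q" "\<And>y. y \<in> {0..1} \<Longrightarrow> \<bar>g (1 - y) + h - q y\<bar> < h"
    by auto
  then obtain c n where "q = (\<lambda>y. \<Sum>m\<le>n. c m * y ^ m)"
    unfolding real_polynomial_function_iff_sum by blast
  with q(2)[of "1 - _"] that[of c n] show ?thesis
    by (force simp: abs_less_iff abs_if split: if_splits)
qed

text \<open>
  The measure \<open>F k\<close> stands for the law of the risk \<open>v\<close> of \<open>k\<close> samples, restricted to the event that
  all of them are essential. The moment equations say that among \<open>m\<close> samples some \<open>k\<close> form the basis and
  the other \<open>m - k\<close> are satisfied, each with probability \<open>1 - v\<close>.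

  If only \<open>F d\<close> carried mass, the equations would determine all its moments, hence \<open>F d\<close> itself, and the
  bound would be an equality. A smaller basis is padded: \<open>v\<close> is replaced by \<open>v + (1 - v) t\<close>, where \<open>t\<close> is
  the maximum of \<open>d - k\<close> uniform points. This only increases \<open>v\<close>, and it turns the equations into those
  of the case where all bases have \<open>d\<close> elements. The indicator of the tail is not a polynomial; a ramp
  between \<open>e'\<close> and \<open>e\<close> is, up to the error \<open>h\<close>.
\<close>

lemma moment_tail_bound_aux:
  fixes F :: "nat \<Rightarrow> real measure"
  assumes fin: "\<And>k. k \<le> d \<Longrightarrow> finite_measure (F k)" and sets: "\<And>k. k \<le> d \<Longrightarrow> sets (F k) = sets borel"
    and supp: "\<And>k. k \<le> d \<Longrightarrow> AE v in F k. v \<in> {0..1}"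
    and mom: "\<And>m. (\<Sum>k\<le>d. real (m choose k) * (\<integral>v. (1 - v) ^ (m - k) \<partial>F k)) = 1"
    and d: "0 < d" "d \<le> N" and e: "0 \<le> e'" "e' < e" "e \<le> 1" and h: "0 < h"
  shows "(\<Sum>k\<le>d. real (N choose k) * (\<integral>v. indicator {e<..} v * (1 - v) ^ (N - k) \<partial>F k))
         \<le> binomial_tail d N e' + real (N choose d) * (2 * h)"
proof -
  \<comment> \<open>a ramp from 0 at e' to 1 at e; it dominates the indicator of the tail beyond e and vanishes below e'\<close>
  define r where "r v = max 0 (min 1 ((v - e') / (e - e')))" for v :: real
  define g where "g v = (1 - v) ^ (N - d) * r v" for v :: real
  have r: "0 \<le> r v" "r v \<le> 1" "v \<le> e' \<Longrightarrow> r v = 0" "e \<le> v \<Longrightarrow> r v = 1" for v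
    using e divide_nonpos_pos[of "v - e'" "e - e'"] by (auto simp: r_def le_divide_eq min_absorb1)
  have cg: "continuous_on S g" for S
    unfolding g_def r_def using e by (intro continuous_intros) auto
  obtain c n where q: "\<And>v. v \<in> {0..1} \<Longrightarrow> g v \<le> (\<Sum>m\<le>n. c m * (1 - v) ^ m)"
    "\<And>v. v \<in> {0..1} \<Longrightarrow> (\<Sum>m\<le>n. c m * (1 - v) ^ m) \<le> g v + 2 * h"
    using polynomial_approximation[OF cg h] by blast
  define q where "q v = (\<Sum>m\<le>n. c m * (1 - v) ^ m)" for v :: real
  have cq: "continuous_on S q" for S unfolding q_def by (intro continuous_intros)
  \<comment> \<open>on the right-hand side stands the padded polynomial; padding moves a point above e only further up\<close>
  have step1: "indicator {e<..} v * (1 - v) ^ (N - k) \<le>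
      real ((N - k) choose (d - k)) * (\<Sum>m\<le>n. c m * (1 - v) ^ (m + (d - k)) / real ((m + (d - k)) choose (d - k)))"
    if k: "k \<le> d" and v: "v \<in> {0..1}" for k v
  proof -
    let ?j = "d - k"
    have vt: "v + (1 - v) * t \<in> {0..1}" "v \<le> v + (1 - v) * t" if "t \<in> {0..1}" for t
      using that v mult_left_le[of t "1 - v"] mult_nonneg_nonneg[of "1 - v" t] by (auto simp: algebra_simps)
    have pad_q: "pad ?j (\<lambda>t. q (v + (1 - v) * t)) = (\<Sum>m\<le>n. c m * (1 - v) ^ m / real ((m + ?j) choose ?j))"
    proof -
      have "q (v + (1 - v) * t) = (\<Sum>m\<le>n. (c m * (1 - v) ^ m) * (1 - t) ^ m)" for t
        unfolding q_def by (intro sum.cong refl) (simp add: power_mult_distrib[symmetric] algebra_simps)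
      then show ?thesis using pad_sum_power[of ?j "\<lambda>m. c m * (1 - v) ^ m" n] by simp
    qed
    have "indicator {e<..} v * (1 - v) ^ (N - d) * (1 / real ((N - k) choose ?j)) \<le> pad ?j (\<lambda>t. q (v + (1 - v) * t))"
    proof -
      have "N - d + ?j = N - k" using d k by simp
      then have "indicator {e<..} v * (1 - v) ^ (N - d) * (1 / real ((N - k) choose ?j)) =
          pad ?j (\<lambda>t. \<Sum>m\<le>N-d. (if m = N - d then indicator {e<..} v * (1 - v) ^ (N - d) else 0) * (1 - t) ^ m)"
        unfolding pad_sum_power by (simp add: if_distrib[of "\<lambda>x. x / _"] cong: if_cong)
      also have "\<dots> \<le> pad ?j (\<lambda>t. q (v + (1 - v) * t))"
      proof (rule pad_mono)
        fix t :: real assume t: "t \<in> {0..1}"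
        have "(\<Sum>m\<le>N-d. (if m = N - d then indicator {e<..} v * (1 - v) ^ (N - d) else 0) * (1 - t) ^ m)
            = indicator {e<..} v * (1 - v) ^ (N - d) * (1 - t) ^ (N - d)"
          by (simp add: if_distrib[of "\<lambda>x. x * _"] cong: if_cong)
        also have "\<dots> = indicator {e<..} v * (1 - (v + (1 - v) * t)) ^ (N - d)"
          by (simp add: power_mult_distrib[symmetric] algebra_simps)
        also have "\<dots> \<le> g (v + (1 - v) * t)"
          unfolding g_def using vt[OF t] r[of "v + (1 - v) * t"]
          by (auto simp: indicator_def)
        also have "\<dots> \<le> q (v + (1 - v) * t)" unfolding q_def by (rule q(1)[OF vt(1)[OF t]])
        finally show "(\<Sum>m\<le>N-d. (if m = N - d then indicator {e<..} v * (1 - v) ^ (N - d) else 0) * (1 - t) ^ m)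
          \<le> q (v + (1 - v) * t)" .
      qed (intro continuous_intros continuous_on_compose2[OF cq[of UNIV]]; simp)+
      finally show ?thesis .
    qed
    moreover have "0 < real ((N - k) choose ?j)" using d k by (simp add: zero_less_binomial_iff)
    ultimately have "indicator {e<..} v * (1 - v) ^ (N - d) \<le> real ((N - k) choose ?j) * pad ?j (\<lambda>t. q (v + (1 - v) * t))"
      by (simp add: field_simps)
    then have "indicator {e<..} v * (1 - v) ^ (N - d) * (1 - v) ^ ?j \<le> real ((N - k) choose ?j) * pad ?j (\<lambda>t. q (v + (1 - v) * t)) * (1 - v) ^ ?j"
      using v by (intro mult_right_mono) auto
    moreover have "(1 - v) ^ (N - d) * (1 - v) ^ ?j = (1 - v) ^ (N - k)"
      using d k by (simp add: power_add[symmetric])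
    ultimately show ?thesis
      unfolding pad_q by (simp add: mult.assoc sum_distrib_right power_add)
  qed
  have intp: "integrable (F k) (\<lambda>v. (1 - v) ^ i)" if "k \<le> d" for k i
  proof -
    interpret finite_measure "F k" by (rule fin[OF that])
    have "AE v in F k. norm ((1 - v) ^ i) \<le> 1"
      using supp[OF that] by eventually_elim (simp add: power_le_one)
    moreover have "(\<lambda>v. (1 - v) ^ i) \<in> borel_measurable (F k)"
      using sets[OF that] by (simp cong: measurable_cong_sets)
    ultimately show ?thesis by (rule integrable_const_bound[of _ 1])
  qed
  have inti: "integrable (F k) (\<lambda>v. indicator {e<..} v * (1 - v) ^ i)" if "k \<le> d" for k i
    using integrable_real_mult_indicator[OF _ intp[OF that], of "{e<..}" i] sets[OF that] by (simp add: mult.commute)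
  have step2: "(\<integral>v. indicator {e<..} v * (1 - v) ^ (N - k) \<partial>F k) \<le>
      real ((N - k) choose (d - k)) * (\<Sum>m\<le>n. c m * (\<integral>v. (1 - v) ^ (m + (d - k)) \<partial>F k) / real ((m + (d - k)) choose (d - k)))"
    if k: "k \<le> d" for k
  proof -
    have "(\<integral>v. indicator {e<..} v * (1 - v) ^ (N - k) \<partial>F k) \<le>
      (\<integral>v. real ((N - k) choose (d - k)) * (\<Sum>m\<le>n. c m * (1 - v) ^ (m + (d - k)) / real ((m + (d - k)) choose (d - k))) \<partial>F k)"
      by (intro integral_mono_AE inti k integrable_mult_right Bochner_Integration.integrable_sum integrable_divide intp
            eventually_mono[OF supp[OF k] step1[OF k]])
    also have "\<dots> = real ((N - k) choose (d - k)) * (\<Sum>m\<le>n. c m * (\<integral>v. (1 - v) ^ (m + (d - k)) \<partial>F k) / real ((m + (d - k)) choose (d - k)))"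
      using intp[OF k] by (simp add: integral_sum)
    finally show ?thesis .
  qed
  have "(\<Sum>k\<le>d. real (N choose k) * (\<integral>v. indicator {e<..} v * (1 - v) ^ (N - k) \<partial>F k)) \<le>
    (\<Sum>k\<le>d. real (N choose k) * (real ((N - k) choose (d - k)) * (\<Sum>m\<le>n. c m * (\<integral>v. (1 - v) ^ (m + (d - k)) \<partial>F k) / real ((m + (d - k)) choose (d - k)))))"
    by (intro sum_mono mult_left_mono step2) auto
  also have "\<dots> = (\<Sum>k\<le>d. \<Sum>m\<le>n. real (N choose d) * (c m / real ((m + d) choose d)) * (real ((m + d) choose k) * (\<integral>v. (1 - v) ^ (m + d - k) \<partial>F k)))"
  proof (intro sum.cong refl)
    fix k assume "k \<in> {..d}"
    then have k: "k \<le> d" by simp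
    have 1: "real (N choose k) * real ((N - k) choose (d - k)) = real (N choose d) * real (d choose k)"
      using choose_mult[OF k d(2)] by (metis of_nat_mult)
    have 2: "real (d choose k) / real ((m + (d - k)) choose (d - k)) = real ((m + d) choose k) / real ((m + d) choose d)" for m
    proof -
      have "real ((m + d) choose d) * real (d choose k) = real ((m + d) choose k) * real ((m + d - k) choose (d - k))"
        using choose_mult[OF k, of "m + d"] by (metis of_nat_mult le_add2)
      moreover have "m + (d - k) = m + d - k" using k by simp
      moreover have "0 < real ((m + d) choose d)" "0 < real ((m + d - k) choose (d - k))"
        using k by (simp_all add: zero_less_binomial_iff)
      ultimately show ?thesis by (simp add: field_simps)
    qed
    have "real (N choose k) * (real ((N - k) choose (d - k)) * (\<Sum>m\<le>n. c m * (\<integral>v. (1 - v) ^ (m + (d - k)) \<partial>F k) / real ((m + (d - k)) choose (d - k)))) =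
      (\<Sum>m\<le>n. (real (N choose k) * real ((N - k) choose (d - k))) * (c m * (\<integral>v. (1 - v) ^ (m + (d - k)) \<partial>F k) / real ((m + (d - k)) choose (d - k))))"
      by (simp add: sum_distrib_left mult.assoc)
    also have "\<dots> = (\<Sum>m\<le>n. real (N choose d) * c m * (\<integral>v. (1 - v) ^ (m + (d - k)) \<partial>F k) * (real (d choose k) / real ((m + (d - k)) choose (d - k))))"
      unfolding 1 by (simp add: mult_ac)
    also have "\<dots> = (\<Sum>m\<le>n. real (N choose d) * (c m / real ((m + d) choose d)) * (real ((m + d) choose k) * (\<integral>v. (1 - v) ^ (m + d - k) \<partial>F k)))"
      unfolding 2 using k by (intro sum.cong refl) (simp add: mult_ac)
    finally show "real (N choose k) * (real ((N - k) choose (d - k)) * (\<Sum>m\<le>n. c m * (\<integral>v. (1 - v) ^ (m + (d - k)) \<partial>F k) / real ((m + (d - k)) choose (d - k)))) = \<dots>" .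
  qed
  also have "\<dots> = (\<Sum>m\<le>n. real (N choose d) * (c m / real ((m + d) choose d)) * (\<Sum>k\<le>d. real ((m + d) choose k) * (\<integral>v. (1 - v) ^ (m + d - k) \<partial>F k)))"
    by (subst sum.swap) (simp add: sum_distrib_left)
  also have "\<dots> = real (N choose d) * pad d q"
    unfolding mom q_def pad_sum_power by (simp add: sum_distrib_left)
  also have "\<dots> \<le> real (N choose d) * (pad d g + 2 * h)"
  proof (rule mult_left_mono)
    have "pad d q \<le> pad d (\<lambda>t. g t + 2 * h)"
      using q(2) by (intro pad_mono cq cg continuous_intros) (simp_all add: q_def)
    also have "\<dots> = pad d g + pad d (\<lambda>t. \<Sum>m\<le>0. (2 * h) * (1 - t) ^ m)"
      using pad_add[OF cg, of "\<lambda>t. 2 * h" d] by simp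
    also have "pad d (\<lambda>t. \<Sum>m\<le>0. (2 * h) * (1 - t) ^ m) = 2 * h" unfolding pad_sum_power by simp
    finally show "pad d q \<le> pad d g + 2 * h" .
  qed simp
  also have "\<dots> = real (N choose d) * pad d g + real (N choose d) * (2 * h)"
    by (rule distrib_left)
  also have "real (N choose d) * pad d g \<le> binomial_tail d N e'"
  proof -
    obtain d' where d': "d = Suc d'" using d by (cases d) auto
    let ?f = "\<lambda>t. real (Suc d') * real (N choose Suc d') * t ^ d' * (1 - t) ^ (N - Suc d')"
    have I: "(?f has_integral binomial_tail (Suc d') N e') {e'..1}"
      by (rule binomial_tail_integral) (use d d' e in auto)
    have c: "continuous_on S (\<lambda>t. real (N choose d) * (real d * t ^ (d - 1) * g t))" for S
      by (intro continuous_intros cg)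
    have "real (N choose d) * pad d g = integral {0..1} (\<lambda>t. real (N choose d) * (real d * t ^ (d - 1) * g t))"
      using d by (simp add: pad_def)
    also have "\<dots> = integral {0..e'} (\<lambda>t. real (N choose d) * (real d * t ^ (d - 1) * g t)) + integral {e'..1} (\<lambda>t. real (N choose d) * (real d * t ^ (d - 1) * g t))"
      using e c by (intro Henstock_Kurzweil_Integration.integral_combine[symmetric] integrable_continuous_interval) auto
    also have "integral {0..e'} (\<lambda>t. real (N choose d) * (real d * t ^ (d - 1) * g t)) = integral {0..e'} (\<lambda>t. 0)"
      by (rule integral_cong) (simp add: g_def r)
    also have "integral {e'..1} (\<lambda>t. real (N choose d) * (real d * t ^ (d - 1) * g t)) \<le> integral {e'..1} ?f"
    proof (rule integral_le)
      fix t assume t: "t \<in> {e'..1}"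
      have "real (Suc d') * real (N choose Suc d') * t ^ d' * ((1 - t) ^ (N - Suc d') * r t) \<le>
         real (Suc d') * real (N choose Suc d') * t ^ d' * ((1 - t) ^ (N - Suc d') * 1)"
        using t e r by (intro mult_left_mono) auto
      then show "real (N choose d) * (real d * t ^ (d - 1) * g t) \<le> ?f t"
        unfolding g_def d' by (simp add: mult_ac)
    qed (use I c in \<open>auto intro: integrable_continuous_interval\<close>)
    finally show ?thesis using integral_unique[OF I] by (simp add: d')
  qed
  finally show ?thesis by simp
qed

text \<open>
  Both the error \<open>h\<close> and the width of the ramp can be made arbitrarily small, since the bound is
  continuous in \<open>e\<close>.
\<close>

lemma moment_tail_bound:
  fixes F :: "nat \<Rightarrow> real measure"
  assumes fin: "\<And>k. k \<le> d \<Longrightarrow> finite_measure (F k)" and sets: "\<And>k. k \<le> d \<Longrightarrow> sets (F k) = sets borel"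
    and supp: "\<And>k. k \<le> d \<Longrightarrow> AE v in F k. v \<in> {0..1}"
    and mom: "\<And>m. (\<Sum>k\<le>d. real (m choose k) * (\<integral>v. (1 - v) ^ (m - k) \<partial>F k)) = 1"
    and d: "0 < d" "d \<le> N" and e: "0 < e" "e \<le> 1"
  shows "(\<Sum>k\<le>d. real (N choose k) * (\<integral>v. indicator {e<..} v * (1 - v) ^ (N - k) \<partial>F k)) \<le> binomial_tail d N e"
proof -
  let ?L = "(\<Sum>k\<le>d. real (N choose k) * (\<integral>v. indicator {e<..} v * (1 - v) ^ (N - k) \<partial>F k))"
  have "?L \<le> binomial_tail d N e'" if e': "0 \<le> e'" "e' < e" for e'
  proof (rule field_le_epsilon)
    fix h :: real assume h: "0 < h"
    have C: "0 < real (N choose d)" using d by (simp add: zero_less_binomial_iff)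
    show "?L \<le> binomial_tail d N e' + h"
      using moment_tail_bound_aux[OF fin sets supp mom d e' e(2), of "h / (2 * real (N choose d))"] h C by simp
  qed
  moreover have "((\<lambda>x. binomial_tail d N x) \<longlongrightarrow> binomial_tail d N e) (at_left e)"
  proof -
    have "isCont (binomial_tail d N) e"
      using continuous_on_binomial_tail[of UNIV d N] continuous_on_eq_continuous_at[OF open_UNIV] by blast
    then show ?thesis unfolding isCont_def filterlim_at_split by blast
  qed
  moreover have "\<forall>\<^sub>F x in at_left e. 0 \<le> x \<and> x < e"
    using e(1) by (intro eventually_at_leftI[of 0]) auto
  ultimately show ?thesis
    by (intro tendsto_lowerbound[of _ _ "at_left e"]) (auto elim!: eventually_mono)
qed

section \<open>Risk of stable solution maps\<close>

text \<open>
  An abstract program: \<open>sol C\<close> is the solution for the finite set \<open>C\<close> of constraints, \<open>viol\<close> says that a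
  solution breaks a constraint, and \<open>act\<close> that a constraint holds without slack. Constraints that already
  hold can be added without changing the solution. A set in which every element is violated by the
  solution for the others is a support set, and \<open>d\<close> bounds its size.
\<close>

locale stable_scenario = prob_space M for M :: "'z measure" +
  fixes sol :: "'z set \<Rightarrow> 's" and viol act :: "'s \<Rightarrow> 'z \<Rightarrow> bool" and d :: nat
  assumes satisfied: "\<And>C z. finite C \<Longrightarrow> C \<subseteq> space M \<Longrightarrow> z \<in> C \<Longrightarrow> \<not> viol (sol C) z"
    and stable: "\<And>C D. finite C \<Longrightarrow> C \<subseteq> space M \<Longrightarrow> finite D \<Longrightarrow> D \<subseteq> space M \<Longrightarrow>
          \<forall>z\<in>D. \<not> viol (sol C) z \<Longrightarrow> sol (C \<union> D) = sol C"
    and viol_imp_act: "\<And>C z. finite C \<Longrightarrow> C \<subseteq> space M \<Longrightarrow> z \<in> space M \<Longrightarrow> viol (sol C) z \<Longrightarrow> act (sol (insert z C)) z"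
    and card_support_le: "\<And>C. finite C \<Longrightarrow> C \<subseteq> space M \<Longrightarrow> (\<And>z. z \<in> C \<Longrightarrow> viol (sol (C - {z})) z) \<Longrightarrow> card C \<le> d"
    and AE_inactive: "\<And>C. finite C \<Longrightarrow> C \<subseteq> space M \<Longrightarrow> AE z in M. \<not> act (sol C) z"
    and measurable_viol: "\<And>I :: nat set. finite I \<Longrightarrow>
          Measurable.pred (PiM I (\<lambda>_. M) \<Otimes>\<^sub>M M) (\<lambda>p. viol (sol (fst p ` I)) (snd p))"
    and measurable_act: "\<And>I :: nat set. finite I \<Longrightarrow>
          Measurable.pred (PiM I (\<lambda>_. M) \<Otimes>\<^sub>M M) (\<lambda>p. act (sol (fst p ` I)) (snd p))"
begin

abbreviation PM :: "nat set \<Rightarrow> (nat \<Rightarrow> 'z) measure" where "PM I \<equiv> PiM I (\<lambda>_. M)"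

definition risk :: "'z set \<Rightarrow> real" where
  "risk C = measure M {z \<in> space M. viol (sol C) z}"

definition essential :: "nat set \<Rightarrow> (nat \<Rightarrow> 'z) \<Rightarrow> bool" where
  "essential K \<omega> \<longleftrightarrow> (\<forall>i\<in>K. viol (sol (\<omega> ` (K - {i}))) (\<omega> i))"

text \<open>
  The solution for the sample indices \<open>I\<close> is already the solution for \<open>K\<close>, and no index of \<open>K\<close> can be
  dropped.
\<close>

definition basis :: "nat set \<Rightarrow> nat set \<Rightarrow> (nat \<Rightarrow> 'z) \<Rightarrow> bool" where
  "basis I K \<omega> \<longleftrightarrow> essential K \<omega> \<and> (\<forall>i\<in>I - K. \<not> viol (sol (\<omega> ` K)) (\<omega> i))"

sublocale product: product_sigma_finite "\<lambda>_::nat. M" ..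

lemma prob_space_PM: "prob_space (PM I)"
  by (intro prob_space_PiM prob_space_axioms)

lemma image_in_space: "\<omega> \<in> space (PM I) \<Longrightarrow> J \<subseteq> I \<Longrightarrow> \<omega> ` J \<subseteq> space M"
  by (auto simp: space_PiM)

lemma measurable_at:
  assumes "finite I" "J \<subseteq> I" "i \<in> I"
  shows measurable_viol_at: "Measurable.pred (PM I) (\<lambda>\<omega>. viol (sol (\<omega> ` J)) (\<omega> i))"
    and measurable_act_at: "Measurable.pred (PM I) (\<lambda>\<omega>. act (sol (\<omega> ` J)) (\<omega> i))"
proof -
  have J: "finite J" using assms finite_subset by auto
  have "(\<lambda>\<omega>. (restrict \<omega> J, \<omega> i)) \<in> PM I \<rightarrow>\<^sub>M PM J \<Otimes>\<^sub>M M"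
    using assms by (intro measurable_Pair measurable_restrict_subset measurable_component_singleton)
  from measurable_compose[OF this measurable_viol[OF J]] measurable_compose[OF this measurable_act[OF J]]
  show "Measurable.pred (PM I) (\<lambda>\<omega>. viol (sol (\<omega> ` J)) (\<omega> i))"
    "Measurable.pred (PM I) (\<lambda>\<omega>. act (sol (\<omega> ` J)) (\<omega> i))" by simp_all
qed

lemma measurable_risk:
  assumes "finite I" "J \<subseteq> I"
  shows "(\<lambda>\<omega>. risk (\<omega> ` J)) \<in> borel_measurable (PM I)"
proof -
  have J: "finite J" using assms finite_subset by auto
  let ?Q = "{p \<in> space (PM J \<Otimes>\<^sub>M M). viol (sol (fst p ` J)) (snd p)}"
  have "?Q \<in> sets (PM J \<Otimes>\<^sub>M M)" using measurable_viol[OF J] by measurable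
  from measurable_emeasure_Pair[OF this]
  have "(\<lambda>\<omega>. enn2real (emeasure M (Pair \<omega> -` ?Q))) \<in> borel_measurable (PM J)" by measurable
  moreover have "enn2real (emeasure M (Pair \<omega> -` ?Q)) = risk (\<omega> ` J)" if "\<omega> \<in> space (PM J)" for \<omega>
  proof -
    have "Pair \<omega> -` ?Q = {z \<in> space M. viol (sol (\<omega> ` J)) z}"
      using that by (auto simp: space_pair_measure)
    then show ?thesis by (simp add: risk_def measure_def)
  qed
  ultimately have "(\<lambda>\<omega>. risk (\<omega> ` J)) \<in> borel_measurable (PM J)"
    by (simp cong: measurable_cong)
  from measurable_compose[OF measurable_restrict_subset[OF assms(2)] this]
  show ?thesis by simp
qed

lemma risk_bounds: "0 \<le> risk C" "risk C \<le> 1"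
  by (simp_all add: risk_def)

lemma measurable_essential [measurable]:
  assumes "finite I" "K \<subseteq> I" shows "Measurable.pred (PM I) (essential K)"
proof -
  have "finite K" using assms finite_subset by auto
  then show ?thesis unfolding essential_def [abs_def] using assms
    by (intro pred_intros_finite measurable_viol_at) auto
qed

lemma measurable_basis:
  assumes "finite I" "K \<subseteq> I" shows "Measurable.pred (PM I) (basis I K)"
  unfolding basis_def [abs_def] using assms
  by (intro pred_intros_logic pred_intros_finite measurable_essential measurable_viol_at) auto

lemma basis_solution:
  assumes "finite I" "K \<subseteq> I" "\<omega> \<in> space (PM I)" "basis I K \<omega>" "K \<subseteq> J" "J \<subseteq> I"
  shows "sol (\<omega> ` J) = sol (\<omega> ` K)"
proof -
  have "finite J" using assms(1,6) finite_subset by auto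
  moreover have "finite K" using assms(1,2) finite_subset by auto
  moreover have "\<omega> ` K \<subseteq> space M" "\<omega> ` J \<subseteq> space M" using image_in_space assms by auto
  moreover have "\<forall>z\<in>\<omega> ` J. \<not> viol (sol (\<omega> ` K)) z"
    using assms satisfied[of "\<omega> ` K"] calculation unfolding basis_def by blast
  ultimately have "sol (\<omega> ` K \<union> \<omega> ` J) = sol (\<omega> ` K)" by (intro stable) auto
  moreover have "\<omega> ` K \<union> \<omega> ` J = \<omega> ` J" using assms by auto
  ultimately show ?thesis by simp
qed

text \<open>
  A subset of minimal size with the same solution.
\<close>

lemma basis_exists:
  assumes "finite I" "\<omega> \<in> space (PM I)"
  shows "\<exists>K\<subseteq>I. basis I K \<omega>"
proof -
  define P where "P K \<longleftrightarrow> K \<subseteq> I \<and> sol (\<omega> ` K) = sol (\<omega> ` I)" for K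
  have "\<exists>K. P K" by (auto simp: P_def)
  then obtain K where K: "P K" "\<And>L. P L \<Longrightarrow> card K \<le> card L"
    using ex_has_least_nat[of P _ card] by blast
  have KI: "K \<subseteq> I" "finite K" using K(1) assms finite_subset by (auto simp: P_def)
  have "essential K \<omega>" unfolding essential_def
  proof (rule ballI, rule ccontr)
    fix i assume i: "i \<in> K" and nv: "\<not> viol (sol (\<omega> ` (K - {i}))) (\<omega> i)"
    have "sol (\<omega> ` (K - {i}) \<union> {\<omega> i}) = sol (\<omega> ` (K - {i}))"
      using nv i KI image_in_space[OF assms(2)] by (intro stable) auto
    moreover have "\<omega> ` (K - {i}) \<union> {\<omega> i} = \<omega> ` K" using i by auto
    ultimately have "P (K - {i})" using K(1) by (auto simp: P_def)
    then show False using K(2)[of "K - {i}"] i KI card_Diff1_less[OF KI(2) i] by simp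
  qed
  moreover have "\<not> viol (sol (\<omega> ` K)) (\<omega> i)" if "i \<in> I - K" for i
    using that K(1) satisfied[of "\<omega> ` I" "\<omega> i"] assms image_in_space[OF assms(2), of I] by (auto simp: P_def)
  ultimately show ?thesis using KI by (auto simp: basis_def)
qed

text \<open>
  A repeated sample is never essential, so an essential family is injective.
\<close>

lemma card_essential_le:
  assumes "finite K" "\<omega> ` K \<subseteq> space M" "essential K \<omega>"
  shows "card K \<le> d"
proof -
  have inj: "inj_on \<omega> K"
  proof (rule inj_onI, rule ccontr)
    fix i j assume ij: "i \<in> K" "j \<in> K" "\<omega> i = \<omega> j" "i \<noteq> j"
    then have "\<not> viol (sol (\<omega> ` (K - {i}))) (\<omega> i)"
      using assms by (intro satisfied) auto
    then show False using assms ij by (auto simp: essential_def)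
  qed
  have "viol (sol (\<omega> ` K - {z})) z" if "z \<in> \<omega> ` K" for z
  proof -
    obtain i where i: "i \<in> K" "z = \<omega> i" using \<open>z \<in> \<omega> ` K\<close> by blast
    have "\<omega> ` K - {z} = \<omega> ` (K - {i})" using inj i by (auto simp: inj_on_def)
    then show ?thesis using assms(3) i by (auto simp: essential_def)
  qed
  then have "card (\<omega> ` K) \<le> d" using assms by (intro card_support_le) auto
  then show ?thesis using card_image[OF inj] by simp
qed

lemma AE_inactive_sample:
  assumes "finite I" "i \<in> I"
  shows "AE \<omega> in PM I. \<not> act (sol (\<omega> ` (I - {i}))) (\<omega> i)"
proof -
  let ?N = "{\<omega> \<in> space (PM I). act (sol (\<omega> ` (I - {i}))) (\<omega> i)}"
  have N: "?N \<in> sets (PM I)" using measurable_act_at[OF assms(1) _ assms(2), of "I - {i}"] by measurable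
  have I: "insert i (I - {i}) = I" using assms by auto
  have "emeasure (PM I) ?N = (\<integral>\<^sup>+\<omega>. indicator ?N \<omega> \<partial>PM (insert i (I - {i})))" using N I by simp
  also have "\<dots> = (\<integral>\<^sup>+\<omega>. (\<integral>\<^sup>+y. indicator ?N (fun_upd \<omega> i y) \<partial>M) \<partial>PM (I - {i}))"
    using N I assms by (intro product.product_nn_integral_insert) auto
  also have "\<dots> = (\<integral>\<^sup>+\<omega>. 0 \<partial>PM (I - {i}))"
  proof (rule nn_integral_cong)
    fix \<omega> assume w: "\<omega> \<in> space (PM (I - {i}))"
    have "AE y in M. \<not> act (sol (\<omega> ` (I - {i}))) y"
      using assms image_in_space[OF w] by (intro AE_inactive) auto
    moreover have "(fun_upd \<omega> i y) ` (I - {i}) = \<omega> ` (I - {i})" for y by auto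
    ultimately have "AE y in M. indicator ?N (fun_upd \<omega> i y) = (0::ennreal)" by (auto simp: indicator_def)
    then show "(\<integral>\<^sup>+y. indicator ?N (fun_upd \<omega> i y) \<partial>M) = 0"
      using nn_integral_cong_AE[of "\<lambda>y. indicator ?N (fun_upd \<omega> i y)" "\<lambda>_. 0"] by simp
  qed
  finally have "emeasure (PM I) ?N = 0" by simp
  then show ?thesis using N by (subst AE_iff_measurable[OF N]) auto
qed

text \<open>
  If an index \<open>i\<close> belongs to one basis but not to another one, then the solution for all samples is the
  solution without sample \<open>i\<close>, which is independent of that sample; yet sample \<open>i\<close> is active there, because
  it is essential in the first basis. This has probability zero.
\<close>

lemma AE_basis_unique:
  assumes "finite I"
  shows "AE \<omega> in PM I. \<exists>!K. K \<subseteq> I \<and> basis I K \<omega>"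
proof -
  have "AE \<omega> in PM I. \<forall>i\<in>I. \<not> act (sol (\<omega> ` (I - {i}))) (\<omega> i)"
    using assms AE_inactive_sample by (intro AE_finite_allI) auto
  moreover have "AE \<omega> in PM I. \<omega> \<in> space (PM I)" by (rule AE_space)
  ultimately show ?thesis
  proof eventually_elim
    case (elim \<omega>)
    have *: "K \<subseteq> L" if K: "K \<subseteq> I" "basis I K \<omega>" and L: "L \<subseteq> I" "basis I L \<omega>" for K L
    proof (rule subsetI, rule ccontr)
      fix i assume i: "i \<in> K" "i \<notin> L"
      have iI: "i \<in> I" using i K by auto
      have "viol (sol (\<omega> ` (K - {i}))) (\<omega> i)" using K i by (auto simp: basis_def essential_def)
      then have "act (sol (insert (\<omega> i) (\<omega> ` (K - {i})))) (\<omega> i)"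
        using K iI assms finite_subset[OF K(1)] image_in_space[OF elim(2)] by (intro viol_imp_act) auto
      moreover have "insert (\<omega> i) (\<omega> ` (K - {i})) = \<omega> ` K" using i by auto
      moreover have "sol (\<omega> ` K) = sol (\<omega> ` I)" using basis_solution[OF assms K(1) elim(2) K(2), of I] K by simp
      moreover have "sol (\<omega> ` I) = sol (\<omega> ` L)" using basis_solution[OF assms L(1) elim(2) L(2), of I] L by simp
      moreover have "sol (\<omega> ` (I - {i})) = sol (\<omega> ` L)"
        using basis_solution[OF assms L(1) elim(2) L(2), of "I - {i}"] L i by auto
      ultimately show False using elim(1) iI by auto
    qed
    obtain K where "K \<subseteq> I" "basis I K \<omega>" using basis_exists[OF assms elim(2)] by auto
    with * show ?case by (intro ex1I[of _ K]) auto
  qed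
qed

text \<open>
  The law of the risk of \<open>k\<close> samples on the event that they are all essential; its total mass is in
  general smaller than 1.
\<close>

definition risk_law :: "nat \<Rightarrow> real measure" where
  "risk_law k = distr (density (PM {..<k}) (indicator {\<omega> \<in> space (PM {..<k}). essential {..<k} \<omega>})) borel (\<lambda>\<omega>. risk (\<omega> ` {..<k}))"

lemma sets_risk_law [simp, measurable_cong]: "sets (risk_law k) = sets borel"
  by (simp add: risk_law_def)

lemma nn_integral_risk_law:
  assumes [measurable]: "h \<in> borel_measurable borel"
  shows "(\<integral>\<^sup>+v. h v \<partial>risk_law k) = (\<integral>\<^sup>+\<omega>. indicator {\<omega>. essential {..<k} \<omega>} \<omega> * h (risk (\<omega> ` {..<k})) \<partial>PM {..<k})"
proof -
  let ?E = "{\<omega> \<in> space (PM {..<k}). essential {..<k} \<omega>}"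
  have [measurable]: "(\<lambda>\<omega>. risk (\<omega> ` {..<k})) \<in> borel_measurable (PM {..<k})" by (rule measurable_risk) auto
  have [measurable]: "?E \<in> sets (PM {..<k})" using measurable_essential[of "{..<k}" "{..<k}"] by measurable
  have "(\<integral>\<^sup>+v. h v \<partial>risk_law k) = (\<integral>\<^sup>+\<omega>. indicator ?E \<omega> * h (risk (\<omega> ` {..<k})) \<partial>PM {..<k})"
    unfolding risk_law_def by (subst nn_integral_distr; (subst nn_integral_density)?) auto
  also have "\<dots> = (\<integral>\<^sup>+\<omega>. indicator {\<omega>. essential {..<k} \<omega>} \<omega> * h (risk (\<omega> ` {..<k})) \<partial>PM {..<k})"
    by (intro nn_integral_cong) (auto simp: indicator_def)
  finally show ?thesis .
qed

lemma emeasure_risk_law_le: "emeasure (risk_law k) (space (risk_law k)) \<le> 1"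
proof -
  interpret P: prob_space "PM {..<k}" by (rule prob_space_PM)
  have "emeasure (risk_law k) (space (risk_law k)) = (\<integral>\<^sup>+v. 1 \<partial>risk_law k)" by simp
  also have "\<dots> \<le> (\<integral>\<^sup>+\<omega>. 1 \<partial>PM {..<k})"
    by (subst nn_integral_risk_law, simp, intro nn_integral_mono) (simp add: indicator_def)
  also have "\<dots> = 1" by (simp add: P.emeasure_space_1)
  finally show ?thesis .
qed

lemma finite_measure_risk_law: "finite_measure (risk_law k)"
  using emeasure_risk_law_le[of k] by (intro finite_measureI) (auto simp: top_unique)

lemma AE_risk_law: "AE v in risk_law k. v \<in> {0..1}"
proof -
  have "(\<lambda>\<omega>. risk (\<omega> ` {..<k})) \<in> borel_measurable (PM {..<k})" by (rule measurable_risk) auto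
  then have [measurable]: "(\<lambda>\<omega>. risk (\<omega> ` {..<k})) \<in> borel_measurable (density (PM {..<k}) (indicator {\<omega> \<in> space (PM {..<k}). essential {..<k} \<omega>}))"
    by simp
  show ?thesis unfolding risk_law_def
    by (subst AE_distr_iff) (use risk_bounds in auto)
qed

text \<open>
  The samples are exchangeable, so only the number of indices matters.
\<close>

lemma nn_integral_essential_reindex:
  assumes K: "finite K" and [measurable]: "h \<in> borel_measurable borel"
  shows "(\<integral>\<^sup>+\<omega>. indicator {\<omega>. essential K \<omega>} \<omega> * h (risk (\<omega> ` K)) \<partial>PM K) = (\<integral>\<^sup>+v. h v \<partial>risk_law (card K))"
proof -
  let ?k = "card K"
  obtain b where b: "bij_betw b {..<?k} K"
    using ex_bij_betw_nat_finite[OF K] by (auto simp: atLeast0LessThan)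
  then have inj: "inj_on b {..<?k}" and img: "b ` {..<?k} = K" by (auto simp: bij_betw_def)
  define t where "t \<omega> = (\<lambda>n\<in>{..<?k}. \<omega> (b n))" for \<omega> :: "nat \<Rightarrow> 'z"
  have im: "t \<omega> ` S = \<omega> ` (b ` S)" if "S \<subseteq> {..<?k}" for \<omega> S
    using that by (force simp: t_def image_image intro!: image_cong)
  have ess: "essential {..<?k} (t \<omega>) \<longleftrightarrow> essential K \<omega>" for \<omega>
  proof -
    have "essential K \<omega> \<longleftrightarrow> (\<forall>i\<in>b ` {..<?k}. viol (sol (\<omega> ` (K - {i}))) (\<omega> i))"
      by (simp only: essential_def img)
    also have "\<dots> \<longleftrightarrow> (\<forall>n<?k. viol (sol (\<omega> ` (K - {b n}))) (\<omega> (b n)))" by blast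
    also have "\<dots> \<longleftrightarrow> essential {..<?k} (t \<omega>)"
    proof -
      have "t \<omega> ` ({..<?k} - {n}) = \<omega> ` (K - {b n})" if "n < ?k" for n
      proof -
        have "b ` ({..<?k} - {n}) = K - {b n}"
          using inj_on_image_set_diff[OF inj, of "{..<?k}" "{n}"] that img by auto
        then show ?thesis using im[of "{..<?k} - {n}" \<omega>] by auto
      qed
      moreover have "t \<omega> n = \<omega> (b n)" if "n < ?k" for n using that by (simp add: t_def)
      ultimately show ?thesis unfolding essential_def by (metis lessThan_iff)
    qed
    finally show ?thesis by simp
  qed
  have [measurable]: "t \<in> PM K \<rightarrow>\<^sub>M PM {..<?k}"
    unfolding t_def [abs_def] using img by (intro measurable_restrict measurable_component_singleton) auto
  have [measurable]: "(\<lambda>\<omega>. risk (\<omega> ` {..<?k})) \<in> borel_measurable (PM {..<?k})" by (rule measurable_risk) auto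
  have [measurable]: "Measurable.pred (PM {..<?k}) (essential {..<?k})" by (rule measurable_essential) auto
  have "(\<integral>\<^sup>+v. h v \<partial>risk_law ?k) = (\<integral>\<^sup>+\<omega>. indicator {\<omega>. essential {..<?k} \<omega>} \<omega> * h (risk (\<omega> ` {..<?k})) \<partial>PM {..<?k})"
    by (rule nn_integral_risk_law) fact
  also have "PM {..<?k} = distr (PM K) (PM {..<?k}) t"
    unfolding t_def [abs_def] using inj img prob_space_axioms
    by (intro distr_PiM_reindex[where M="\<lambda>_. M", symmetric]) auto
  also have "(\<integral>\<^sup>+\<omega>. indicator {\<omega>. essential {..<?k} \<omega>} \<omega> * h (risk (\<omega> ` {..<?k})) \<partial>distr (PM K) (PM {..<?k}) t) =
     (\<integral>\<^sup>+\<omega>. indicator {\<omega>. essential {..<?k} \<omega>} (t \<omega>) * h (risk (t \<omega> ` {..<?k})) \<partial>PM K)"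
  proof (rule nn_integral_distr)
    have "(\<lambda>\<omega>. indicator {\<omega> \<in> space (PM {..<?k}). essential {..<?k} \<omega>} \<omega> * h (risk (\<omega> ` {..<?k}))) \<in> borel_measurable (PM {..<?k})"
      by measurable
    then show "(\<lambda>\<omega>. indicator {\<omega>. essential {..<?k} \<omega>} \<omega> * h (risk (\<omega> ` {..<?k}))) \<in> borel_measurable (distr (PM K) (PM {..<?k}) t)"
      unfolding measurable_distr_eq1 by (rule measurable_cong[THEN iffD1, rotated]) (auto simp: indicator_def)
  qed measurable
  also have "\<dots> = (\<integral>\<^sup>+\<omega>. indicator {\<omega>. essential K \<omega>} \<omega> * h (risk (\<omega> ` K)) \<partial>PM K)"
    using ess im[of "{..<?k}"] img by (simp add: indicator_def)
  finally show ?thesis by simp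
qed

text \<open>
  Given the samples of the basis, the remaining ones are independent, and each of them is satisfied
  with probability one minus the risk.
\<close>

lemma nn_integral_basis:
  assumes I: "finite I" and K: "K \<subseteq> I" and [measurable]: "h \<in> borel_measurable borel"
  shows "(\<integral>\<^sup>+\<omega>. indicator {\<omega>. basis I K \<omega>} \<omega> * h (risk (\<omega> ` K)) \<partial>PM I) =
         (\<integral>\<^sup>+v. h v * ennreal ((1 - v) ^ (card I - card K)) \<partial>risk_law (card K))"
proof -
  let ?J = "I - K"
  have fin: "finite K" "finite ?J" using I K finite_subset by auto
  have IJ: "K \<inter> ?J = {}" "K \<union> ?J = I" using K by auto
  have [measurable]: "Measurable.pred (PM I) (basis I K)" by (rule measurable_basis[OF I K])
  have [measurable]: "(\<lambda>\<omega>. risk (\<omega> ` K)) \<in> borel_measurable (PM I)" by (rule measurable_risk[OF I K])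
  have "(\<lambda>\<omega>. indicator {\<omega> \<in> space (PM I). basis I K \<omega>} \<omega> * h (risk (\<omega> ` K))) \<in> borel_measurable (PM I)"
    by measurable
  then have m: "(\<lambda>\<omega>. indicator {\<omega>. basis I K \<omega>} \<omega> * h (risk (\<omega> ` K))) \<in> borel_measurable (PM (K \<union> ?J))"
    unfolding IJ by (rule measurable_cong[THEN iffD1, rotated]) (auto simp: indicator_def)
  have "(\<integral>\<^sup>+\<omega>. indicator {\<omega>. basis I K \<omega>} \<omega> * h (risk (\<omega> ` K)) \<partial>PM I) =
    (\<integral>\<^sup>+x. (\<integral>\<^sup>+y. indicator {\<omega>. basis I K \<omega>} (merge K ?J (x, y)) * h (risk (merge K ?J (x, y) ` K)) \<partial>PM ?J) \<partial>PM K)"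
    using product.product_nn_integral_fold[OF IJ(1) fin m] by (simp only: IJ)
  also have "\<dots> = (\<integral>\<^sup>+x. indicator {\<omega>. essential K \<omega>} x * (h (risk (x ` K)) * ennreal ((1 - risk (x ` K)) ^ (card I - card K))) \<partial>PM K)"
  proof (rule nn_integral_cong)
    fix x assume x: "x \<in> space (PM K)"
    let ?A = "{z \<in> space M. \<not> viol (sol (x ` K)) z}"
    have xK: "x ` K \<subseteq> space M" using image_in_space[OF x] by simp
    have pm: "Measurable.pred M (\<lambda>z. viol (sol (x ` K)) z)"
      using measurable_compose[OF measurable_Pair1'[OF x] measurable_viol[OF fin(1)]] by simp
    have A: "?A \<in> sets M" and B: "{z \<in> space M. viol (sol (x ` K)) z} \<in> sets M" using pm by measurable
    have eA: "emeasure M ?A = ennreal (1 - risk (x ` K))"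
      using prob_neg[OF B] by (simp add: emeasure_eq_measure risk_def)
    have im: "merge K ?J (x, y) ` S = x ` S" if "S \<subseteq> K" for y S
      using that by (intro image_cong) (auto simp: merge_def)
    have "essential K (merge K ?J (x, y)) = essential K x" for y
      unfolding essential_def by (intro ball_cong refl) (subst im, blast, simp add: merge_def)
    then have eq: "indicator {\<omega>. basis I K \<omega>} (merge K ?J (x, y)) = indicator {\<omega>. essential K \<omega>} x * (indicator (PiE ?J (\<lambda>_. ?A)) y :: ennreal)"
      if "y \<in> space (PM ?J)" for y
      using that im[of K y] unfolding indicator_def basis_def
      by (auto simp: space_PiM PiE_iff merge_def)
    have "(\<integral>\<^sup>+y. indicator {\<omega>. basis I K \<omega>} (merge K ?J (x, y)) * h (risk (merge K ?J (x, y) ` K)) \<partial>PM ?J) =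
      (\<integral>\<^sup>+y. (indicator {\<omega>. essential K \<omega>} x * h (risk (x ` K))) * indicator (PiE ?J (\<lambda>_. ?A)) y \<partial>PM ?J)"
      by (intro nn_integral_cong) (simp add: eq im mult_ac)
    also have "\<dots> = (indicator {\<omega>. essential K \<omega>} x * h (risk (x ` K))) * emeasure (PM ?J) (PiE ?J (\<lambda>_. ?A))"
      using A fin by (intro nn_integral_cmult_indicator sets_PiM_I_finite) auto
    also have "emeasure (PM ?J) (PiE ?J (\<lambda>_. ?A)) = ennreal ((1 - risk (x ` K)) ^ (card I - card K))"
      using A fin risk_bounds[of "x ` K"] K
      by (subst product.emeasure_PiM) (auto simp: eA ennreal_power card_Diff_subset)
    finally show "(\<integral>\<^sup>+y. indicator {\<omega>. basis I K \<omega>} (merge K ?J (x, y)) * h (risk (merge K ?J (x, y) ` K)) \<partial>PM ?J) =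
      indicator {\<omega>. essential K \<omega>} x * (h (risk (x ` K)) * ennreal ((1 - risk (x ` K)) ^ (card I - card K)))"
      by (simp add: mult.assoc)
  qed
  also have "\<dots> = (\<integral>\<^sup>+v. h v * ennreal ((1 - v) ^ (card I - card K)) \<partial>risk_law (card K))"
    by (rule nn_integral_essential_reindex[OF fin(1)]) measurable
  finally show ?thesis .
qed

text \<open>
  Almost every sample has exactly one basis, so the expectation splits into one term for each possible
  basis, and there are \<open>card I choose k\<close> of size \<open>k\<close>.
\<close>

lemma nn_integral_risk:
  assumes I: "finite I" and [measurable]: "h \<in> borel_measurable borel"
  shows "(\<integral>\<^sup>+\<omega>. h (risk (\<omega> ` I)) \<partial>PM I) =
     (\<Sum>k\<le>d. of_nat (card I choose k) * (\<integral>\<^sup>+v. h v * ennreal ((1 - v) ^ (card I - k)) \<partial>risk_law k))"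
proof -
  define T where "T k = (\<integral>\<^sup>+v. h v * ennreal ((1 - v) ^ (card I - k)) \<partial>risk_law k)" for k
  have "(\<integral>\<^sup>+\<omega>. h (risk (\<omega> ` I)) \<partial>PM I) = (\<integral>\<^sup>+\<omega>. (\<Sum>K\<in>Pow I. indicator {\<omega>. basis I K \<omega>} \<omega> * h (risk (\<omega> ` K))) \<partial>PM I)"
  proof (rule nn_integral_cong_AE)
    show "AE \<omega> in PM I. h (risk (\<omega> ` I)) = (\<Sum>K\<in>Pow I. indicator {\<omega>. basis I K \<omega>} \<omega> * h (risk (\<omega> ` K)))"
      using AE_basis_unique[OF I] AE_space
    proof eventually_elim
      case (elim \<omega>)
      then obtain K where K: "K \<subseteq> I" "basis I K \<omega>" "\<And>L. L \<subseteq> I \<Longrightarrow> basis I L \<omega> \<Longrightarrow> L = K" by auto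
      have "(\<Sum>L\<in>Pow I. indicator {\<omega>. basis I L \<omega>} \<omega> * h (risk (\<omega> ` L))) = (\<Sum>L\<in>{K}. indicator {\<omega>. basis I L \<omega>} \<omega> * h (risk (\<omega> ` L)))"
      proof (rule sum.mono_neutral_right)
        have "\<not> basis I L \<omega>" if "L \<in> Pow I - {K}" for L using that K(3)[of L] by blast
        then show "\<forall>L\<in>Pow I - {K}. indicator {\<omega>. basis I L \<omega>} \<omega> * h (risk (\<omega> ` L)) = 0" by simp
      qed (use I K(1) in simp_all)
      also have "\<dots> = h (risk (\<omega> ` K))" using K(2) by simp
      also have "risk (\<omega> ` K) = risk (\<omega> ` I)"
        using basis_solution[OF I K(1) elim(2) K(2) K(1) subset_refl] by (simp add: risk_def)
      finally show ?case by simp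
    qed
  qed
  also have "\<dots> = (\<Sum>K\<in>Pow I. (\<integral>\<^sup>+\<omega>. indicator {\<omega>. basis I K \<omega>} \<omega> * h (risk (\<omega> ` K)) \<partial>PM I))"
  proof (rule nn_integral_sum)
    fix K assume "K \<in> Pow I"
    then have K: "K \<subseteq> I" by simp
    have [measurable]: "Measurable.pred (PM I) (basis I K)" by (rule measurable_basis[OF I K])
    have [measurable]: "(\<lambda>\<omega>. risk (\<omega> ` K)) \<in> borel_measurable (PM I)" by (rule measurable_risk[OF I K])
    have "(\<lambda>\<omega>. indicator {\<omega> \<in> space (PM I). basis I K \<omega>} \<omega> * h (risk (\<omega> ` K))) \<in> borel_measurable (PM I)"
      by measurable
    then show "(\<lambda>\<omega>. indicator {\<omega>. basis I K \<omega>} \<omega> * h (risk (\<omega> ` K))) \<in> borel_measurable (PM I)"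
      by (rule measurable_cong[THEN iffD1, rotated]) (auto simp: indicator_def)
  qed
  also have "\<dots> = (\<Sum>K\<in>Pow I. T (card K))"
    by (intro sum.cong refl) (auto simp: nn_integral_basis[OF I] T_def)
  also have "\<dots> = (\<Sum>K\<in>{K\<in>Pow I. card K \<le> d}. T (card K))"
  proof (rule sum.mono_neutral_right)
    show "\<forall>K\<in>Pow I - {K \<in> Pow I. card K \<le> d}. T (card K) = 0"
    proof
      fix K assume K: "K \<in> Pow I - {K \<in> Pow I. card K \<le> d}"
      have "indicator {\<omega>. essential {..<card K} \<omega>} \<omega> = (0::ennreal)" if "\<omega> \<in> space (PM {..<card K})" for \<omega>
        using card_essential_le[of "{..<card K}" \<omega>] image_in_space[OF that, of "{..<card K}"] K
        by (auto simp: indicator_def)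
      then show "T (card K) = 0"
        unfolding T_def by (subst nn_integral_risk_law) (simp_all cong: nn_integral_cong)
    qed
  qed (use I in auto)
  also have "\<dots> = (\<Sum>k\<le>d. (\<Sum>K\<in>{K\<in>{K\<in>Pow I. card K \<le> d}. card K = k}. T (card K)))"
    using I by (intro sum.group[symmetric]) auto
  also have "\<dots> = (\<Sum>k\<le>d. of_nat (card I choose k) * T k)"
  proof (intro sum.cong refl)
    fix k assume "k \<in> {..d}"
    then have "{K\<in>{K\<in>Pow I. card K \<le> d}. card K = k} = {K. K \<subseteq> I \<and> card K = k}" by auto
    moreover have "(\<Sum>K\<in>{K. K \<subseteq> I \<and> card K = k}. T (card K)) = (\<Sum>K\<in>{K. K \<subseteq> I \<and> card K = k}. T k)"
      by (rule sum.cong) auto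
    ultimately show "(\<Sum>K\<in>{K\<in>{K\<in>Pow I. card K \<le> d}. card K = k}. T (card K)) = of_nat (card I choose k) * T k"
      using n_subsets[OF I, of k] by simp
  qed
  finally show ?thesis unfolding T_def .
qed

lemma nn_integral_risk_law_real:
  assumes [measurable]: "h \<in> borel_measurable borel" and h: "\<And>v. v \<in> {0..1} \<Longrightarrow> 0 \<le> h v \<and> h v \<le> 1"
  shows "(\<integral>\<^sup>+v. ennreal (h v) \<partial>risk_law k) = ennreal (\<integral>v. h v \<partial>risk_law k)"
proof -
  interpret F: finite_measure "risk_law k" by (rule finite_measure_risk_law)
  have ae: "AE v in risk_law k. norm (h v) \<le> 1" "AE v in risk_law k. 0 \<le> h v"
    by (rule eventually_mono[OF AE_risk_law[of k]], use h in simp)+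
  have "integrable (risk_law k) h" by (rule F.integrable_const_bound[OF ae(1)]) simp
  then show ?thesis by (rule nn_integral_eq_integral) (rule ae(2))
qed

text \<open>
  With \<open>h = 1\<close> the splitting gives the moment equations for every number of samples, with the
  indicator of the tail it gives the quantity to be bounded.
\<close>

lemma risk_tail:
  assumes I: "finite I" and d: "0 < d" "d \<le> card I" and e: "0 < e" "e \<le> 1"
  shows "measure (PM I) {\<omega> \<in> space (PM I). risk (\<omega> ` I) > e} \<le> binomial_tail d (card I) e"
proof -
  let ?N = "card I"
  interpret P: prob_space "PM I" by (rule prob_space_PM)
  have expand: "ennreal (\<Sum>k\<le>d. real (card J choose k) * (\<integral>v. h v * (1 - v) ^ (card J - k) \<partial>risk_law k)) = (\<integral>\<^sup>+\<omega>. ennreal (h (risk (\<omega> ` J))) \<partial>PM J)"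
      and sum_nn: "0 \<le> (\<Sum>k\<le>d. real (card J choose k) * (\<integral>v. h v * (1 - v) ^ (card J - k) \<partial>risk_law k))"
    if [measurable]: "h \<in> borel_measurable borel" and J: "finite J" and h: "\<And>v. v \<in> {0..1} \<Longrightarrow> 0 \<le> h v \<and> h v \<le> 1" for h :: "real \<Rightarrow> real" and J :: "nat set"
  proof -
    have hb: "0 \<le> h v * (1 - v) ^ i \<and> h v * (1 - v) ^ i \<le> 1" if "v \<in> {0..1}" for v :: real and i
      using h[OF that] that by (auto intro!: mult_le_one power_le_one)
    have nn: "0 \<le> (\<integral>v. h v * (1 - v) ^ i \<partial>risk_law k)" for i k
      by (rule integral_nonneg_AE, rule eventually_mono[OF AE_risk_law[of k]]) (use hb in blast)
    have "(\<integral>\<^sup>+\<omega>. ennreal (h (risk (\<omega> ` J))) \<partial>PM J) = (\<Sum>k\<le>d. of_nat (card J choose k) * (\<integral>\<^sup>+v. ennreal (h v) * ennreal ((1 - v) ^ (card J - k)) \<partial>risk_law k))"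
      by (rule nn_integral_risk[OF J]) measurable
    also have "\<dots> = (\<Sum>k\<le>d. of_nat (card J choose k) * (\<integral>\<^sup>+v. ennreal (h v * (1 - v) ^ (card J - k)) \<partial>risk_law k))"
      by (intro sum.cong refl arg_cong2[where f="(*)"] nn_integral_cong_AE, rule eventually_mono[OF AE_risk_law])
         (use h in \<open>simp add: ennreal_mult\<close>)
    also have "\<dots> = (\<Sum>k\<le>d. of_nat (card J choose k) * ennreal (\<integral>v. h v * (1 - v) ^ (card J - k) \<partial>risk_law k))"
      using hb by (subst nn_integral_risk_law_real) auto
    also have "\<dots> = (\<Sum>k\<le>d. ennreal (real (card J choose k) * (\<integral>v. h v * (1 - v) ^ (card J - k) \<partial>risk_law k)))"
      by (simp add: ennreal_mult' ennreal_of_nat_eq_real_of_nat)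
    also have "\<dots> = ennreal (\<Sum>k\<le>d. real (card J choose k) * (\<integral>v. h v * (1 - v) ^ (card J - k) \<partial>risk_law k))"
      using nn by (subst sum_ennreal) auto
    finally show "ennreal (\<Sum>k\<le>d. real (card J choose k) * (\<integral>v. h v * (1 - v) ^ (card J - k) \<partial>risk_law k)) = (\<integral>\<^sup>+\<omega>. ennreal (h (risk (\<omega> ` J))) \<partial>PM J)" by simp
    show "0 \<le> (\<Sum>k\<le>d. real (card J choose k) * (\<integral>v. h v * (1 - v) ^ (card J - k) \<partial>risk_law k))"
      using nn by (intro sum_nonneg mult_nonneg_nonneg) auto
  qed
  have mom: "(\<Sum>k\<le>d. real (m choose k) * (\<integral>v. (1 - v) ^ (m - k) \<partial>risk_law k)) = 1" for m
  proof -
    interpret Q: prob_space "PM {..<m}" by (rule prob_space_PM)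
    have "ennreal (\<Sum>k\<le>d. real (card {..<m} choose k) * (\<integral>v. 1 * (1 - v) ^ (card {..<m} - k) \<partial>risk_law k)) = 1"
      by (subst expand) (auto simp: Q.emeasure_space_1)
    then show ?thesis by (simp add: ennreal_eq_1)
  qed
  have [measurable]: "(\<lambda>\<omega>. risk (\<omega> ` I)) \<in> borel_measurable (PM I)" by (rule measurable_risk[OF I]) simp
  have "emeasure (PM I) {\<omega> \<in> space (PM I). risk (\<omega> ` I) > e} = (\<integral>\<^sup>+\<omega>. indicator {\<omega> \<in> space (PM I). risk (\<omega> ` I) > e} \<omega> \<partial>PM I)"
    by (intro nn_integral_indicator[symmetric]) measurable
  also have "\<dots> = (\<integral>\<^sup>+\<omega>. ennreal (indicator {e<..} (risk (\<omega> ` I))) \<partial>PM I)"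
    by (intro nn_integral_cong) (auto simp: indicator_def)
  also have "\<dots> = ennreal (\<Sum>k\<le>d. real (?N choose k) * (\<integral>v. indicator {e<..} v * (1 - v) ^ (?N - k) \<partial>risk_law k))"
    by (rule expand[symmetric]) (use I in auto)
  finally have "measure (PM I) {\<omega> \<in> space (PM I). risk (\<omega> ` I) > e} = (\<Sum>k\<le>d. real (?N choose k) * (\<integral>v. indicator {e<..} v * (1 - v) ^ (?N - k) \<partial>risk_law k))"
    using sum_nn[of "indicator {e<..}" I] I by (simp add: P.emeasure_eq_measure)
  also have "(\<Sum>k\<le>d. real (?N choose k) * (\<integral>v. indicator {e<..} v * (1 - v) ^ (?N - k) \<partial>risk_law k)) \<le> binomial_tail d ?N e"
    by (rule moment_tail_bound[OF finite_measure_risk_law sets_risk_law AE_risk_law mom d e])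
  finally show ?thesis .
qed

end

section \<open>Programs with linear-fractional constraints\<close>

text \<open>
  The program is to minimize \<open>g \<ge> 0\<close> subject to \<open>P \<in> X\<close> and \<open>u z P \<le> g\<^sup>2 v z P\<close> for all \<open>z \<in> C\<close>. Ties
  between optimal \<open>P\<close> are broken by \<open>\<phi>\<close>. The constraint is not jointly convex in \<open>g\<close> and \<open>P\<close>, but for
  fixed \<open>g\<close> it is linear in \<open>P\<close>.
\<close>

locale fractional_program =
  fixes X :: "'a::euclidean_space set" and Z :: "'z set"
    and u v :: "'z \<Rightarrow> 'a \<Rightarrow> real" and \<phi> :: "'a \<Rightarrow> real"
  assumes compact_X: "compact X" and convex_X: "convex X" and nonempty_X: "X \<noteq> {}"
    and linear_u: "\<And>z. linear (u z)" and linear_v: "\<And>z. linear (v z)"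
    and u_nonneg: "\<And>z P. P \<in> X \<Longrightarrow> 0 \<le> u z P"
    and v_pos: "\<And>z P. z \<in> Z \<Longrightarrow> P \<in> X \<Longrightarrow> 0 < v z P"
    and continuous_tie_break: "continuous_on X \<phi>"
    and strictly_convex_tie_break: "strictly_convex_on X \<phi>"
begin

definition feasible :: "'z set \<Rightarrow> real \<Rightarrow> 'a \<Rightarrow> bool" where
  "feasible C g P \<longleftrightarrow> 0 \<le> g \<and> P \<in> X \<and> (\<forall>z\<in>C. u z P \<le> g\<^sup>2 * v z P)"

definition opt_value :: "'z set \<Rightarrow> real" where
  "opt_value C = Inf {g. \<exists>P. feasible C g P}"

definition opt_set :: "'z set \<Rightarrow> 'a set" where
  "opt_set C = {P. feasible C (opt_value C) P}"

definition opt_point :: "'z set \<Rightarrow> 'a" where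
  "opt_point C = (THE P. P \<in> opt_set C \<and> (\<forall>Q\<in>opt_set C. \<phi> P \<le> \<phi> Q))"

text \<open>
  The smallest level at which \<open>P\<close> is feasible; the 0 makes this correct for the empty program.
\<close>

definition worst :: "'z set \<Rightarrow> 'a \<Rightarrow> real" where
  "worst C P = Max (insert 0 ((\<lambda>z. sqrt (u z P / v z P)) ` C))"

definition violated :: "real \<times> 'a \<Rightarrow> 'z \<Rightarrow> bool" where
  "violated s z \<longleftrightarrow> (fst s)\<^sup>2 * v z (snd s) < u z (snd s)"

definition active :: "real \<times> 'a \<Rightarrow> 'z \<Rightarrow> bool" where
  "active s z \<longleftrightarrow> u z (snd s) = (fst s)\<^sup>2 * v z (snd s)"

definition solution :: "'z set \<Rightarrow> real \<times> 'a" where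
  "solution C = (opt_value C, opt_point C)"

lemma ratio_le_iff:
  assumes "z \<in> Z" "P \<in> X" "0 \<le> g"
  shows "sqrt (u z P / v z P) \<le> g \<longleftrightarrow> u z P \<le> g\<^sup>2 * v z P"
proof -
  have "sqrt (u z P / v z P) \<le> g \<longleftrightarrow> u z P / v z P \<le> g\<^sup>2"
    using assms u_nonneg[of P z] v_pos[of z P] by (simp add: real_sqrt_le_iff' sqrt_le_D real_le_lsqrt  real_sqrt_le_iff)
  then show ?thesis using v_pos[OF assms(1,2)] by (simp add: pos_divide_le_eq)
qed

lemma worst_insert:
  assumes "finite C"
  shows "worst (insert z C) P = max (sqrt (u z P / v z P)) (worst C P)"
proof -
  have "worst (insert z C) P = Max (insert (sqrt (u z P / v z P)) (insert 0 ((\<lambda>z. sqrt (u z P / v z P)) ` C)))"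
    unfolding worst_def by (simp add: insert_commute)
  also have "\<dots> = max (sqrt (u z P / v z P)) (Max (insert 0 ((\<lambda>z. sqrt (u z P / v z P)) ` C)))"
    by (rule Max_insert) (use assms in auto)
  finally show ?thesis unfolding worst_def .
qed

lemma worst_nonneg: "finite C \<Longrightarrow> 0 \<le> worst C P"
  unfolding worst_def by (rule Max_ge) auto

lemma feasible_iff_worst:
  assumes "finite C" "C \<subseteq> Z"
  shows "feasible C g P \<longleftrightarrow> P \<in> X \<and> worst C P \<le> g"
proof -
  have "worst C P \<le> g \<longleftrightarrow> 0 \<le> g \<and> (\<forall>z\<in>C. sqrt (u z P / v z P) \<le> g)"
    unfolding worst_def using assms by (subst Max_le_iff) auto
  then show ?thesis
    unfolding feasible_def using ratio_le_iff assms by blast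
qed

lemma continuous_on_worst:
  assumes "finite C" "C \<subseteq> Z"
  shows "continuous_on X (worst C)"
  using assms
proof (induction C)
  case empty
  have "worst {} = (\<lambda>P. 0)" by (simp add: worst_def fun_eq_iff)
  then show ?case by simp
next
  case (insert z C)
  have "worst (insert z C) = (\<lambda>P. max (sqrt (u z P / v z P)) (worst C P))"
    using worst_insert[OF insert(1)] by auto
  moreover have "continuous_on X (\<lambda>P. sqrt (u z P / v z P))"
    using v_pos[of z] insert.prems
    by (intro continuous_intros linear_continuous_on linear_conv_bounded_linear[THEN iffD1] linear_u linear_v) force
  ultimately show ?case using insert by (auto intro: continuous_on_max)
qed

lemma opt_value_attained:
  assumes "finite C" "C \<subseteq> Z"
  shows "\<exists>P\<in>X. worst C P = opt_value C" and "\<And>Q. Q \<in> X \<Longrightarrow> opt_value C \<le> worst C Q"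
proof -
  obtain P where P: "P \<in> X" "\<forall>Q\<in>X. worst C P \<le> worst C Q"
    using continuous_attains_inf[OF compact_X nonempty_X continuous_on_worst[OF assms]] by blast
  have "opt_value C = worst C P"
    unfolding opt_value_def
    by (rule cInf_eq_minimum) (use P feasible_iff_worst[OF assms] in force)+
  then show "\<exists>P\<in>X. worst C P = opt_value C" "\<And>Q. Q \<in> X \<Longrightarrow> opt_value C \<le> worst C Q"
    using P by auto
qed

lemma opt_value_nonneg: "finite C \<Longrightarrow> C \<subseteq> Z \<Longrightarrow> 0 \<le> opt_value C"
  using opt_value_attained(1)[of C] worst_nonneg[of C] by metis

lemma opt_set_eq:
  assumes "finite C" "C \<subseteq> Z"
  shows "opt_set C = {P \<in> X. worst C P \<le> opt_value C}"
  unfolding opt_set_def feasible_iff_worst[OF assms] by simp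

lemma convex_feasible:
  assumes "feasible C g P" "feasible C g Q" "0 \<le> a" "0 \<le> b" "a + b = 1"
  shows "feasible C g (a *\<^sub>R P + b *\<^sub>R Q)"
  unfolding feasible_def
proof (intro conjI ballI)
  show "0 \<le> g" using assms by (simp add: feasible_def)
  show "a *\<^sub>R P + b *\<^sub>R Q \<in> X"
    using assms convex_X unfolding feasible_def convex_def by blast
  fix z assume z: "z \<in> C"
  have "u z (a *\<^sub>R P + b *\<^sub>R Q) = a * u z P + b * u z Q"
    using linear_u[of z] by (simp add: linear_add linear_scale)
  also have "\<dots> \<le> a * (g\<^sup>2 * v z P) + b * (g\<^sup>2 * v z Q)"
    using assms z unfolding feasible_def by (intro add_mono mult_left_mono) auto
  also have "\<dots> = g\<^sup>2 * v z (a *\<^sub>R P + b *\<^sub>R Q)"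
    using linear_v[of z] by (simp add: linear_add linear_scale algebra_simps)
  finally show "u z (a *\<^sub>R P + b *\<^sub>R Q) \<le> g\<^sup>2 * v z (a *\<^sub>R P + b *\<^sub>R Q)" .
qed

lemma tie_break_strict:
  assumes "P \<in> X" "Q \<in> X" "P \<noteq> Q" "0 < t" "t < 1"
  shows "\<phi> ((1 - t) *\<^sub>R P + t *\<^sub>R Q) < (1 - t) * \<phi> P + t * \<phi> Q"
  using strictly_convex_tie_break assms unfolding strictly_convex_on_def by auto

lemma convex_on_tie_break: "convex_on X \<phi>"
proof (intro convex_onI convex_X)
  fix t :: real and P Q assume "0 < t" "t < 1" "P \<in> X" "Q \<in> X"
  then show "\<phi> ((1 - t) *\<^sub>R P + t *\<^sub>R Q) \<le> (1 - t) * \<phi> P + t * \<phi> Q"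
    using tie_break_strict[of P Q t] by (cases "P = Q") (auto simp: algebra_simps)
qed

lemma opt_point_unique:
  assumes "finite C" "C \<subseteq> Z"
  shows "\<exists>!P. P \<in> opt_set C \<and> (\<forall>Q\<in>opt_set C. \<phi> P \<le> \<phi> Q)"
proof -
  have sub: "opt_set C \<subseteq> X" using opt_set_eq[OF assms] by auto
  have "closed {P \<in> X. worst C P \<le> opt_value C}"
    using continuous_closed_preimage[OF continuous_on_worst[OF assms] compact_imp_closed[OF compact_X], of "{..opt_value C}"]
    by (simp add: vimage_def Int_def)
  then have "compact (opt_set C)"
    using compact_X opt_set_eq[OF assms] sub by (metis compact_Int_closed inf.absorb_iff2)
  moreover have "opt_set C \<noteq> {}"
    using opt_value_attained(1)[OF assms] unfolding opt_set_eq[OF assms] by force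
  ultimately obtain P where P: "P \<in> opt_set C" "\<forall>Q\<in>opt_set C. \<phi> P \<le> \<phi> Q"
    using continuous_attains_inf continuous_on_subset[OF continuous_tie_break sub] by blast
  show ?thesis
  proof (rule ex1I[of _ P])
    fix Q assume Q: "Q \<in> opt_set C \<and> (\<forall>R\<in>opt_set C. \<phi> Q \<le> \<phi> R)"
    show "Q = P"
    proof (rule ccontr)
      assume "Q \<noteq> P"
      let ?R = "(1 - 1/2) *\<^sub>R Q + (1/2) *\<^sub>R P"
      have "?R \<in> opt_set C"
        using convex_feasible[of C "opt_value C" Q P "1 - 1/2" "1/2"] Q P unfolding opt_set_def by simp
      moreover have "\<phi> ?R < (1 - 1/2) * \<phi> Q + 1/2 * \<phi> P"
        using tie_break_strict[of Q P "1/2"] Q P sub \<open>Q \<noteq> P\<close> by auto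
      moreover have "\<phi> Q = \<phi> P" using P Q by (meson order_antisym)
      ultimately show False using P by fastforce
    qed
  qed (use P in auto)
qed

lemma opt_point:
  assumes "finite C" "C \<subseteq> Z"
  shows opt_point_feasible: "feasible C (opt_value C) (opt_point C)"
    and opt_point_tie_break: "\<And>Q. feasible C (opt_value C) Q \<Longrightarrow> Q \<noteq> opt_point C \<Longrightarrow> \<phi> (opt_point C) < \<phi> Q"
proof -
  have *: "opt_point C \<in> opt_set C \<and> (\<forall>Q\<in>opt_set C. \<phi> (opt_point C) \<le> \<phi> Q)"
    unfolding opt_point_def by (rule theI'[OF opt_point_unique[OF assms]])
  then show "feasible C (opt_value C) (opt_point C)" by (simp add: opt_set_def)
  fix Q assume Q: "feasible C (opt_value C) Q" "Q \<noteq> opt_point C"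
  show "\<phi> (opt_point C) < \<phi> Q"
  proof (rule ccontr)
    assume "\<not> ?thesis"
    then have "Q \<in> opt_set C \<and> (\<forall>R\<in>opt_set C. \<phi> Q \<le> \<phi> R)"
      using Q * by (force simp: opt_set_def)
    with * Q opt_point_unique[OF assms] show False by blast
  qed
qed

lemma opt_point_in: "finite C \<Longrightarrow> C \<subseteq> Z \<Longrightarrow> opt_point C \<in> X"
  using opt_point_feasible unfolding feasible_def by blast

lemma opt_value_le: "finite C \<Longrightarrow> C \<subseteq> Z \<Longrightarrow> feasible C g P \<Longrightarrow> opt_value C \<le> g"
  using opt_value_attained(2)[of C P] feasible_iff_worst[of C g P] by auto

lemma solution_satisfies:
  assumes "finite C" "C \<subseteq> Z" "z \<in> C"
  shows "\<not> violated (solution C) z"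
  using opt_point_feasible[OF assms(1,2)] assms(3) by (auto simp: feasible_def violated_def solution_def)

text \<open>
  The optimum for the smaller program is feasible for the larger one, so it remains optimal, and it
  remains the best choice among the optimal points.
\<close>

lemma solution_stable:
  assumes C: "finite C" "C \<subseteq> Z" and D: "finite D" "D \<subseteq> Z"
    and sat: "\<forall>z\<in>D. \<not> violated (solution C) z"
  shows "solution (C \<union> D) = solution C"
proof -
  have CD: "finite (C \<union> D)" "C \<union> D \<subseteq> Z" using C D by auto
  have mono: "feasible C g P" if "feasible (C \<union> D) g P" for g P
    using that by (auto simp: feasible_def)
  have f: "feasible (C \<union> D) (opt_value C) (opt_point C)"
    using opt_point_feasible[OF C] sat by (auto simp: feasible_def violated_def solution_def)
  have val: "opt_value (C \<union> D) = opt_value C"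
    using opt_value_le[OF CD f] opt_value_le[OF C mono[OF opt_point_feasible[OF CD]]] by simp
  have "opt_point (C \<union> D) = opt_point C"
  proof (rule ccontr)
    assume ne: "opt_point (C \<union> D) \<noteq> opt_point C"
    have "\<phi> (opt_point (C \<union> D)) < \<phi> (opt_point C)"
      using opt_point_tie_break[OF CD, of "opt_point C"] f val ne by auto
    moreover have "\<phi> (opt_point C) < \<phi> (opt_point (C \<union> D))"
      using opt_point_tie_break[OF C] mono[OF opt_point_feasible[OF CD]] val ne by auto
    ultimately show False by simp
  qed
  then show ?thesis using val by (simp add: solution_def)
qed

lemma strictly_feasible_improves:
  assumes C: "finite C" "C \<subseteq> Z" "C \<noteq> {}" and Q: "Q \<in> X" and g: "0 \<le> g"
    and strict: "\<And>z. z \<in> C \<Longrightarrow> u z Q < g\<^sup>2 * v z Q"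
  shows "opt_value C < g"
proof -
  obtain z0 where z0: "z0 \<in> C" using C by auto
  have "sqrt (u z Q / v z Q) < g" if z: "z \<in> C" for z
  proof -
    have "0 < v z Q" using v_pos C z Q by auto
    then have "u z Q / v z Q < g\<^sup>2" using strict[OF z] by (simp add: pos_divide_less_eq)
    then show ?thesis using g by (metis real_sqrt_less_iff real_sqrt_abs abs_of_nonneg)
  qed
  moreover have "0 < g"
  proof -
    have "0 \<le> sqrt (u z0 Q / v z0 Q)" using u_nonneg[OF Q, of z0] v_pos[of z0 Q] z0 C Q by auto
    then show ?thesis using calculation[OF z0] by linarith
  qed
  ultimately have "worst C Q < g" unfolding worst_def using C by (subst Max_less_iff) auto
  then show ?thesis using opt_value_attained(2)[OF C(1,2) Q] by simp
qed

text \<open>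
  Suppose that the new constraint has slack at the new optimum. A small step towards the old optimum
  keeps that constraint and all others. It improves the level if the old level was smaller, and it
  improves the tie-breaking value, by strict convexity, if the levels agree.
\<close>

lemma violated_imp_active:
  assumes C: "finite C" "C \<subseteq> Z" and z: "z \<in> Z" and viol: "violated (solution C) z"
  shows "active (solution (insert z C)) z"
proof (rule ccontr)
  assume na: "\<not> ?thesis"
  define D where "D = insert z C"
  have D: "finite D" "D \<subseteq> Z" "D \<noteq> {}" using C z by (auto simp: D_def)
  define g0 P0 g P where "g0 = opt_value C" "P0 = opt_point C" "g = opt_value D" "P = opt_point D"
  note defs = this
  have f0: "feasible C g0 P0" using opt_point_feasible[OF C] by (simp add: defs)
  have f: "feasible D g P" using opt_point_feasible[OF D(1,2)] by (simp add: defs)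
  then have fC: "feasible C g P" by (auto simp: feasible_def D_def)
  have g: "g0 \<le> g" using opt_value_le[OF C fC] by (simp add: defs)
  have nn: "0 \<le> g0" "0 \<le> g" "P0 \<in> X" "P \<in> X" using f0 f by (auto simp: feasible_def)
  have zs: "u z P < g\<^sup>2 * v z P"
    using f na unfolding feasible_def active_def D_def[symmetric] solution_def defs[symmetric]
    by (auto simp: D_def)
  have zv: "g0\<^sup>2 * v z P0 < u z P0"
    using viol by (simp add: violated_def solution_def defs)
  have "((\<lambda>t. (u z P - g\<^sup>2 * v z P) + t * ((u z P0 - g\<^sup>2 * v z P0) - (u z P - g\<^sup>2 * v z P))) \<longlongrightarrow>
        (u z P - g\<^sup>2 * v z P) + 0 * ((u z P0 - g\<^sup>2 * v z P0) - (u z P - g\<^sup>2 * v z P))) (at_right 0)"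
    by (intro tendsto_intros)
  then have "\<forall>\<^sub>F t in at_right 0. (u z P - g\<^sup>2 * v z P) + t * ((u z P0 - g\<^sup>2 * v z P0) - (u z P - g\<^sup>2 * v z P)) < 0"
    by (rule order_tendstoD) (use zs in simp)
  moreover have "\<forall>\<^sub>F t in at_right 0. t < (1::real)" "\<forall>\<^sub>F t in at_right 0. 0 < (t::real)"
    by (auto simp: eventually_at_right_less intro: eventually_at_rightI[of 0 1])
  ultimately have "\<forall>\<^sub>F t in at_right 0. (u z P - g\<^sup>2 * v z P) + t * ((u z P0 - g\<^sup>2 * v z P0) - (u z P - g\<^sup>2 * v z P)) < 0 \<and> t < 1 \<and> 0 < t"
    by eventually_elim auto
  then obtain t where t: "(u z P - g\<^sup>2 * v z P) + t * ((u z P0 - g\<^sup>2 * v z P0) - (u z P - g\<^sup>2 * v z P)) < 0" "t < 1" "0 < t"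
    using eventually_happens[of _ "at_right (0::real)"] by force
  define Q where "Q = (1 - t) *\<^sub>R P + t *\<^sub>R P0"
  have uQ: "u y Q = (1 - t) * u y P + t * u y P0" and vQ: "v y Q = (1 - t) * v y P + t * v y P0" for y
    using linear_u[of y] linear_v[of y] by (simp_all add: Q_def linear_add linear_scale)
  have zQ: "u z Q < g\<^sup>2 * v z Q" using t(1) unfolding uQ vQ by (simp add: algebra_simps)
  have QX: "Q \<in> X" using convexD_alt[OF convex_X nn(4,3)] t by (simp add: Q_def)
  show False
  proof (cases "g0 < g")
    case True
    have "u y Q < g\<^sup>2 * v y Q" if "y \<in> D" for y
    proof (cases "y = z")
      case False
      then have y: "y \<in> C" using that by (simp add: D_def)
      have "u y P0 \<le> g0\<^sup>2 * v y P0" using f0 y by (auto simp: feasible_def)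
      also have "\<dots> < g\<^sup>2 * v y P0"
        using v_pos[of y P0] y C nn True by (intro mult_strict_right_mono power_strict_mono) auto
      finally have "t * u y P0 < t * (g\<^sup>2 * v y P0)" using t by simp
      moreover have "(1 - t) * u y P \<le> (1 - t) * (g\<^sup>2 * v y P)"
        using fC y t by (intro mult_left_mono) (auto simp: feasible_def)
      ultimately show ?thesis unfolding uQ vQ by (simp add: algebra_simps)
    qed (use zQ in simp)
    from strictly_feasible_improves[OF D QX nn(2) this] show False by (simp add: defs)
  next
    case False
    then have eq: "g0 = g" using g by simp
    have "P0 \<noteq> P" using zv zs eq by auto
    have "\<phi> P0 < \<phi> P"
      using opt_point_tie_break[OF C, of P] fC eq \<open>P0 \<noteq> P\<close> by (auto simp: defs)
    moreover have "\<phi> Q < (1 - t) * \<phi> P + t * \<phi> P0"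
      unfolding Q_def using tie_break_strict[of P P0 t] nn t \<open>P0 \<noteq> P\<close> by auto
    ultimately have "\<phi> Q < \<phi> P" using t
      by (smt (verit) mult_left_mono left_diff_distrib mult_cancel_right1 mult_less_cancel_left_pos)
    moreover have "feasible C g Q"
      using convex_feasible[OF fC, of P0 "1 - t" t] f0 eq t by (simp add: Q_def)
    then have "feasible D g Q" using zQ by (auto simp: feasible_def D_def)
    then have "\<phi> P \<le> \<phi> Q" using opt_point_tie_break[OF D(1,2), of Q] by (fastforce simp: defs)
    ultimately show False by simp
  qed
qed

text \<open>
  Two equal points count as a dependence, so the family need not be injective.
\<close>

lemma linear_dependence:
  fixes p :: "'i \<Rightarrow> 'a"
  assumes "finite I" "card I > dim X" "\<And>i. i \<in> I \<Longrightarrow> p i \<in> X"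
  shows "\<exists>c. (\<Sum>i\<in>I. c i *\<^sub>R p i) = 0 \<and> (\<exists>i\<in>I. c i \<noteq> 0)"
proof (cases "inj_on p I")
  case True
  have "dim (p ` I) \<le> dim X" using assms by (intro dim_subset) auto
  also have "\<dots> < card (p ` I)" using assms card_image[OF True] by simp
  finally have "dependent (p ` I)" using dim_eq_card_independent by fastforce
  then obtain w where w: "(\<Sum>y\<in>p ` I. w y *\<^sub>R y) = 0" "\<exists>y\<in>p ` I. w y \<noteq> 0"
    using dependent_finite[of "p ` I"] assms by auto
  then show ?thesis
    by (intro exI[of _ "w \<circ> p"]) (auto simp: sum.reindex[OF True])
next
  case False
  then obtain i j where ij: "i \<in> I" "j \<in> I" "i \<noteq> j" "p i = p j" by (auto simp: inj_on_def)
  let ?c = "\<lambda>k. if k = i then 1 else if k = j then -1 else (0::real)"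
  have "(\<Sum>k\<in>I. ?c k *\<^sub>R p k) = (\<Sum>k\<in>{i, j}. ?c k *\<^sub>R p k)"
    using ij assms by (intro sum.mono_neutral_right) auto
  also have "\<dots> = 0" using ij by simp
  finally show ?thesis using ij by (intro exI[of _ ?c]) auto
qed

text \<open>
  For each \<open>z\<close> in a support set let \<open>p z\<close> be the optimum without \<open>z\<close>. With more than \<open>dim X\<close> of them
  there is a dependence \<open>\<Sum> c z p z = 0\<close>. Moving the negative coefficients to the other side gives one point
  \<open>S\<close> that is a positive combination of the \<open>p z\<close> with \<open>c z > 0\<close> and, at the same time, of the \<open>p z\<close> with
  \<open>c z < 0\<close>. Every constraint lies outside one of the two index sets and is satisfied there by all points
  of the combination, so \<open>S\<close> satisfies all constraints. If all inequalities are strict, the level can be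
  lowered; if one is tight, then all points of the combination have the optimal level and a better
  tie-breaking value, and so does \<open>S\<close>, rescaled to a convex combination. Both are impossible. The
  constraints are homogeneous, so only this rescaling has to respect \<open>X\<close>.
\<close>

lemma card_support_le_dim:
  assumes C: "finite C" "C \<subseteq> Z" and ess: "\<And>z. z \<in> C \<Longrightarrow> violated (solution (C - {z})) z"
  shows "card C \<le> dim X"
proof (rule ccontr)
  assume "\<not> card C \<le> dim X"
  then have card: "card C > dim X" by simp
  then have ne: "C \<noteq> {}" by auto
  then obtain z0 where z0: "z0 \<in> C" by auto
  define g P where "g = opt_value C" "P = opt_point C"
  note defs = this
  define h p where "h z = opt_value (C - {z})" "p z = opt_point (C - {z})" for z
  note hp = this
  have f: "feasible C g P" using opt_point_feasible[OF C] by (simp add: defs)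
  have fz: "feasible (C - {z}) (h z) (p z)" for z using opt_point_feasible[of "C - {z}"] C by (auto simp: hp)
  have pX: "p z \<in> X" for z using fz by (auto simp: feasible_def)
  have f': "feasible (C - {z}) g P" for z using f by (auto simp: feasible_def)
  have hg: "h z \<le> g" for z using opt_value_le[OF _ _ f', of z] C by (auto simp: hp)
  have h0: "0 \<le> h z" "0 \<le> g" for z using fz f by (auto simp: feasible_def)
  \<comment> \<open>p z precedes the optimum lexicographically: by its level, which leaves slack, or by the tie-break value\<close>
  have le: "u y (p z) \<le> g\<^sup>2 * v y (p z)" and
    alt: "u y (p z) < g\<^sup>2 * v y (p z) \<or> \<phi> (p z) < \<phi> P" if yz: "y \<in> C" "z \<in> C" "y \<noteq> z" for y z
  proof -
    have vp: "0 < v y (p z)" using v_pos yz C pX by auto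
    have a: "u y (p z) \<le> (h z)\<^sup>2 * v y (p z)" using fz[of z] yz by (auto simp: feasible_def)
    also have b: "\<dots> \<le> g\<^sup>2 * v y (p z)" using vp h0 hg by (intro mult_right_mono power_mono) auto
    finally show "u y (p z) \<le> g\<^sup>2 * v y (p z)" .
    show "u y (p z) < g\<^sup>2 * v y (p z) \<or> \<phi> (p z) < \<phi> P"
    proof (cases "h z < g")
      case True
      have "(h z)\<^sup>2 * v y (p z) < g\<^sup>2 * v y (p z)"
        using vp h0 True by (intro mult_strict_right_mono power_strict_mono) auto
      then show ?thesis using a by auto
    next
      case False
      then have hz: "h z = g" using hg[of z] by simp
      have "p z \<noteq> P"
        using ess[OF yz(2)] f yz hz by (auto simp: violated_def solution_def hp[symmetric] feasible_def)
      then have "\<phi> (p z) < \<phi> P"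
        using opt_point_tie_break[of "C - {z}" P] f'[of z] C hz by (auto simp: hp)
      then show ?thesis ..
    qed
  qed
  obtain c where c: "(\<Sum>z\<in>C. c z *\<^sub>R p z) = 0" "\<exists>z\<in>C. c z \<noteq> 0"
    using linear_dependence[OF C(1) card, of p] pX by auto
  \<comment> \<open>tightness at Q would mean tightness, and so a better tie-break value, at every point of the combination\<close>
  have key: "u y Q < g\<^sup>2 * v y Q"
    if I: "I \<subseteq> C" "I \<noteq> {}" and a: "\<And>z. z \<in> I \<Longrightarrow> 0 < a z" "sum a I = (1::real)"
      and Q: "Q = (\<Sum>z\<in>I. a z *\<^sub>R p z)" and y: "y \<in> C" "y \<notin> I" 
      and all: "\<And>y. y \<in> C \<Longrightarrow> u y Q \<le> g\<^sup>2 * v y Q" for I a Q y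
  proof (rule ccontr)
    assume neg: "\<not> ?thesis"
    have fin: "finite I" using I C finite_subset by auto
    have uQ: "u y Q = (\<Sum>z\<in>I. a z * u y (p z))" and vQ: "v y Q = (\<Sum>z\<in>I. a z * v y (p z))"
      unfolding Q using linear_u[of y] linear_v[of y] by (simp_all add: linear_sum linear_scale o_def)
    have "(\<Sum>z\<in>I. a z * (g\<^sup>2 * v y (p z) - u y (p z))) = g\<^sup>2 * v y Q - u y Q"
      unfolding uQ vQ by (simp add: sum_distrib_left sum_subtractf algebra_simps)
    also have "\<dots> \<le> 0" using neg by simp
    moreover have nn: "0 \<le> a z * (g\<^sup>2 * v y (p z) - u y (p z))" if "z \<in> I" for z
      using a(1)[OF that] le[of y z] that I y by (intro mult_nonneg_nonneg) auto
    ultimately have z: "\<forall>z\<in>I. a z * (g\<^sup>2 * v y (p z) - u y (p z)) = 0"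
      using sum_nonneg_eq_0_iff[OF fin, of "\<lambda>z. a z * (g\<^sup>2 * v y (p z) - u y (p z))"] nn
        sum_nonneg[of I "\<lambda>z. a z * (g\<^sup>2 * v y (p z) - u y (p z))"] by (simp add: order_antisym)
    have phi: "\<phi> (p z) < \<phi> P" if "z \<in> I" for z
      using alt[of y z] z a(1)[OF that] that I y by force
    have QX: "Q \<in> X" unfolding Q using fin convex_X a pX
      by (intro convex_sum) (auto simp: less_imp_le)
    have "\<phi> Q \<le> (\<Sum>z\<in>I. a z * \<phi> (p z))" unfolding Q using fin a pX I(2)
      by (intro convex_on_sum[OF _ _ convex_on_tie_break]) (auto simp: less_imp_le)
    also have "\<dots> < (\<Sum>z\<in>I. a z * \<phi> P)" using fin a phi I(2)
      by (intro sum_strict_mono) auto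
    also have "\<dots> = \<phi> P" using a(2) by (simp add: sum_distrib_right[symmetric])
    finally have "\<phi> Q < \<phi> P" .
    moreover have "feasible C g Q" using all QX h0 by (auto simp: feasible_def)
    then have "\<phi> P \<le> \<phi> Q" using opt_point_tie_break[OF C, of Q] by (force simp: defs)
    ultimately show False by simp
  qed
  define I J where "I = {z\<in>C. 0 < c z}" "J = {z\<in>C. c z < 0}"
  note IJ = this
  have finIJ: "finite I" "finite J" "I \<subseteq> C" "J \<subseteq> C" "I \<inter> J = {}" using C by (auto simp: IJ)
  have split: "(\<Sum>z\<in>C. f z) = (\<Sum>z\<in>I. f z) + (\<Sum>z\<in>J. f z)" if "\<And>z. c z = 0 \<Longrightarrow> f z = 0" for f :: "'z \<Rightarrow> 'b::real_vector"
  proof -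
    have "(\<Sum>z\<in>C. f z) = (\<Sum>z\<in>I \<union> J. f z)" using C that by (intro sum.mono_neutral_right) (auto simp: IJ not_less order_le_less)
    also have "\<dots> = (\<Sum>z\<in>I. f z) + (\<Sum>z\<in>J. f z)" using finIJ by (intro sum.union_disjoint) auto
    finally show ?thesis .
  qed
  define S where "S = (\<Sum>z\<in>I. c z *\<^sub>R p z)"
  have S2: "S = (\<Sum>z\<in>J. (- c z) *\<^sub>R p z)"
    using split[of "\<lambda>z. c z *\<^sub>R p z"] c(1) by (simp add: S_def sum_negf eq_neg_iff_add_eq_0)
  have vz: "0 < v z0 (p z)" for z using v_pos z0 C pX by auto
  have vS: "v z0 S = (\<Sum>z\<in>I. c z * v z0 (p z))" "v z0 S = (\<Sum>z\<in>J. (- c z) * v z0 (p z))"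
    using linear_v[of z0] by (simp add: S_def linear_sum linear_scale o_def, simp add: S2 linear_sum linear_scale linear_neg o_def)
  have ne: "I \<noteq> {}" "J \<noteq> {}"
  proof -
    have "0 < v z0 S" if "I \<noteq> {}" unfolding vS(1)
      using that finIJ vz by (intro sum_pos) (auto simp: IJ)
    moreover have "0 < v z0 S" if "J \<noteq> {}" unfolding vS(2)
      using that finIJ vz by (intro sum_pos) (auto simp: IJ intro!: mult_neg_pos)
    moreover have "v z0 S = 0" if "I = {}" using that vS by simp
    moreover have "v z0 S = 0" if "J = {}" using that vS by simp
    moreover have "I \<noteq> {} \<or> J \<noteq> {}" using c(2) linorder_neqE_linordered_idom[of "c _" 0] by (auto simp: IJ)
    ultimately show "I \<noteq> {}" "J \<noteq> {}" by force+
  qed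
  define si sj where "si = sum c I" "sj = (\<Sum>z\<in>J. - c z)"
  note ss = this
  have pos: "0 < si" "0 < sj" unfolding ss using ne finIJ by (auto intro!: sum_pos simp: IJ)
  have sum1: "(\<Sum>z\<in>I. c z / si) = 1" "(\<Sum>z\<in>J. - c z / sj) = 1"
    unfolding sum_divide_distrib[symmetric] ss[symmetric] using pos by simp_all
  have cpos: "0 < c z / si" if "z \<in> I" for z using that pos by (auto simp: IJ)
  have cneg: "0 < - c z / sj" if "z \<in> J" for z using that pos by (auto simp: IJ divide_neg_pos)
  define Q R where "Q = (1 / si) *\<^sub>R S" "R = (1 / sj) *\<^sub>R S"
  note QR = this
  have Qe: "Q = (\<Sum>z\<in>I. (c z / si) *\<^sub>R p z)" by (simp add: QR S_def scaleR_sum_right divide_inverse mult.commute)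
  have Re: "R = (\<Sum>z\<in>J. (- c z / sj) *\<^sub>R p z)"
    unfolding QR S2 scaleR_sum_right by (rule sum.cong) auto
  have hom: "u y T < g\<^sup>2 * v y T \<longleftrightarrow> u y S < g\<^sup>2 * v y S" "u y T \<le> g\<^sup>2 * v y T \<longleftrightarrow> u y S \<le> g\<^sup>2 * v y S"
    if "T = k *\<^sub>R S" "k > 0" for y T k
    using that linear_u[of y] linear_v[of y] by (simp_all add: linear_scale mult.left_commute)
  have QX: "Q \<in> X" unfolding Qe using finIJ convex_X pX pos
    by (intro convex_sum) (use sum1 cpos in \<open>auto simp: less_imp_le\<close>)
  have leI: "u y S \<le> g\<^sup>2 * v y S" if y: "y \<in> C" "y \<notin> I" for y
  proof -
    have "u y S = (\<Sum>z\<in>I. c z * u y (p z))" "g\<^sup>2 * v y S = (\<Sum>z\<in>I. c z * (g\<^sup>2 * v y (p z)))"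
      using linear_u[of y] linear_v[of y]
      by (simp_all add: S_def linear_sum linear_scale o_def sum_distrib_left algebra_simps)
    moreover have "(\<Sum>z\<in>I. c z * u y (p z)) \<le> (\<Sum>z\<in>I. c z * (g\<^sup>2 * v y (p z)))"
      using y le[of y] by (intro sum_mono mult_left_mono) (auto simp: IJ)
    ultimately show ?thesis by simp
  qed
  have leJ: "u y S \<le> g\<^sup>2 * v y S" if y: "y \<in> C" "y \<notin> J" for y
  proof -
    have "u y S = (\<Sum>z\<in>J. (- c z) * u y (p z))" "g\<^sup>2 * v y S = (\<Sum>z\<in>J. (- c z) * (g\<^sup>2 * v y (p z)))"
      using linear_u[of y] linear_v[of y]
      by (simp_all add: S2 linear_sum linear_scale linear_neg o_def sum_distrib_left algebra_simps)
    moreover have "(\<Sum>z\<in>J. (- c z) * u y (p z)) \<le> (\<Sum>z\<in>J. (- c z) * (g\<^sup>2 * v y (p z)))"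
      using y le[of y] by (intro sum_mono mult_left_mono) (auto simp: IJ)
    ultimately show ?thesis by simp
  qed
  have all: "u y S \<le> g\<^sup>2 * v y S" if "y \<in> C" for y
    using leI leJ that finIJ(5) by blast
  have "u y S < g\<^sup>2 * v y S" if y: "y \<in> C" for y
  proof (cases "y \<in> I")
    case False
    have "u y Q < g\<^sup>2 * v y Q"
      by (rule key[of I "\<lambda>z. c z / si"])
         (use finIJ ne pos y False Qe all hom(2)[OF QR(1)] cpos sum1 in auto)
    then show ?thesis using hom(1)[OF QR(1)] pos by simp
  next
    case True
    then have "y \<notin> J" using finIJ by auto
    have "u y R < g\<^sup>2 * v y R"
      by (rule key[of J "\<lambda>z. - c z / sj"])
         (use finIJ(4) ne pos y \<open>y \<notin> J\<close> Re all hom(2)[OF QR(2)] cneg sum1 in auto)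
    then show ?thesis using hom(1)[OF QR(2)] pos by simp
  qed
  then have "u y Q < g\<^sup>2 * v y Q" if "y \<in> C" for y using hom(1)[OF QR(1)] pos that by simp
  from strictly_feasible_improves[OF C \<open>C \<noteq> {}\<close> QX h0(2) this] show False by (simp add: defs)
qed

end

section \<open>Measurable dependence of the optimum on the samples\<close>

text \<open>
  The last assumption is the source of nondegeneracy: a random constraint is almost surely not tight at
  a point that does not depend on it.
\<close>

locale fractional_scenario = fractional_program X "space M" u v \<phi> + prob_space M
  for M :: "'z measure" and X :: "'a::euclidean_space set" and u v :: "'z \<Rightarrow> 'a \<Rightarrow> real" and \<phi> :: "'a \<Rightarrow> real" +
  assumes measurable_u: "\<And>P. (\<lambda>z. u z P) \<in> borel_measurable M"
    and measurable_v: "\<And>P. (\<lambda>z. v z P) \<in> borel_measurable M"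
    and AE_not_tight: "\<And>g P. 0 \<le> g \<Longrightarrow> P \<in> X \<Longrightarrow> AE z in M. u z P \<noteq> g\<^sup>2 * v z P"
begin

lemma sample_valid: "finite I \<Longrightarrow> \<omega> \<in> space (PiM I (\<lambda>_. M)) \<Longrightarrow> J \<subseteq> I \<Longrightarrow> finite (\<omega> ` J) \<and> \<omega> ` J \<subseteq> space M"
  by (auto simp: space_PiM intro: finite_subset)

lemma measurable_worst:
  assumes "finite I" "J \<subseteq> I"
  shows "(\<lambda>\<omega>. worst (\<omega> ` J) P) \<in> borel_measurable (PiM I (\<lambda>_. M))"
proof -
  have "finite J" using assms finite_subset by auto
  then show ?thesis using assms(2)
  proof (induction J)
    case empty
    then show ?case by (simp add: worst_def)
  next
    case (insert i J)
    have [measurable]: "(\<lambda>\<omega>. u (\<omega> i) P) \<in> borel_measurable (PiM I (\<lambda>_. M))" "(\<lambda>\<omega>. v (\<omega> i) P) \<in> borel_measurable (PiM I (\<lambda>_. M))"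
    proof -
      have "(\<lambda>\<omega>. \<omega> i) \<in> PiM I (\<lambda>_. M) \<rightarrow>\<^sub>M M"
        using insert.prems by (intro measurable_component_singleton) auto
      from measurable_compose[OF this measurable_u] measurable_compose[OF this measurable_v]
      show "(\<lambda>\<omega>. u (\<omega> i) P) \<in> borel_measurable (PiM I (\<lambda>_. M))" "(\<lambda>\<omega>. v (\<omega> i) P) \<in> borel_measurable (PiM I (\<lambda>_. M))" .
    qed
    have [measurable]: "(\<lambda>\<omega>. worst (\<omega> ` J) P) \<in> borel_measurable (PiM I (\<lambda>_. M))" using insert by auto
    have "(\<lambda>\<omega>. worst (\<omega> ` insert i J) P) = (\<lambda>\<omega>. max (sqrt (u (\<omega> i) P / v (\<omega> i) P)) (worst (\<omega> ` J) P))"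
      using insert.hyps by (simp add: worst_insert)
    then show ?case by simp
  qed
qed

text \<open>
  By compactness the infimum over \<open>G\<close> is attained, and by continuity it is the infimum over \<open>D\<close>.
\<close>

lemma exists_le_iff_dense:
  assumes C: "finite C" "C \<subseteq> space M" and G: "compact G" "G \<subseteq> X" and D: "D \<subseteq> G" "G \<subseteq> closure D"
  shows "(\<exists>P\<in>G. worst C P \<le> c) \<longleftrightarrow> (\<forall>n::nat. \<exists>P\<in>D. worst C P < c + 1 / Suc n)"
proof
  assume "\<exists>P\<in>G. worst C P \<le> c"
  then obtain P where P: "P \<in> G" "worst C P \<le> c" by auto
  show "\<forall>n::nat. \<exists>P\<in>D. worst C P < c + 1 / Suc n"
  proof
    fix n :: nat
    let ?e = "1 / real (Suc n)"
    have "continuous_on G (worst C)" using continuous_on_worst[OF C] G continuous_on_subset by blast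
    then obtain h where h: "0 < h" "\<And>Q. Q \<in> G \<Longrightarrow> dist Q P < h \<Longrightarrow> dist (worst C Q) (worst C P) < ?e"
      using P(1) unfolding continuous_on_iff by (metis zero_less_divide_1_iff of_nat_0_less_iff zero_less_Suc)
    obtain Q where "Q \<in> D" "dist Q P < h"
      using D(2) P(1) h(1) closure_approachable by blast
    with h(2)[of Q] P(2) D(1) show "\<exists>P\<in>D. worst C P < c + ?e"
      by (intro bexI[of _ Q]) (auto simp: dist_real_def)
  qed
next
  assume *: "\<forall>n::nat. \<exists>P\<in>D. worst C P < c + 1 / Suc n"
  then have "G \<noteq> {}" using D by blast
  moreover have "continuous_on G (worst C)" using continuous_on_worst[OF C] G continuous_on_subset by blast
  ultimately obtain P where P: "P \<in> G" "\<And>Q. Q \<in> G \<Longrightarrow> worst C P \<le> worst C Q"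
    using continuous_attains_inf[OF G(1)] by blast
  have "worst C P \<le> c"
  proof (rule ccontr)
    assume "\<not> ?thesis"
    then obtain n where n: "inverse (real (Suc n)) < worst C P - c"
      using reals_Archimedean[of "worst C P - c"] by auto
    obtain Q where "Q \<in> D" "worst C Q < c + 1 / Suc n" using * by blast
    with P(2)[of Q] D n show False by (auto simp: inverse_eq_divide)
  qed
  then show "\<exists>P\<in>G. worst C P \<le> c" using P by auto
qed

lemma measurable_exists_le:
  assumes I: "finite I" and G: "compact G" "G \<subseteq> X" and [measurable]: "c \<in> borel_measurable (PiM I (\<lambda>_. M))"
  shows "Measurable.pred (PiM I (\<lambda>_. M)) (\<lambda>\<omega>. \<exists>P\<in>G. worst (\<omega> ` I) P \<le> c \<omega>)"
proof -
  obtain D where D: "countable D" "D \<subseteq> G" "G \<subseteq> closure D" using separable[of G] by blast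
  have [measurable]: "(\<lambda>\<omega>. worst (\<omega> ` I) P) \<in> borel_measurable (PiM I (\<lambda>_. M))" for P
    by (rule measurable_worst[OF I]) simp
  have A: "Measurable.pred (PiM I (\<lambda>_. M)) (\<lambda>\<omega>. \<forall>n::nat. \<exists>P\<in>D. worst (\<omega> ` I) P < c \<omega> + 1 / Suc n)"
  proof (rule pred_intros_countable(1))
    fix n :: nat
    show "Measurable.pred (PiM I (\<lambda>_. M)) (\<lambda>\<omega>. \<exists>P\<in>D. worst (\<omega> ` I) P < c \<omega> + 1 / Suc n)"
      unfolding pred_def by (rule sets.sets_Collect_countable_Ex'[OF _ D(1)]) measurable
  qed
  have eq: "(\<forall>n::nat. \<exists>P\<in>D. worst (\<omega> ` I) P < c \<omega> + 1 / Suc n) \<longleftrightarrow> (\<exists>P\<in>G. worst (\<omega> ` I) P \<le> c \<omega>)"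
    if "\<omega> \<in> space (PiM I (\<lambda>_. M))" for \<omega>
    using sample_valid[OF I that subset_refl]
    by (intro exists_le_iff_dense[OF _ _ G D(2,3), symmetric]) auto
  show ?thesis by (rule iffD1[OF measurable_cong[OF eq] A])
qed

lemma measurable_opt_value:
  assumes I: "finite I"
  shows "(\<lambda>\<omega>. opt_value (\<omega> ` I)) \<in> borel_measurable (PiM I (\<lambda>_. M))"
  unfolding borel_measurable_iff_le
proof
  fix a
  have "Measurable.pred (PiM I (\<lambda>_. M)) (\<lambda>\<omega>. \<exists>P\<in>X. worst (\<omega> ` I) P \<le> a)"
    by (rule measurable_exists_le[OF I compact_X]) auto
  moreover have "(\<exists>P\<in>X. worst (\<omega> ` I) P \<le> a) \<longleftrightarrow> opt_value (\<omega> ` I) \<le> a" if "\<omega> \<in> space (PiM I (\<lambda>_. M))" for \<omega>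
  proof -
    have C: "finite (\<omega> ` I)" "\<omega> ` I \<subseteq> space M" using sample_valid[OF I that, of I] by auto
    obtain P where P: "P \<in> X" "worst (\<omega> ` I) P = opt_value (\<omega> ` I)"
      using opt_value_attained(1)[OF C] by blast
    show ?thesis
    proof
      assume "\<exists>P\<in>X. worst (\<omega> ` I) P \<le> a"
      then show "opt_value (\<omega> ` I) \<le> a" using opt_value_attained(2)[OF C] order_trans by blast
    next
      assume "opt_value (\<omega> ` I) \<le> a"
      then show "\<exists>P\<in>X. worst (\<omega> ` I) P \<le> a" by (intro bexI[OF _ P(1)]) (simp only: P(2))
    qed
  qed
  ultimately have "Measurable.pred (PiM I (\<lambda>_. M)) (\<lambda>\<omega>. opt_value (\<omega> ` I) \<le> a)"
    by (simp cong: measurable_cong)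
  then show "{\<omega> \<in> space (PiM I (\<lambda>_. M)). opt_value (\<omega> ` I) \<le> a} \<in> sets (PiM I (\<lambda>_. M))"
    by measurable
qed

lemma compact_sublevel: "closed F \<Longrightarrow> compact {P \<in> X. P \<in> F \<and> \<phi> P \<le> q}"
proof -
  assume F: "closed F"
  have "closed {P \<in> X. \<phi> P \<le> q}"
    using continuous_closed_preimage[OF continuous_tie_break compact_imp_closed[OF compact_X], of "{..q}"]
    by (simp add: vimage_def Int_def)
  then have "compact (X \<inter> ({P \<in> X. \<phi> P \<le> q} \<inter> F))" using compact_X F by (intro compact_Int_closed) auto
  moreover have "X \<inter> ({P \<in> X. \<phi> P \<le> q} \<inter> F) = {P \<in> X. P \<in> F \<and> \<phi> P \<le> q}" by auto
  ultimately show ?thesis by simp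
qed

text \<open>
  The right-hand side says that restricting the program to \<open>F\<close> worsens neither the level nor the
  tie-breaking value. It involves only countably many conditions of the kind treated in
  \<open>measurable_exists_le\<close>, since the tie-breaking value enters the compact set over which the level is
  minimized.
\<close>

lemma opt_point_in_closed_iff:
  assumes C: "finite C" "C \<subseteq> space M" and F: "closed F"
  shows "opt_point C \<in> F \<longleftrightarrow>
    (\<forall>q\<in>\<rat>. (\<exists>P\<in>{P \<in> X. P \<in> UNIV \<and> \<phi> P \<le> q}. worst C P \<le> opt_value C) \<longrightarrow>
           (\<exists>P\<in>{P \<in> X. P \<in> F \<and> \<phi> P \<le> q}. worst C P \<le> opt_value C))" (is "_ \<longleftrightarrow> ?R")
proof
  assume F: "opt_point C \<in> F"
  show ?R
  proof (intro ballI impI)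
    fix q assume "\<exists>P\<in>{P \<in> X. P \<in> UNIV \<and> \<phi> P \<le> q}. worst C P \<le> opt_value C"
    then obtain P where "\<phi> P \<le> q" "feasible C (opt_value C) P" using feasible_iff_worst[OF C] by auto
    then have "\<phi> (opt_point C) \<le> q" using opt_point_tie_break[OF C, of P] by fastforce
    then show "\<exists>P\<in>{P \<in> X. P \<in> F \<and> \<phi> P \<le> q}. worst C P \<le> opt_value C"
      using F opt_point_feasible[OF C] feasible_iff_worst[OF C] by auto
  qed
next
  assume R: ?R
  have opt: "opt_point C \<in> X" "worst C (opt_point C) \<le> opt_value C"
    using opt_point_feasible[OF C] feasible_iff_worst[OF C] by auto
  have ex: "\<exists>P\<in>X. P \<in> F \<and> \<phi> P \<le> q \<and> worst C P \<le> opt_value C" if "q \<in> \<rat>" "\<phi> (opt_point C) \<le> q" for q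
    using R opt that by force
  define H where "H = opt_set C \<inter> F"
  have "closed {P \<in> X. worst C P \<le> opt_value C}"
    using continuous_closed_preimage[OF continuous_on_worst[OF C] compact_imp_closed[OF compact_X], of "{..opt_value C}"]
    by (simp add: vimage_def Int_def)
  then have "compact (X \<inter> ({P \<in> X. worst C P \<le> opt_value C} \<inter> F))"
    using compact_X F by (intro compact_Int_closed) auto
  moreover have "X \<inter> ({P \<in> X. worst C P \<le> opt_value C} \<inter> F) = H" by (auto simp: H_def opt_set_eq[OF C])
  ultimately have "compact H" by simp
  moreover obtain q0 where "q0 \<in> \<rat>" "\<phi> (opt_point C) < q0"
    using Rats_dense_in_real[of "\<phi> (opt_point C)" "\<phi> (opt_point C) + 1"] by auto
  then have "H \<noteq> {}" using ex[of q0] by (auto simp: H_def opt_set_eq[OF C])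
  moreover have HX: "H \<subseteq> X" by (auto simp: H_def opt_set_eq[OF C])
  ultimately obtain P where P: "P \<in> H" "\<And>Q. Q \<in> H \<Longrightarrow> \<phi> P \<le> \<phi> Q"
    using continuous_attains_inf continuous_on_subset[OF continuous_tie_break HX] by metis
  have "P = opt_point C"
  proof (rule ccontr)
    assume "P \<noteq> opt_point C"
    then have "\<phi> (opt_point C) < \<phi> P"
      using opt_point_tie_break[OF C, of P] P(1) by (auto simp: H_def opt_set_def)
    then obtain q where q: "q \<in> \<rat>" "\<phi> (opt_point C) < q" "q < \<phi> P" using Rats_dense_in_real by blast
    obtain Q where "Q \<in> H" "\<phi> Q \<le> q" using ex[of q] q by (auto simp: H_def opt_set_eq[OF C])
    then show False using P(2)[of Q] q by simp
  qed
  then show "opt_point C \<in> F" using P by (auto simp: H_def)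
qed

lemma measurable_opt_point:
  assumes I: "finite I"
  shows "(\<lambda>\<omega>. opt_point (\<omega> ` I)) \<in> borel_measurable (PiM I (\<lambda>_. M))"
  unfolding borel_eq_closed
proof (rule measurable_measure_of)
  fix F :: "'a set" assume "F \<in> Collect closed"
  then have F: "closed F" by simp
  let ?L = "\<lambda>\<omega>. \<forall>q\<in>\<rat>. (\<exists>P\<in>{P \<in> X. P \<in> UNIV \<and> \<phi> P \<le> q}. worst (\<omega> ` I) P \<le> opt_value (\<omega> ` I)) \<longrightarrow>
           (\<exists>P\<in>{P \<in> X. P \<in> F \<and> \<phi> P \<le> q}. worst (\<omega> ` I) P \<le> opt_value (\<omega> ` I))"
  have "Measurable.pred (PiM I (\<lambda>_. M)) ?L"
    unfolding pred_def by (rule sets.sets_Collect_countable_All'[OF _ countable_rat], unfold pred_def[symmetric], rule pred_intros_logic(4);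
        rule measurable_exists_le[OF I compact_sublevel _ measurable_opt_value[OF I]]) (use F in auto)
  then have "{\<omega> \<in> space (PiM I (\<lambda>_. M)). ?L \<omega>} \<in> sets (PiM I (\<lambda>_. M))" by measurable
  also have "{\<omega> \<in> space (PiM I (\<lambda>_. M)). ?L \<omega>} = {\<omega> \<in> space (PiM I (\<lambda>_. M)). opt_point (\<omega> ` I) \<in> F}"
  proof (rule Collect_cong, rule conj_cong[OF refl])
    fix \<omega> assume "\<omega> \<in> space (PiM I (\<lambda>_. M))"
    from sample_valid[OF I this subset_refl] show "?L \<omega> \<longleftrightarrow> opt_point (\<omega> ` I) \<in> F"
      by (intro opt_point_in_closed_iff[OF _ _ F, symmetric]) auto
  qed
  also have "\<dots> = (\<lambda>\<omega>. opt_point (\<omega> ` I)) -` F \<inter> space (PiM I (\<lambda>_. M))" by blast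
  finally show "(\<lambda>\<omega>. opt_point (\<omega> ` I)) -` F \<inter> space (PiM I (\<lambda>_. M)) \<in> sets (PiM I (\<lambda>_. M))" .
qed auto

lemma measurable_linear_form:
  fixes l :: "'z \<Rightarrow> 'a \<Rightarrow> real"
  assumes L: "\<And>z. linear (l z)" and [measurable]: "\<And>P. (\<lambda>z. l z P) \<in> borel_measurable M"
    and [measurable]: "p \<in> borel_measurable N" "f \<in> N \<rightarrow>\<^sub>M M" 
  shows "(\<lambda>\<omega>. (l (f \<omega>) (p \<omega>) :: real)) \<in> borel_measurable N"
proof -
  have "l z P = (\<Sum>b\<in>Basis. (P \<bullet> b) * l z b)" for z and P :: 'a
  proof -
    have "l z P = l z (\<Sum>b\<in>Basis. (P \<bullet> b) *\<^sub>R b)" by (simp add: euclidean_representation)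
    also have "\<dots> = (\<Sum>b\<in>Basis. (P \<bullet> b) * l z b)"
      using L[of z] by (simp add: linear_sum linear_scale o_def)
    finally show ?thesis .
  qed
  then have "(\<lambda>\<omega>. l (f \<omega>) (p \<omega>)) = (\<lambda>\<omega>. \<Sum>b\<in>Basis. (p \<omega> \<bullet> b) * l (f \<omega>) b)" by (intro ext)
  also have "\<dots> \<in> borel_measurable N" by measurable
  finally show ?thesis .
qed

sublocale scenario: stable_scenario M solution violated active "dim X"
proof
  fix C z
  assume "finite C" "C \<subseteq> space M" "z \<in> C"
  then show "\<not> violated (solution C) z" by (rule solution_satisfies)
next
  fix C D
  assume "finite C" "C \<subseteq> space M" "finite D" "D \<subseteq> space M" "\<forall>z\<in>D. \<not> violated (solution C) z"
  then show "solution (C \<union> D) = solution C" by (rule solution_stable)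
next
  fix C z
  assume "finite C" "C \<subseteq> space M" "z \<in> space M" "violated (solution C) z"
  then show "active (solution (insert z C)) z" by (rule violated_imp_active)
next
  fix C
  assume "finite C" "C \<subseteq> space M" "\<And>z. z \<in> C \<Longrightarrow> violated (solution (C - {z})) z"
  then show "card C \<le> dim X" by (rule card_support_le_dim)
next
  fix C assume C: "finite C" "C \<subseteq> space M"
  show "AE z in M. \<not> active (solution C) z"
    using AE_not_tight[OF opt_value_nonneg[OF C] opt_point_in[OF C]] by (simp add: active_def solution_def)
next
  fix I :: "nat set" assume I: "finite I"
  let ?N = "PiM I (\<lambda>_. M) \<Otimes>\<^sub>M M"
  have [measurable]: "(\<lambda>p. opt_point (fst p ` I)) \<in> borel_measurable ?N" "(\<lambda>p. opt_value (fst p ` I)) \<in> borel_measurable ?N"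
    by (rule measurable_compose[OF measurable_fst measurable_opt_point[OF I]],
        rule measurable_compose[OF measurable_fst measurable_opt_value[OF I]])
  have [measurable]: "(\<lambda>p. u (snd p) (opt_point (fst p ` I))) \<in> borel_measurable ?N"
    "(\<lambda>p. v (snd p) (opt_point (fst p ` I))) \<in> borel_measurable ?N"
    by (rule measurable_linear_form[OF linear_u measurable_u], measurable)
       (rule measurable_linear_form[OF linear_v measurable_v], measurable)
  show "Measurable.pred ?N (\<lambda>p. violated (solution (fst p ` I)) (snd p))"
    "Measurable.pred ?N (\<lambda>p. active (solution (fst p ` I)) (snd p))"
    unfolding violated_def active_def solution_def fst_conv snd_conv by measurable
qed

end

section \<open>Double caps of the sphere and the incomplete beta function\<close>

text \<open>
  Up to the factor \<open>2 unit_ball_vol m\<close>, the volume of the points \<open>y\<close> of the unit ball of dimension \<open>m + 1\<close>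
  with \<open>c norm y \<le> \<bar>y\<^sub>1\<bar>\<close>: a double cone and, on top of it, two spherical segments.
\<close>

definition cap_profile :: "nat \<Rightarrow> real \<Rightarrow> real" where
  "cap_profile m c = sqrt (1 - c\<^sup>2) ^ m * c / real (Suc m) + integral {c..1} (\<lambda>t. sqrt (1 - t\<^sup>2) ^ m)"

text \<open>
  The radius of the slice of that double cap at height \<open>t\<close>: the cone determines it below height \<open>c\<close>, the
  sphere above.
\<close>

definition slice_radius :: "real \<Rightarrow> real \<Rightarrow> real" where
  "slice_radius c t = (if \<bar>t\<bar> \<le> c then sqrt (1 - c\<^sup>2) / c * \<bar>t\<bar> else sqrt (1 - t\<^sup>2))"

lemma slice_iff:
  assumes "0 \<le> c" "c < 1" "0 \<le> s" "t \<noteq> 0"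
  shows "t\<^sup>2 + s\<^sup>2 \<le> 1 \<and> c * sqrt (t\<^sup>2 + s\<^sup>2) \<le> \<bar>t\<bar> \<longleftrightarrow> \<bar>t\<bar> \<le> 1 \<and> s \<le> slice_radius c t"
proof -
  have c2: "c\<^sup>2 < 1" using assms by (simp add: abs_square_less_1)
  have A: "c * sqrt (t\<^sup>2 + s\<^sup>2) \<le> \<bar>t\<bar> \<longleftrightarrow> c\<^sup>2 * s\<^sup>2 \<le> (1 - c\<^sup>2) * t\<^sup>2"
  proof -
    have "c * sqrt (t\<^sup>2 + s\<^sup>2) \<le> \<bar>t\<bar> \<longleftrightarrow> (c * sqrt (t\<^sup>2 + s\<^sup>2))\<^sup>2 \<le> \<bar>t\<bar>\<^sup>2"
      using assms(1) abs_le_square_iff[of "c * sqrt (t\<^sup>2 + s\<^sup>2)" t] by (simp add: abs_mult)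
    then show ?thesis by (simp add: power_mult_distrib algebra_simps)
  qed
  show ?thesis
  proof (cases "\<bar>t\<bar> \<le> c")
    case True
    then have c0: "0 < c" using assms by linarith
    have t2: "t\<^sup>2 \<le> c\<^sup>2" using True by (simp add: abs_le_square_iff[symmetric] c0)
    then have t1: "\<bar>t\<bar> \<le> 1" using True assms by linarith
    have "s \<le> slice_radius c t \<longleftrightarrow> s\<^sup>2 \<le> (sqrt (1 - c\<^sup>2) / c * \<bar>t\<bar>)\<^sup>2"
      using True assms c2 c0 unfolding slice_radius_def
      by (simp add: abs_le_square_iff[symmetric])
    also have "(sqrt (1 - c\<^sup>2) / c * \<bar>t\<bar>)\<^sup>2 = (1 - c\<^sup>2) * t\<^sup>2 / c\<^sup>2"
      using c2 by (simp add: power_mult_distrib power_divide)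
    also have "s\<^sup>2 \<le> (1 - c\<^sup>2) * t\<^sup>2 / c\<^sup>2 \<longleftrightarrow> c\<^sup>2 * s\<^sup>2 \<le> (1 - c\<^sup>2) * t\<^sup>2"
      using c0 by (simp add: field_simps)
    finally have B: "s \<le> slice_radius c t \<longleftrightarrow> c\<^sup>2 * s\<^sup>2 \<le> (1 - c\<^sup>2) * t\<^sup>2" .
    have "t\<^sup>2 + s\<^sup>2 \<le> 1" if "c\<^sup>2 * s\<^sup>2 \<le> (1 - c\<^sup>2) * t\<^sup>2"
    proof -
      have "c\<^sup>2 * (t\<^sup>2 + s\<^sup>2) \<le> c\<^sup>2 * 1" using that t2 by (simp add: algebra_simps)
      then show ?thesis using c0 by (simp only: mult_le_cancel_left_pos zero_less_power)
    qed
    then show ?thesis using A B t1 by auto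
  next
    case False
    then have t2: "c\<^sup>2 \<le> t\<^sup>2" using assms by (simp add: abs_le_square_iff[symmetric])
    have eq: "s \<le> slice_radius c t \<longleftrightarrow> t\<^sup>2 + s\<^sup>2 \<le> 1"
    proof -
      have "s \<le> slice_radius c t \<longleftrightarrow> sqrt (s\<^sup>2) \<le> sqrt (1 - t\<^sup>2)"
        using False assms(3) by (simp add: slice_radius_def)
      also have "\<dots> \<longleftrightarrow> t\<^sup>2 + s\<^sup>2 \<le> 1" unfolding real_sqrt_le_iff by linarith
      finally show ?thesis .
    qed
    have "\<bar>t\<bar> \<le> 1" if "t\<^sup>2 + s\<^sup>2 \<le> 1"
      using that zero_le_power2[of s] unfolding abs_square_le_1[symmetric] by linarith
    moreover have "c\<^sup>2 * s\<^sup>2 \<le> (1 - c\<^sup>2) * t\<^sup>2" if "t\<^sup>2 + s\<^sup>2 \<le> 1"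
    proof -
      have "c\<^sup>2 * (t\<^sup>2 + s\<^sup>2) \<le> c\<^sup>2 * 1" using that by (intro mult_left_mono) auto
      then show ?thesis using t2 by (simp add: algebra_simps)
    qed
    ultimately show ?thesis using A eq by blast
  qed
qed

lemma slice_radius_pos: "0 \<le> c \<Longrightarrow> c < 1 \<Longrightarrow> t \<noteq> 0 \<Longrightarrow> \<bar>t\<bar> < 1 \<Longrightarrow> 0 < slice_radius c t"
  unfolding slice_radius_def
  by (auto simp: abs_square_less_1 intro!: mult_pos_pos divide_pos_pos)

lemma slice_radius_integral:
  assumes c: "0 \<le> c" "c < 1" "m > 0"
  shows "((\<lambda>t. slice_radius c t ^ m) has_integral cap_profile m c) {0..1}"
proof -
  have "((\<lambda>t. slice_radius c t ^ m) has_integral (sqrt (1 - c\<^sup>2) ^ m * c / real (Suc m))) {0..c}"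
  proof -
    let ?a = "sqrt (1 - c\<^sup>2) / c"
    have "((\<lambda>t. ?a ^ m * t ^ m) has_integral (?a ^ m * (c ^ Suc m / real (Suc m)) - ?a ^ m * (0 ^ Suc m / real (Suc m)))) {0..c}"
      by (rule fundamental_theorem_of_calculus[OF c(1)])
        (auto simp: has_real_derivative_iff_has_vector_derivative[symmetric] simp del: power_Suc of_nat_Suc intro!: derivative_eq_intros)
    note A = this
    have B: "?a ^ m * (c ^ Suc m / real (Suc m)) - ?a ^ m * (0 ^ Suc m / real (Suc m)) = sqrt (1 - c\<^sup>2) ^ m * c / real (Suc m)"
    proof -
      have "?a ^ m * c ^ Suc m = sqrt (1 - c\<^sup>2) ^ m * c"
        using c by (cases "c = 0") (simp_all add: power_divide)
      then show ?thesis unfolding times_divide_eq_right by simp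
    qed
    have "slice_radius c t ^ m = ?a ^ m * t ^ m" if "t \<in> {0..c}" for t
      using that by (simp add: slice_radius_def power_mult_distrib power_divide)
    then show ?thesis by (intro has_integral_eq[OF _ A[unfolded B]]) simp
  qed
  moreover have "((\<lambda>t. slice_radius c t ^ m) has_integral integral {c..1} (\<lambda>t. sqrt (1 - t\<^sup>2) ^ m)) {c..1}"
  proof (rule has_integral_spike_finite[of "{c}"])
    show "((\<lambda>t. sqrt (1 - t\<^sup>2) ^ m) has_integral integral {c..1} (\<lambda>t. sqrt (1 - t\<^sup>2) ^ m)) {c..1}"
      by (intro integrable_integral integrable_continuous_interval continuous_intros)
  qed (use c in \<open>auto simp: slice_radius_def\<close>)
  ultimately show ?thesis unfolding cap_profile_def
    by (rule has_integral_combine[OF c(1) less_imp_le[OF c(2)]])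
qed

lemma slice_radius_integral_sym:
  assumes c: "0 \<le> c" "c < 1" "m > 0"
  shows "((\<lambda>t. slice_radius c t ^ m) has_integral 2 * cap_profile m c) {-1..1}"
proof -
  have A: "((\<lambda>t. slice_radius c t ^ m) has_integral cap_profile m c) {0..1}"
    by (rule slice_radius_integral[OF c])
  have "((\<lambda>t. slice_radius c (- t) ^ m) has_integral cap_profile m c) {-1..-0}"
    by (subst has_integral_reflect_real) (rule A)
  moreover have "slice_radius c (- t) = slice_radius c t" for t by (simp add: slice_radius_def)
  ultimately have B: "((\<lambda>t. slice_radius c t ^ m) has_integral cap_profile m c) {-1..0}" by simp
  show ?thesis using has_integral_combine[OF _ _ B A] by simp
qed

lemma slice_radius_nonneg: "0 \<le> c \<Longrightarrow> c < 1 \<Longrightarrow> \<bar>t\<bar> \<le> 1 \<Longrightarrow> 0 \<le> slice_radius c t"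
  by (auto simp: slice_radius_def abs_square_le_1 intro!: mult_nonneg_nonneg divide_nonneg_nonneg)

lemma emeasure_double_cap:
  fixes b :: "'a::euclidean_space"
  assumes b: "b \<in> Basis" and D: "DIM('a) = Suc m" and c: "0 \<le> c" "c < 1" "m > 0"
  shows "emeasure lborel {y :: 'a. norm y \<le> 1 \<and> c * norm y \<le> \<bar>b \<bullet> y\<bar>} = ennreal (unit_ball_vol (real m) * (2 * cap_profile m c))"
proof -
  interpret product_sigma_finite "\<lambda>_. lborel :: real measure" by standard
  let ?B = "Basis - {b} :: 'a set"
  let ?P = "PiM (Basis :: 'a set) (\<lambda>_. lborel :: real measure)"
  let ?Q = "PiM ?B (\<lambda>_. lborel :: real measure)"
  let ?S = "{y :: 'a. norm y \<le> 1 \<and> c * norm y \<le> \<bar>b \<bullet> y\<bar>}"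
  let ?F = "\<lambda>f::'a \<Rightarrow> real. \<Sum>i\<in>Basis. f i *\<^sub>R i"
  have ins: "insert b ?B = Basis" and cardB: "card ?B = m" using b D by (auto simp: card_Diff_singleton)
  have S: "?S \<in> sets borel" by measurable
  have F: "?F \<in> ?P \<rightarrow>\<^sub>M borel" by measurable
  have nF: "norm (?F f) = sqrt ((f b)\<^sup>2 + (sqrt (\<Sum>i\<in>?B. (f i)\<^sup>2))\<^sup>2)" and bF: "b \<bullet> ?F f = f b" for f
  proof -
    have "norm (?F f) = sqrt (\<Sum>i\<in>Basis. (f i)\<^sup>2)"
      by (simp add: norm_eq_sqrt_inner inner_sum_left inner_sum_right inner_Basis power2_eq_square if_distrib cong: if_cong)
    also have "(\<Sum>i\<in>Basis. (f i)\<^sup>2) = (f b)\<^sup>2 + (\<Sum>i\<in>?B. (f i)\<^sup>2)" using b by (intro sum.remove) auto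
    finally show "norm (?F f) = sqrt ((f b)\<^sup>2 + (sqrt (\<Sum>i\<in>?B. (f i)\<^sup>2))\<^sup>2)" by (simp add: sum_nonneg)
    show "b \<bullet> ?F f = f b" using b by (simp add: inner_sum_right inner_Basis if_distrib cong: if_cong)
  qed
  have "emeasure lborel ?S = emeasure (distr ?P borel ?F) ?S" by (subst lborel_eq) simp
  also have "\<dots> = emeasure ?P (?F -` ?S \<inter> space ?P)" by (rule emeasure_distr[OF F S])
  also have "\<dots> = (\<integral>\<^sup>+ f. indicator (?F -` ?S \<inter> space ?P) f \<partial>PiM (insert b ?B) (\<lambda>_. lborel))"
    unfolding ins using measurable_sets[OF F S] by simp
  also have "\<dots> = (\<integral>\<^sup>+ t. \<integral>\<^sup>+ x. indicator (?F -` ?S \<inter> space ?P) (x(b := t)) \<partial>?Q \<partial>lborel)"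
    using measurable_sets[OF F S] by (intro product_nn_integral_insert_rev) (auto simp only: ins intro!: borel_measurable_indicator, auto)
  also have "\<dots> = (\<integral>\<^sup>+ t. \<integral>\<^sup>+ x. indicator {-1..1} t * indicator ({f. sqrt (\<Sum>i\<in>?B. (f i)\<^sup>2) \<le> slice_radius c t} \<inter> space ?Q) x \<partial>?Q \<partial>lborel)"
  proof (rule nn_integral_cong_AE)
    have "AE t in lborel. t \<notin> {0::real}" by (intro AE_not_in countable_imp_null_set_lborel) auto
    then show "AE t in lborel. (\<integral>\<^sup>+ x. indicator (?F -` ?S \<inter> space ?P) (x(b := t)) \<partial>?Q) =
      (\<integral>\<^sup>+ x. indicator {-1..1} t * indicator ({f. sqrt (\<Sum>i\<in>?B. (f i)\<^sup>2) \<le> slice_radius c t} \<inter> space ?Q) x \<partial>?Q)"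
    proof eventually_elim
      case (elim t)
      show ?case
      proof (rule nn_integral_cong)
        fix x assume x: "x \<in> space ?Q"
        have sp: "x(b := t) \<in> space ?P"
          using x b by (auto simp: space_PiM PiE_def extensional_def)
        have "(\<Sum>i\<in>?B. ((x(b := t)) i)\<^sup>2) = (\<Sum>i\<in>?B. (x i)\<^sup>2)" by (intro sum.cong) auto
        then have "?F (x(b := t)) \<in> ?S \<longleftrightarrow> t\<^sup>2 + (sqrt (\<Sum>i\<in>?B. (x i)\<^sup>2))\<^sup>2 \<le> 1 \<and> c * sqrt (t\<^sup>2 + (sqrt (\<Sum>i\<in>?B. (x i)\<^sup>2))\<^sup>2) \<le> \<bar>t\<bar>"
          unfolding mem_Collect_eq nF bF by simp
        also have "\<dots> \<longleftrightarrow> \<bar>t\<bar> \<le> 1 \<and> sqrt (\<Sum>i\<in>?B. (x i)\<^sup>2) \<le> slice_radius c t"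
          using elim by (intro slice_iff c(1,2)) (auto simp: sum_nonneg)
        finally show "indicator (?F -` ?S \<inter> space ?P) (x(b := t)) =
           (indicator {-1..1} t * indicator ({f. sqrt (\<Sum>i\<in>?B. (f i)\<^sup>2) \<le> slice_radius c t} \<inter> space ?Q) x :: ennreal)"
          using sp x by (auto simp: indicator_def abs_le_iff simp del: mem_Collect_eq)
      qed
    qed
  qed
  also have "\<dots> = (\<integral>\<^sup>+ t. indicator {-1..1} t * emeasure ?Q ({f. sqrt (\<Sum>i\<in>?B. (f i)\<^sup>2) \<le> slice_radius c t} \<inter> space ?Q) \<partial>lborel)"
    by (rule nn_integral_cong, rule nn_integral_cmult_indicator) measurable
  also have "\<dots> = (\<integral>\<^sup>+ t. indicator {-1..1} t * ennreal (unit_ball_vol (real m) * slice_radius c t ^ m) \<partial>lborel)"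
  proof (rule nn_integral_cong_AE)
    have "AE t in lborel. t \<notin> {-1, 0, 1::real}" by (intro AE_not_in countable_imp_null_set_lborel) auto
    then show "AE t in lborel. indicator {-1..1} t * emeasure ?Q ({f. sqrt (\<Sum>i\<in>?B. (f i)\<^sup>2) \<le> slice_radius c t} \<inter> space ?Q) =
       indicator {-1..1} t * ennreal (unit_ball_vol (real m) * slice_radius c t ^ m)"
    proof eventually_elim
      case (elim t)
      show ?case
      proof (cases "t \<in> {-1..1}")
        case True
        then have "0 < slice_radius c t" using elim by (intro slice_radius_pos c(1,2)) auto
        from emeasure_cball_aux[OF _ this, of ?B] show ?thesis by (simp add: cardB)
      qed simp
    qed
  qed
  also have "\<dots> = (\<integral>\<^sup>+ t. indicator {-1..1} t * ennreal (unit_ball_vol (real m) * (if \<bar>t\<bar> \<le> 1 then slice_radius c t ^ m else 0)) \<partial>lborel)"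
    by (intro nn_integral_cong) (auto simp: indicator_def)
  also have "\<dots> = ennreal (unit_ball_vol (real m) * (2 * cap_profile m c))"
  proof -
    have "((\<lambda>t. unit_ball_vol (real m) * (if \<bar>t\<bar> \<le> 1 then slice_radius c t ^ m else 0)) has_integral unit_ball_vol (real m) * (2 * cap_profile m c)) {-1..1}"
      by (intro has_integral_mult_right, rule has_integral_eq[OF _ slice_radius_integral_sym[OF c]]) (auto simp: abs_le_iff)
    from nn_integral_has_integral_lebesgue[OF _ this]
    have "(\<integral>\<^sup>+ t. ennreal (indicator {-1..1} t * (unit_ball_vol (real m) * (if \<bar>t\<bar> \<le> 1 then slice_radius c t ^ m else 0))) \<partial>lborel) = ennreal (unit_ball_vol (real m) * (2 * cap_profile m c))"
      using slice_radius_nonneg[OF c(1,2)] by (simp add: unit_ball_vol_nonneg)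
    moreover have "ennreal (indicator {-1..1} t * r) = indicator {-1..1} t * ennreal r" for t r :: real
      by (simp add: indicator_def)
    ultimately show ?thesis by (simp only:)
  qed
  finally show ?thesis .
qed

text \<open>
  In the variable \<open>x = 1 - c\<^sup>2\<close> the derivative of the profile is, up to a constant factor, the integrand of
  the incomplete beta function.
\<close>

definition beta_profile :: "nat \<Rightarrow> real \<Rightarrow> real" where
  "beta_profile m x = cap_profile m (sqrt (1 - x))"

lemma continuous_beta_profile: "continuous_on {0..1} (beta_profile m)"
proof -
  have "continuous_on {0..1} (\<lambda>c. integral {c..1} (\<lambda>t. sqrt (1 - t\<^sup>2) ^ m))"
    by (intro indefinite_integral_continuous_1' integrable_continuous_interval continuous_intros)
  then have "continuous_on {0..1} (\<lambda>x. integral {sqrt (1 - x)..1} (\<lambda>t. sqrt (1 - t\<^sup>2) ^ m))"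
    by (rule continuous_on_compose2) (auto intro!: continuous_intros)
  then show ?thesis unfolding beta_profile_def [abs_def] cap_profile_def
    by (intro continuous_intros) auto
qed

text \<open>
  The factor \<open>c\<^sup>2\<close> from the chain rule is written as \<open>1 - (1 - c\<^sup>2)\<close>; then all powers with exponent
  \<open>m / 2\<close> cancel and a single power remains.
\<close>

lemma cap_profile_deriv:
  assumes "0 < c" "c < 1" "m > 0"
  shows "(cap_profile m has_real_derivative - (real m / real (Suc m) * (1 - c\<^sup>2) powr (real m / 2 - 1))) (at c)"
proof -
  have c2: "0 < 1 - c\<^sup>2" using assms by (simp add: abs_square_less_1)
  let ?s = "sqrt (1 - c\<^sup>2)"
  have s: "0 < ?s" "?s\<^sup>2 = 1 - c\<^sup>2" using c2 by auto
  have "((\<lambda>x. sqrt (1 - x\<^sup>2) ^ m * x) has_real_derivative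
     real m * ?s ^ (m - 1) * (- c / ?s) * c + ?s ^ m) (at c)"
    using c2 s by (auto intro!: derivative_eq_intros simp: field_simps)
  then have "((\<lambda>x. sqrt (1 - x\<^sup>2) ^ m * x / real (Suc m)) has_real_derivative
     (real m * ?s ^ (m - 1) * (- c / ?s) * c + ?s ^ m) / real (Suc m)) (at c)"
    by (rule DERIV_cdivide)
  moreover have "((\<lambda>x. integral {x..1} (\<lambda>t. sqrt (1 - t\<^sup>2) ^ m)) has_real_derivative - (?s ^ m)) (at c)"
  proof -
    have "((\<lambda>x. integral {x..1} (\<lambda>t. sqrt (1 - t\<^sup>2) ^ m)) has_real_derivative - (?s ^ m)) (at c within {0..1})"
      using assms by (intro integral_has_real_derivative' continuous_intros) auto
    moreover have "c \<in> interior {0..1}" using assms by simp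
    ultimately show ?thesis using at_within_interior by metis
  qed
  ultimately have "(cap_profile m has_real_derivative (real m * ?s ^ (m - 1) * (- c / ?s) * c + ?s ^ m) / real (Suc m) + - (?s ^ m)) (at c)"
    unfolding cap_profile_def [abs_def] by (rule DERIV_add)
  moreover have "(real m * ?s ^ (m - 1) * (- c / ?s) * c + ?s ^ m) / real (Suc m) + - (?s ^ m) = - (real m / real (Suc m) * (1 - c\<^sup>2) powr (real m / 2 - 1))"
  proof -
    obtain k where m: "m = Suc k" using assms by (cases m) auto
    have "(1 - c\<^sup>2) powr (real m / 2 - 1) = ?s powr (real m - 2)"
      using c2 by (simp add: powr_half_sqrt[symmetric] powr_powr field_simps)
    also have "\<dots> = ?s ^ m / ?s\<^sup>2" using s by (simp add: powr_diff powr_realpow)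
    also have "r ^ m / r\<^sup>2 = r ^ k / r" if "r > 0" for r :: real using that unfolding m by (simp add: power2_eq_square)
    note this[OF s(1)]
    finally have e: "(1 - c\<^sup>2) powr (real m / 2 - 1) = ?s ^ k / ?s" .
    have "c * c = 1 - ?s\<^sup>2" using s by (simp add: power2_eq_square)
    moreover have "real m * ?s ^ k * (- c / ?s) * c = - (real m * (?s ^ k / ?s) * (c * c))" by simp
    ultimately have "real m * ?s ^ k * (- c / ?s) * c = - (real m * (?s ^ k / ?s) * (1 - ?s\<^sup>2))" by (simp only:)
    also have "- (M * (r ^ k / r) * (1 - r\<^sup>2)) = - (M * (r ^ k / r)) + M * r ^ m" if "r > 0" for M r :: real
      using that unfolding m by (simp add: field_simps power2_eq_square)
    note this[OF s(1)]
    finally have "(real m * ?s ^ (m - 1) * (- c / ?s) * c + ?s ^ m) = - (real m * (?s ^ k / ?s)) + real (Suc m) * ?s ^ m"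
      unfolding m by (simp add: algebra_simps)
    then have "(real m * ?s ^ (m - 1) * (- c / ?s) * c + ?s ^ m) / real (Suc m) = - (real m / real (Suc m) * (?s ^ k / ?s)) + ?s ^ m"
      by (simp add: add_divide_distrib diff_divide_distrib del: of_nat_Suc)
    then show ?thesis unfolding e by simp
  qed
  ultimately show ?thesis by simp
qed

lemma beta_profile_deriv:
  assumes "0 < x" "x < 1" "m > 0"
  shows "(beta_profile m has_real_derivative real m / (2 * real (Suc m)) * (x powr (real m / 2 - 1) * (1 - x) powr (- 1 / 2))) (at x)"
proof -
  let ?c = "sqrt (1 - x)"
  have c: "0 < ?c" "?c < 1" "?c\<^sup>2 = 1 - x" using assms by auto
  have "((\<lambda>x. sqrt (1 - x)) has_real_derivative - (1 / (2 * ?c))) (at x)"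
    using c assms by (auto intro!: derivative_eq_intros simp: field_simps)
  from DERIV_chain2[OF cap_profile_deriv[OF c(1,2) assms(3)] this]
  have "(beta_profile m has_real_derivative - (real m / real (Suc m) * (1 - ?c\<^sup>2) powr (real m / 2 - 1)) * - (1 / (2 * ?c))) (at x)"
    unfolding beta_profile_def [abs_def] .
  moreover have "- (real m / real (Suc m) * (1 - ?c\<^sup>2) powr (real m / 2 - 1)) * - (1 / (2 * ?c)) =
     real m / (2 * real (Suc m)) * (x powr (real m / 2 - 1) * (1 - x) powr (- 1 / 2))"
    using c assms by (simp add: powr_minus_divide powr_half_sqrt field_simps del: of_nat_Suc)
  ultimately show ?thesis by simp
qed

lemma beta_profile_strict_mono:
  assumes "0 \<le> x" "x < y" "y \<le> 1" "m > 0"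
  shows "beta_profile m x < beta_profile m y"
proof (rule DERIV_pos_imp_increasing_open[OF assms(2)])
  fix t assume "x < t" "t < y"
  then have t: "0 < t" "t < 1" using assms by auto
  then have "0 < real m / (2 * real (Suc m)) * (t powr (real m / 2 - 1) * (1 - t) powr (- 1 / 2))"
    using assms(4) by (intro mult_pos_pos divide_pos_pos) auto
  with beta_profile_deriv[OF t assms(4)]
  show "\<exists>d. (beta_profile m has_real_derivative d) (at t) \<and> d > 0" by blast
qed (use assms in \<open>auto intro: continuous_on_subset[OF continuous_beta_profile]\<close>)

lemma beta_profile_0: "m > 0 \<Longrightarrow> beta_profile m 0 = 0"
  by (simp add: beta_profile_def cap_profile_def)

text \<open>
  By the fundamental theorem of calculus both integrals are the profile up to the same constant, which
  cancels in the quotient.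
\<close>

lemma reg_inc_beta_eq:
  assumes "m > 0" "0 \<le> x" "x \<le> 1"
  shows "reg_inc_beta x (real m / 2) (1 / 2) = beta_profile m x / beta_profile m 1"
proof -
  let ?K = "real m / (2 * real (Suc m))"
  have K: "?K > 0" using assms by simp
  have HI: "((\<lambda>t. ?K * (t powr (real m / 2 - 1) * (1 - t) powr (- 1 / 2))) has_integral beta_profile m y) {0..y}"
    if y: "0 \<le> y" "y \<le> 1" for y
  proof -
    have "((\<lambda>t. ?K * (t powr (real m / 2 - 1) * (1 - t) powr (- 1 / 2))) has_integral beta_profile m y - beta_profile m 0) {0..y}"
    proof (rule fundamental_theorem_of_calculus_interior[OF y(1)])
      show "continuous_on {0..y} (beta_profile m)"
        by (rule continuous_on_subset[OF continuous_beta_profile]) (use y in auto)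
      fix t assume "t \<in> {0<..<y}"
      then have "0 < t" "t < 1" using y by auto
      from beta_profile_deriv[OF this assms(1)]
      show "(beta_profile m has_vector_derivative ?K * (t powr (real m / 2 - 1) * (1 - t) powr (- 1 / 2))) (at t)"
        by (simp only: has_real_derivative_iff_has_vector_derivative)
    qed
    then show ?thesis using beta_profile_0[OF assms(1)] by simp
  qed
  have I: "?K * integral {0..y} (\<lambda>t. t powr (real m / 2 - 1) * (1 - t) powr (- 1 / 2)) = beta_profile m y"
    if "0 \<le> y" "y \<le> 1" for y
    using integral_unique[OF HI[OF that]] unfolding integral_mult_right .
  have "reg_inc_beta x (real m / 2) (1 / 2) =
     (?K * integral {0..x} (\<lambda>t. t powr (real m / 2 - 1) * (1 - t) powr (- 1 / 2))) /
     (?K * integral {0..1} (\<lambda>t. t powr (real m / 2 - 1) * (1 - t) powr (- 1 / 2)))"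
    unfolding reg_inc_beta_def using K assms(1) by simp
  then show ?thesis by (simp only: I[OF assms(2,3)] I[OF zero_le_one order_refl])
qed

lemma reg_inc_beta_bij:
  assumes "m > 0"
  shows "bij_betw (\<lambda>x. reg_inc_beta x (real m / 2) (1 / 2)) {0..1} {0..1}"
    and "\<And>x y. 0 \<le> x \<Longrightarrow> x < y \<Longrightarrow> y \<le> 1 \<Longrightarrow> reg_inc_beta x (real m / 2) (1 / 2) < reg_inc_beta y (real m / 2) (1 / 2)"
proof -
  let ?I = "\<lambda>x. reg_inc_beta x (real m / 2) (1 / 2)"
  have pos: "0 < beta_profile m 1" using beta_profile_strict_mono[of 0 1 m] beta_profile_0 assms by simp
  show mono: "?I x < ?I y" if "0 \<le> x" "x < y" "y \<le> 1" for x y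
    using that reg_inc_beta_eq[OF assms, of x] reg_inc_beta_eq[OF assms, of y] beta_profile_strict_mono[OF that assms] pos
    by (simp add: divide_strict_right_mono)
  have ends: "?I 0 = 0" "?I 1 = 1" using reg_inc_beta_eq[OF assms] beta_profile_0[OF assms] pos by auto
  have cont: "continuous_on {0..1} ?I"
    by (rule continuous_on_cong[THEN iffD1, OF refl _ continuous_on_divide[OF continuous_beta_profile continuous_on_const]])
       (use reg_inc_beta_eq[OF assms] pos in auto)
  have sm: "strict_mono_on {0..1} ?I" using mono by (auto simp: strict_mono_on_def)
  have "?I ` {0..1} = {0..1}"
  proof
    show "?I ` {0..1} \<subseteq> {0..1}"
      using strict_mono_on_leD[OF sm] ends by force
    show "{0..1} \<subseteq> ?I ` {0..1}"
    proof
      fix y :: real assume "y \<in> {0..1}"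
      then have "\<exists>x. 0 \<le> x \<and> x \<le> 1 \<and> ?I x = y" using cont ends by (intro IVT') auto
      then show "y \<in> ?I ` {0..1}" by force
    qed
  qed
  then show "bij_betw ?I {0..1} {0..1}"
    using strict_mono_on_imp_inj_on[OF sm] by (simp add: bij_betw_def)
qed

section \<open>Quadratic forms and eigenvalues\<close>

lemma bilinear_symmetric:
  fixes P :: "real^'n^'n"
  assumes "transpose P = P"
  shows "x \<bullet> (P *v y) = y \<bullet> (P *v x)"
  using assms by (metis dot_lmul_matrix inner_commute transpose_matrix_vector vector_transpose_matrix)

text \<open>
  At a minimizer \<open>v\<close> of the Rayleigh quotient the form \<open>x \<bullet> P x - m (x \<bullet> x)\<close> is minimal, namely zero.
  A short step in direction \<open>-h\<close> with \<open>h = P v - m v\<close> would make it negative unless \<open>h = 0\<close>.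
\<close>

lemma rayleigh_min:
  fixes P :: "real^'n^'n"
  assumes sym: "transpose P = P"
  shows "\<exists>m\<in>eigenvals P. \<forall>x. m * (norm x)\<^sup>2 \<le> x \<bullet> (P *v x)"
proof -
  have cont: "continuous_on (sphere 0 1) (\<lambda>x. x \<bullet> (P *v x))"
    by (intro continuous_intros linear_continuous_on linear_conv_bounded_linear[THEN iffD1]) simp
  have "sphere 0 1 \<noteq> ({} :: (real^'n) set)" by simp
  then obtain v where v: "norm v = 1" "\<And>y. norm y = 1 \<Longrightarrow> v \<bullet> (P *v v) \<le> y \<bullet> (P *v y)"
    using continuous_attains_inf[OF compact_sphere _ cont] by (auto simp: dist_norm)
  define m where "m = v \<bullet> (P *v v)"
  have le: "m * (norm x)\<^sup>2 \<le> x \<bullet> (P *v x)" for x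
  proof (cases "x = 0")
    case False
    have "m \<le> ((1 / norm x) *\<^sub>R x) \<bullet> (P *v ((1 / norm x) *\<^sub>R x))"
      unfolding m_def using False by (intro v(2)) simp
    also have "\<dots> = (x \<bullet> (P *v x)) / (norm x)\<^sup>2"
      by (simp add: matrix_vector_mult_scaleR power2_eq_square)
    finally show ?thesis using False by (simp add: pos_le_divide_eq)
  qed simp
  define h where "h = P *v v - m *\<^sub>R v"
  define f where "f = h \<bullet> (P *v h) - m * (norm h)\<^sup>2"
  have f0: "0 \<le> f" using le[of h] by (simp add: f_def)
  have "h = 0"
  proof (rule ccontr)
    assume "h \<noteq> 0"
    then have q: "0 < (norm h)\<^sup>2" by simp
    have expand: "(v + t *\<^sub>R h) \<bullet> (P *v (v + t *\<^sub>R h)) - m * (norm (v + t *\<^sub>R h))\<^sup>2 = 2 * t * (norm h)\<^sup>2 + t\<^sup>2 * f" for t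
    proof -
      have e1: "(v + t *\<^sub>R h) \<bullet> (P *v (v + t *\<^sub>R h)) = m + 2 * t * (h \<bullet> (P *v v)) + t\<^sup>2 * (h \<bullet> (P *v h))"
        using bilinear_symmetric[OF sym, of v h]
        by (simp add: matrix_vector_right_distrib matrix_vector_mult_scaleR inner_add_left inner_add_right m_def power2_eq_square algebra_simps)
      have e2: "(norm (v + t *\<^sub>R h))\<^sup>2 = 1 + 2 * t * (h \<bullet> v) + t\<^sup>2 * (norm h)\<^sup>2"
        using v(1) unfolding power2_norm_eq_inner norm_eq_1
        by (simp add: inner_add_left inner_add_right inner_commute power2_eq_square algebra_simps)
      have e3: "(norm h)\<^sup>2 = h \<bullet> (P *v v) - m * (h \<bullet> v)"
        by (simp add: power2_norm_eq_inner h_def inner_diff_right)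
      have "m + 2 * t * (h \<bullet> (P *v v)) + t\<^sup>2 * (h \<bullet> (P *v h)) - m * (1 + 2 * t * (h \<bullet> v) + t\<^sup>2 * (norm h)\<^sup>2) =
        2 * t * (h \<bullet> (P *v v) - m * (h \<bullet> v)) + t\<^sup>2 * f" by (simp add: f_def algebra_simps)
      then show ?thesis unfolding e1 e2 e3[symmetric] .
    qed
    \<comment> \<open>nearly the minimizer of the quadratic polynomial; the 1 avoids a division by zero\<close>
    define t where "t = - (norm h)\<^sup>2 / (f + 1)"
    have t: "t < 0" "t * f > - (norm h)\<^sup>2"
      using q f0 by (auto simp: t_def divide_neg_pos field_simps)
    have "0 \<le> 2 * t * (norm h)\<^sup>2 + t\<^sup>2 * f" using le[of "v + t *\<^sub>R h"] expand[of t] by simp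
    also have "\<dots> = t * (2 * (norm h)\<^sup>2 + t * f)" by (simp add: power2_eq_square algebra_simps)
    also have "\<dots> < 0"
    proof (rule mult_neg_pos[OF t(1)])
      show "0 < 2 * (norm h)\<^sup>2 + t * f" using t(2) q by linarith
    qed
    finally show False by simp
  qed
  then have "m \<in> eigenvals P" using v(1) by (auto simp: eigenvals_def h_def intro!: exI[of _ v])
  then show ?thesis using le by blast
qed

lemma rayleigh_max:
  fixes P :: "real^'n^'n"
  assumes sym: "transpose P = P"
  shows "\<exists>m\<in>eigenvals P. \<forall>x. x \<bullet> (P *v x) \<le> m * (norm x)\<^sup>2"
proof -
  have mm: "(- P) *v x = - (P *v x)" for x by (simp add: matrix_vector_mult_def vec_eq_iff sum_negf)
  have "transpose (- P) = - P" using sym by (simp add: transpose_def vec_eq_iff)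
  from rayleigh_min[OF this] obtain m where m: "m \<in> eigenvals (- P)" "\<And>x. m * (norm x)\<^sup>2 \<le> x \<bullet> ((- P) *v x)" by blast
  obtain v where v: "v \<noteq> 0" "(- P) *v v = m *\<^sub>R v" using m(1) by (auto simp: eigenvals_def)
  then have "P *v v = (- m) *\<^sub>R v" unfolding mm by (metis minus_equation_iff scaleR_minus_left)
  then have "- m \<in> eigenvals P" using v(1) by (auto simp: eigenvals_def)
  moreover have "x \<bullet> (P *v x) \<le> - m * (norm x)\<^sup>2" for x using m(2)[of x] by (simp add: mm)
  ultimately show ?thesis by blast
qed

text \<open>
  Eigenvectors of a symmetric matrix for different eigenvalues are orthogonal, hence independent.
\<close>

lemma finite_eigenvals:
  fixes P :: "real^'n^'n"
  assumes sym: "transpose P = P"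
  shows "finite (eigenvals P)"
proof -
  define w where "w c = (SOME v. v \<noteq> 0 \<and> P *v v = c *\<^sub>R v)" for c
  have w: "w c \<noteq> 0" "P *v w c = c *\<^sub>R w c" if "c \<in> eigenvals P" for c
    using that someI_ex[of "\<lambda>v. v \<noteq> 0 \<and> P *v v = c *\<^sub>R v"] by (auto simp: w_def eigenvals_def)
  have inj: "inj_on w (eigenvals P)"
    by (rule inj_onI) (metis w scaleR_cancel_right)
  have "pairwise orthogonal (w ` eigenvals P)"
  proof (rule pairwiseI)
    fix x y assume "x \<in> w ` eigenvals P" "y \<in> w ` eigenvals P" "x \<noteq> y"
    then obtain c e where c: "c \<in> eigenvals P" "x = w c" and e: "e \<in> eigenvals P" "y = w e" and "c \<noteq> e" by auto
    have "e * (x \<bullet> y) = x \<bullet> (P *v y)" using w(2)[OF e(1)] e by simp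
    also have "\<dots> = y \<bullet> (P *v x)" by (rule bilinear_symmetric[OF sym])
    also have "\<dots> = c * (x \<bullet> y)" using w(2)[OF c(1)] c by (simp add: inner_commute)
    finally show "orthogonal x y" using \<open>c \<noteq> e\<close> by (simp add: orthogonal_def)
  qed
  moreover have "0 \<notin> w ` eigenvals P" using w(1) by force
  ultimately have "independent (w ` eigenvals P)" by (rule pairwise_orthogonal_independent)
  then have "finite (w ` eigenvals P)" by (rule independent_imp_finite)
  then show ?thesis using inj finite_imageD by blast
qed

lemma eigenvalue_bounds:
  fixes P :: "real^'n^'n"
  assumes sym: "transpose P = P"
  shows "c \<le> lambda_min P \<longleftrightarrow> (\<forall>x. c * (norm x)\<^sup>2 \<le> x \<bullet> (P *v x))"
    and "lambda_max P \<le> c \<longleftrightarrow> (\<forall>x. x \<bullet> (P *v x) \<le> c * (norm x)\<^sup>2)"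
proof -
  have val: "v \<bullet> (P *v v) = e * (norm v)\<^sup>2" if "P *v v = e *\<^sub>R v" for e v
    using that by (simp add: power2_norm_eq_inner)
  obtain m where m: "m \<in> eigenvals P" "\<And>x. m * (norm x)\<^sup>2 \<le> x \<bullet> (P *v x)" using rayleigh_min[OF sym] by blast
  obtain k where k: "k \<in> eigenvals P" "\<And>x. x \<bullet> (P *v x) \<le> k * (norm x)\<^sup>2" using rayleigh_max[OF sym] by blast
  have min: "lambda_min P = m"
    unfolding lambda_min_def
  proof (rule Min_eqI[OF finite_eigenvals[OF sym] _ m(1)])
    fix e assume "e \<in> eigenvals P"
    then obtain v where "v \<noteq> 0" "P *v v = e *\<^sub>R v" by (auto simp: eigenvals_def)
    then show "m \<le> e" using m(2)[of v] val[of v e] by (simp add: power2_norm_eq_inner)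
  qed
  have max: "lambda_max P = k"
    unfolding lambda_max_def
  proof (rule Max_eqI[OF finite_eigenvals[OF sym] _ k(1)])
    fix e assume "e \<in> eigenvals P"
    then obtain v where "v \<noteq> 0" "P *v v = e *\<^sub>R v" by (auto simp: eigenvals_def)
    then show "e \<le> k" using k(2)[of v] val[of v e] by (simp add: power2_norm_eq_inner)
  qed
  obtain v where v: "v \<noteq> 0" "P *v v = m *\<^sub>R v" using m(1) by (auto simp: eigenvals_def)
  obtain w where w: "w \<noteq> 0" "P *v w = k *\<^sub>R w" using k(1) by (auto simp: eigenvals_def)
  show "c \<le> lambda_min P \<longleftrightarrow> (\<forall>x. c * (norm x)\<^sup>2 \<le> x \<bullet> (P *v x))"
  proof
    assume "c \<le> lambda_min P"
    then have "c * (norm x)\<^sup>2 \<le> m * (norm x)\<^sup>2" for x unfolding min by (intro mult_right_mono) auto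
    then show "\<forall>x. c * (norm x)\<^sup>2 \<le> x \<bullet> (P *v x)" using m(2) order_trans by blast
  next
    assume "\<forall>x. c * (norm x)\<^sup>2 \<le> x \<bullet> (P *v x)"
    then have "c * (norm v)\<^sup>2 \<le> m * (norm v)\<^sup>2" using val[OF v(2)] by metis
    then show "c \<le> lambda_min P" unfolding min using v(1) by (simp add: mult_le_cancel_right)
  qed
  show "lambda_max P \<le> c \<longleftrightarrow> (\<forall>x. x \<bullet> (P *v x) \<le> c * (norm x)\<^sup>2)"
  proof
    assume "lambda_max P \<le> c"
    then have "k * (norm x)\<^sup>2 \<le> c * (norm x)\<^sup>2" for x unfolding max by (intro mult_right_mono) auto
    then show "\<forall>x. x \<bullet> (P *v x) \<le> c * (norm x)\<^sup>2" using k(2) order_trans by blast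
  next
    assume "\<forall>x. x \<bullet> (P *v x) \<le> c * (norm x)\<^sup>2"
    then have "k * (norm w)\<^sup>2 \<le> c * (norm w)\<^sup>2" using val[OF w(2)] by metis
    then show "lambda_max P \<le> c" unfolding max using w(1) by (simp add: mult_le_cancel_right)
  qed
qed

lemma lambda_min_le_lambda_max:
  fixes P :: "real^'n^'n"
  assumes "transpose P = P"
  shows "lambda_min P \<le> lambda_max P"
proof -
  obtain x :: "real^'n" where x: "norm x = 1" using vector_choose_size[of 1] by auto
  have "lambda_min P * (norm x)\<^sup>2 \<le> x \<bullet> (P *v x)" "x \<bullet> (P *v x) \<le> lambda_max P * (norm x)\<^sup>2"
    using eigenvalue_bounds(1)[OF assms, of "lambda_min P"] eigenvalue_bounds(2)[OF assms, of "lambda_max P"] by auto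
  then show ?thesis using x by simp
qed

text \<open>
  The columns of \<open>B\<close> are a basis that is orthonormal for the inner product \<open>x \<bullet> P y\<close>; such a basis exists
  because an orthonormal family of maximal size spans everything. The inverse \<open>L\<close> of \<open>B\<close> plays the role of
  the square root of \<open>P\<close>.
\<close>

lemma pos_def_factor:
  fixes P :: "real^'n^'n"
  assumes P: "pos_def P"
  obtains L B :: "real^'n^'n" where "L ** B = mat 1" "B ** L = mat 1"
    "det P = (det L)\<^sup>2" "\<And>x. pnorm P x = norm (L *v x)"
proof -
  have sym: "transpose P = P" and pos: "\<And>x. x \<noteq> 0 \<Longrightarrow> 0 < x \<bullet> (P *v x)" using P by (auto simp: pos_def_def)
  define orth where "orth S \<longleftrightarrow> (\<forall>x\<in>S. \<forall>y\<in>S. x \<bullet> (P *v y) = (if x = y then 1 else 0))" for S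
  have lin: "linear (\<lambda>y. x \<bullet> (P *v y))" for x
    by (intro linear_compose[unfolded o_def, of "\<lambda>y. P *v y" "\<lambda>z. x \<bullet> z"]) (simp_all add: linear_iff inner_add_right matrix_vector_right_distrib matrix_vector_mult_scaleR)
  have ind: "independent S" if "orth S" "finite S" for S
  proof (rule independent_if_scalars_zero[OF that(2)])
    fix f x assume f: "(\<Sum>x\<in>S. f x *\<^sub>R x) = 0" and x: "x \<in> S"
    have "0 = x \<bullet> (P *v (\<Sum>y\<in>S. f y *\<^sub>R y))" using f by simp
    also have "\<dots> = (\<Sum>y\<in>S. f y * (x \<bullet> (P *v y)))" by (simp only: linear_sum[OF lin] o_def) (simp add: matrix_vector_mult_scaleR)
    also have "\<dots> = (\<Sum>y\<in>S. if x = y then f y else 0)" using that(1) x by (intro sum.cong) (auto simp: orth_def)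
    also have "\<dots> = f x" using that(2) x by simp
    finally show "f x = 0" by simp
  qed
  have bound: "card S \<le> CARD('n)" if "orth S" "finite S" for S
    using independent_bound[OF ind[OF that]] by simp
  have "\<exists>S. (orth S \<and> finite S) \<and> (\<forall>T. orth T \<and> finite T \<longrightarrow> card T \<le> card S)"
    by (rule ex_has_greatest_nat[of _ "{}" card "Suc CARD('n)"]) (auto simp: orth_def[of "{}"] less_Suc_eq_le bound)
  then obtain S where S: "orth S" "finite S" "\<And>T. orth T \<Longrightarrow> finite T \<Longrightarrow> card T \<le> card S" by blast
  have span: "span S = UNIV"
  proof (rule ccontr)
    assume "span S \<noteq> UNIV"
    then obtain x where x: "x \<notin> span S" by auto
    define x' where "x' = x - (\<Sum>s\<in>S. (s \<bullet> (P *v x)) *\<^sub>R s)"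
    have "(\<Sum>s\<in>S. (s \<bullet> (P *v x)) *\<^sub>R s) \<in> span S" by (intro span_sum span_scale span_base)
    then have x': "x' \<notin> span S" using x span_add[of x' S "\<Sum>s\<in>S. (s \<bullet> (P *v x)) *\<^sub>R s"] by (auto simp: x'_def)
    then have "x' \<noteq> 0" using span_zero by metis
    then have p: "0 < x' \<bullet> (P *v x')" by (rule pos)
    have o: "s \<bullet> (P *v x') = 0" if "s \<in> S" for s
    proof -
      have "s \<bullet> (P *v x') = s \<bullet> (P *v x) - (\<Sum>t\<in>S. (t \<bullet> (P *v x)) * (s \<bullet> (P *v t)))"
        unfolding x'_def by (simp only: linear_diff[OF lin] linear_sum[OF lin] o_def) (simp add: matrix_vector_mult_scaleR)
      also have "(\<Sum>t\<in>S. (t \<bullet> (P *v x)) * (s \<bullet> (P *v t))) = (\<Sum>t\<in>S. if s = t then t \<bullet> (P *v x) else 0)"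
        using S(1) that by (intro sum.cong) (auto simp: orth_def)
      also have "\<dots> = s \<bullet> (P *v x)" using S(2) that by simp
      finally show ?thesis by simp
    qed
    define y where "y = (1 / sqrt (x' \<bullet> (P *v x'))) *\<^sub>R x'"
    have yS: "y \<notin> S"
    proof
      assume "y \<in> S"
      then have "sqrt (x' \<bullet> (P *v x')) *\<^sub>R y \<in> span S" by (intro span_scale span_base)
      then show False using x' p by (simp add: y_def)
    qed
    have yy: "y \<bullet> (P *v y) = 1" using p by (simp add: y_def matrix_vector_mult_scaleR)
    have sy: "s \<bullet> (P *v y) = 0" if "s \<in> S" for s using o[OF that] by (simp add: y_def matrix_vector_mult_scaleR)
    have "orth (insert y S)"
      unfolding orth_def
    proof (intro ballI)
      fix a b assume "a \<in> insert y S" "b \<in> insert y S"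
      then show "a \<bullet> (P *v b) = (if a = b then 1 else 0)"
        using yy sy[of a] sy[of b] yS S(1) bilinear_symmetric[OF sym, of y b] unfolding orth_def by auto
    qed
    from S(3)[OF this] S(2) yS show False by simp
  qed
  have "card S = CARD('n)"
    using bound[OF S(1,2)] dim_eq_card_independent[OF ind[OF S(1,2)]] span
    by (metis dim_UNIV dim_span DIM_cart DIM_real mult.right_neutral)
  then obtain f where f: "bij_betw f (UNIV :: 'n set) S"
    using S(2) by (metis finite_same_card_bij finite)
  define B :: "real^'n^'n" where "B = (\<chi> i j. f j $ i)"
  have colB: "column j B = f j" for j by (simp add: B_def column_def vec_eq_iff)
  have G: "transpose B ** P ** B = mat 1"
  proof -
    have "(transpose B ** (P ** B)) $ i $ j = f i \<bullet> (P *v f j)" for i j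
    proof -
      have "(transpose B ** (P ** B)) $ i $ j = (\<Sum>k\<in>UNIV. f i $ k * (\<Sum>l\<in>UNIV. P $ k $ l * f j $ l))"
        by (simp add: matrix_matrix_mult_def transpose_def B_def)
      also have "\<dots> = f i \<bullet> (P *v f j)" by (simp add: inner_vec_def matrix_vector_mult_def)
      finally show ?thesis .
    qed
    moreover have "f i \<bullet> (P *v f j) = (if i = j then 1 else 0)" for i j
      using S(1) f unfolding orth_def bij_betw_def inj_on_def by (metis UNIV_I image_eqI)
    ultimately show ?thesis by (simp add: vec_eq_iff mat_def matrix_mul_assoc[symmetric])
  qed
  have d: "(det B)\<^sup>2 * det P = 1"
  proof -
    have "det (transpose B ** P ** B) = 1" unfolding G by simp
    then show ?thesis by (simp add: det_mul power2_eq_square mult_ac)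
  qed
  then have "det B \<noteq> 0" by auto
  then have inv: "invertible B" by (simp add: invertible_det_nz)
  then obtain L where LB: "L ** B = mat 1" "B ** L = mat 1" unfolding invertible_def by blast
  have "det L * det B = 1" using arg_cong[OF LB(1), of det] by (simp add: det_mul)
  then have "det P = (det L)\<^sup>2 * ((det B)\<^sup>2 * det P)" by (simp add: power_mult_distrib[symmetric] mult.assoc[symmetric])
  then have dP: "det P = (det L)\<^sup>2" using d by simp
  have n: "pnorm P x = norm (L *v x)" for x
  proof -
    define y where "y = L *v x"
    have x: "x = B *v y" by (simp add: y_def matrix_vector_mul_assoc LB)
    have "x \<bullet> (P *v x) = (B *v y) \<bullet> (P *v (B *v y))" by (simp add: x)
    also have "\<dots> = y \<bullet> (transpose B *v (P *v (B *v y)))"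
      by (metis dot_lmul_matrix inner_commute transpose_matrix_vector)
    also have "\<dots> = y \<bullet> ((transpose B ** P ** B) *v y)" by (simp add: matrix_vector_mul_assoc matrix_mul_assoc)
    also have "\<dots> = y \<bullet> y" unfolding G by simp
    finally show ?thesis by (simp add: pnorm_def norm_eq_sqrt_inner y_def)
  qed
  show thesis by (rule that[OF LB dP n])
qed

lemma borel_ball_lmeasurable:
  fixes S :: "'a::euclidean_space set"
  assumes "S \<in> sets borel" "S \<subseteq> cball 0 r"
  shows "S \<in> lmeasurable"
  using assms by (intro bounded_set_imp_lmeasurable) (auto intro: bounded_subset[OF bounded_cball])

section \<open>Lebesgue measure under linear maps\<close>

lemma det_swap_shear:
  assumes mn: "m \<noteq> (n :: 'n::finite)"
  shows "\<bar>det (matrix (\<lambda>x::real^'n. \<chi> i. x $ Transposition.transpose m n i))\<bar> = 1"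
    and "det (matrix (\<lambda>x::real^'n. \<chi> i. if i = m then x $ m + x $ n else x $ i)) = 1"
proof -
  have "matrix (\<lambda>x::real^'n. \<chi> i. x $ Transposition.transpose m n i) = (\<chi> i. mat 1 $ Transposition.transpose m n i)"
    by (auto simp: matrix_def mat_def axis_def vec_eq_iff)
  then show "\<bar>det (matrix (\<lambda>x::real^'n. \<chi> i. x $ Transposition.transpose m n i))\<bar> = 1"
    using det_permute_rows[OF permutes_swap_id[of m UNIV n], of "mat 1 :: real^'n^'n"] mn
    by (simp add: sign_swap_id)
  have "matrix (\<lambda>x::real^'n. \<chi> i. if i = m then x $ m + x $ n else x $ i) =
     (\<chi> k. if k = m then row m (mat 1) + 1 *s row n (mat 1) else row k (mat 1))"
    by (auto simp: matrix_def mat_def axis_def row_def vec_eq_iff)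
  then show "det (matrix (\<lambda>x::real^'n. \<chi> i. if i = m then x $ m + x $ n else x $ i)) = 1"
    using det_row_operation[OF mn, of "mat 1 :: real^'n^'n" 1] by simp
qed

lemma measure_swap_box:
  fixes a b :: "real^'n"
  shows "measure lebesgue ((\<lambda>x. \<chi> i. x $ Transposition.transpose m n i) ` cbox a b) = measure lebesgue (cbox a b)"
proof -
  let ?h = "\<lambda>x::real^'n. \<chi> i. x $ Transposition.transpose m n i"
  have inv: "?h (?h x) = x" for x by (simp add: vec_eq_iff)
  have mem: "?h x \<in> cbox (?h u) (?h w) \<longleftrightarrow> x \<in> cbox u w" for x u w :: "real^'n"
    by (simp add: mem_box_cart) (metis transpose_involutory)
  have img: "?h ` cbox a b = cbox (?h a) (?h b)"
  proof (intro set_eqI iffI)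
    fix y assume "y \<in> cbox (?h a) (?h b)"
    then have "?h y \<in> cbox a b" using mem[of "?h y" a b] inv by simp
    then show "y \<in> ?h ` cbox a b" using inv[of y] by (intro image_eqI[of _ _ "?h y"]) auto
  qed (use mem in blast)
  show ?thesis
  proof (cases "cbox a b = {}")
    case False
    then have "cbox (?h a) (?h b) \<noteq> {}" unfolding img[symmetric] by simp
    then have "measure lebesgue (cbox (?h a) (?h b)) = (\<Prod>i\<in>UNIV. b $ Transposition.transpose m n i - a $ Transposition.transpose m n i)"
      by (simp add: content_cbox_cart)
    also have "\<dots> = (\<Prod>i\<in>UNIV. b $ i - a $ i)"
      by (rule prod.reindex_bij_betw[of "Transposition.transpose m n" UNIV UNIV "\<lambda>i. b $ i - a $ i"]) simp
    also have "\<dots> = measure lebesgue (cbox a b)" using False by (simp add: content_cbox_cart)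
    finally show ?thesis unfolding img .
  qed simp
qed

text \<open>
  A translation moves the box to one whose lower corner has the coordinate \<open>n\<close> equal to zero.
\<close>

lemma measure_shear_box:
  fixes a b :: "real^'n"
  assumes mn: "m \<noteq> n"
  shows "measure lebesgue ((\<lambda>x. \<chi> i. if i = m then x $ m + x $ n else x $ i) ` cbox a b) = measure lebesgue (cbox a b)"
proof (cases "cbox a b = {}")
  case False
  let ?h = "\<lambda>x::real^'n. \<chi> i. if i = m then x $ m + x $ n else x $ i"
  define t :: "real^'n" where "t = axis n (a $ n)"
  have box: "cbox a b = (+) t ` cbox (a - t) (b - t)" by (simp add: cbox_translation[symmetric])
  have "?h ` cbox a b = (+) (?h t) ` (?h ` cbox (a - t) (b - t))"
    unfolding box image_image by (rule image_cong) (auto simp: vec_eq_iff)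
  then have "measure lebesgue (?h ` cbox a b) = measure lebesgue (?h ` cbox (a - t) (b - t))"
    by (simp only: measure_translation)
  also have "\<dots> = measure lebesgue (cbox (a - t) (b - t))"
    by (rule measure_shear_interval[OF mn]) (use False box in \<open>auto simp: t_def\<close>)
  also have "\<dots> = measure lebesgue (cbox a b)" unfolding box by (rule measure_translation[symmetric])
  finally show ?thesis .
qed simp

text \<open>
  The index type carries no order, so the determinants of the elementary maps come from row operations
  on the identity matrix.
\<close>

lemma lebesgue_linear_image:
  fixes f :: "real^'n \<Rightarrow> real^'n"
  assumes f: "linear f" and S: "S \<in> lmeasurable"
  shows "f ` S \<in> lmeasurable" "measure lebesgue (f ` S) = \<bar>det (matrix f)\<bar> * measure lebesgue S"
proof -
  let ?P = "\<lambda>f :: real^'n \<Rightarrow> real^'n. \<forall>S \<in> lmeasurable. f ` S \<in> lmeasurable \<and> measure lebesgue (f ` S) = \<bar>det (matrix f)\<bar> * measure lebesgue S"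
  have "?P f"
  proof (rule induct_linear_elementary[OF f])
    fix f g :: "real^'n \<Rightarrow> real^'n"
    assume "linear f" "linear g" and P: "?P f" "?P g"
    then have "\<bar>det (matrix (f \<circ> g))\<bar> = \<bar>det (matrix f)\<bar> * \<bar>det (matrix g)\<bar>"
      by (simp add: matrix_compose det_mul abs_mult)
    moreover have "(f \<circ> g) ` S = f ` (g ` S)" for S by (simp add: image_comp)
    ultimately show "?P (f \<circ> g)" using P by (simp only: mult.assoc) simp
  next
    fix f :: "real^'n \<Rightarrow> real^'n" and i
    assume lin: "linear f" and z: "\<And>x. f x $ i = 0"
    have "f x \<noteq> axis i 1" for x using z[of x] by (metis axis_nth zero_neq_one)
    then have ni: "\<not> inj f" using linear_injective_imp_surjective[OF lin] by (metis surjD)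
    then have "negligible (f ` S)" for S by (rule negligible_linear_singular_image[OF lin])
    moreover have "det (matrix f) = 0" using ni det_nz_iff_inj[OF lin] by blast
    ultimately show "?P f" by (simp add: negligible_imp_measurable negligible_imp_measure0)
  next
    fix c :: "'n \<Rightarrow> real"
    have "det (matrix (\<lambda>x. \<chi> i. c i * x $ i)) = prod c UNIV"
      by (simp add: axis_def matrix_def det_diagonal)
    then show "?P (\<lambda>x. \<chi> i. c i * x $ i)" by (simp add: measurable_stretch measure_stretch)
  next
    fix m n :: 'n assume mn: "m \<noteq> n"
    let ?h = "\<lambda>x::real^'n. \<chi> i. x $ Transposition.transpose m n i"
    have lin: "linear ?h" by (rule linearI) (simp_all add: vec_eq_iff)
    show "?P ?h"
    proof
      fix S :: "(real^'n) set" assume "S \<in> lmeasurable"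
      from measure_linear_sufficient[OF lin this, of 1] measure_swap_box[of m n]
      have "?h ` S \<in> lmeasurable \<and> 1 * measure lebesgue S = measure lebesgue (?h ` S)" by simp
      then show "?h ` S \<in> lmeasurable \<and> measure lebesgue (?h ` S) = \<bar>det (matrix ?h)\<bar> * measure lebesgue S"
        unfolding det_swap_shear(1)[OF mn] by argo
    qed
  next
    fix m n :: 'n assume mn: "m \<noteq> n"
    let ?h = "\<lambda>x::real^'n. \<chi> i. if i = m then x $ m + x $ n else x $ i"
    have lin: "linear ?h" by (rule linearI) (auto simp: vec_eq_iff algebra_simps)
    show "?P ?h"
    proof
      fix S :: "(real^'n) set" assume "S \<in> lmeasurable"
      from measure_linear_sufficient[OF lin this, of 1] measure_shear_box[OF mn]
      have "?h ` S \<in> lmeasurable \<and> 1 * measure lebesgue S = measure lebesgue (?h ` S)" by simp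
      then show "?h ` S \<in> lmeasurable \<and> measure lebesgue (?h ` S) = \<bar>det (matrix ?h)\<bar> * measure lebesgue S"
        unfolding det_swap_shear(2)[OF mn] by simp
    qed
  qed
  then show "f ` S \<in> lmeasurable" "measure lebesgue (f ` S) = \<bar>det (matrix f)\<bar> * measure lebesgue S"
    using S by auto
qed

text \<open>
  A rotation reduces the claim to a cap around a coordinate axis. The ball itself is the double cap
  with \<open>c = 0\<close>.
\<close>

lemma measure_double_cap:
  fixes e :: "real^'n"
  assumes n: "CARD('n) = Suc m" and c: "0 \<le> c" "c < 1" "m > 0" and e: "norm e = 1"
  shows "measure lborel {y. norm y \<le> 1 \<and> c * norm y \<le> \<bar>e \<bullet> y\<bar>} =
         reg_inc_beta (1 - c\<^sup>2) (real m / 2) (1 / 2) * measure lborel (cball 0 1 :: (real^'n) set)"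
proof -
  let ?S = "\<lambda>e c. {y :: real^'n. norm y \<le> 1 \<and> c * norm y \<le> \<bar>e \<bullet> y\<bar>}"
  obtain k :: 'n where "True" by simp
  define b :: "real^'n" where "b = axis k 1"
  have b: "b \<in> Basis" "norm b = 1" by (auto simp: b_def)
  have vol: "measure lborel (?S b c) = unit_ball_vol (real m) * (2 * cap_profile m c)" if "0 \<le> c" "c < 1" for c
  proof -
    have "emeasure lborel (?S b c) = ennreal (unit_ball_vol (real m) * (2 * cap_profile m c))"
      by (rule emeasure_double_cap[OF b(1) _ that c(3)]) (simp add: n)
    moreover have "0 \<le> cap_profile m c"
    proof -
      have "0 \<le> slice_radius c t ^ m" if "t \<in> {0..1}" for t
        using slice_radius_nonneg[OF \<open>0 \<le> c\<close> \<open>c < 1\<close>, of t] that by simp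
      then show ?thesis using has_integral_nonneg[OF slice_radius_integral[OF that c(3)]] by simp
    qed
    ultimately show ?thesis by (simp add: measure_def unit_ball_vol_nonneg)
  qed
  have prof: "beta_profile m (1 - c\<^sup>2) = cap_profile m c" "beta_profile m 1 = cap_profile m 0"
    using c by (simp_all add: beta_profile_def)
  have c2: "0 \<le> 1 - c\<^sup>2" "1 - c\<^sup>2 \<le> 1" using c by (simp_all add: abs_square_le_1)
  have "0 < beta_profile m 1" using beta_profile_strict_mono[of 0 1 m] beta_profile_0 c by simp
  then have "measure lborel (?S b c) = reg_inc_beta (1 - c\<^sup>2) (real m / 2) (1 / 2) * measure lborel (?S b 0)"
    unfolding reg_inc_beta_eq[OF c(3) c2] vol[OF c(1,2)] vol[OF order_refl zero_less_one] prof by simp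
  moreover have "?S b 0 = cball 0 1" by auto
  moreover have "measure lborel (?S e c) = measure lborel (?S b c)"
  proof -
    obtain f where f: "orthogonal_transformation f" "f b = e"
      using orthogonal_transformation_exists_1[OF b(2) e] by blast
    have nf: "norm (f x) = norm x" and inf: "f x \<bullet> f y = x \<bullet> y" for x y
      using f(1) by (auto simp: orthogonal_transformation_norm orthogonal_transformation_def)
    have "?S e c = f ` ?S b c"
    proof (intro set_eqI iffI)
      fix y assume y: "y \<in> ?S e c"
      obtain x where x: "y = f x" using orthogonal_transformation_surj[OF f(1)] by (metis surj_def)
      then show "y \<in> f ` ?S b c" using y unfolding f(2)[symmetric] by (auto simp: nf inf)
    next
      fix y assume "y \<in> f ` ?S b c"
      then show "y \<in> ?S e c" unfolding f(2)[symmetric] by (auto simp: nf inf)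
    qed
    moreover have bor: "?S x c \<in> sets borel" for x by measurable
    have "?S b c \<in> lmeasurable" by (rule borel_ball_lmeasurable[OF bor, of _ 1]) auto
    then have "measure lebesgue (f ` ?S b c) = measure lebesgue (?S b c)"
      using lebesgue_linear_image(2)[OF orthogonal_transformation_linear[OF f(1)]] f(1) by simp
    ultimately have "measure lebesgue (?S e c) = measure lebesgue (?S b c)" by simp
    then show ?thesis using bor[of e] bor[of b] by simp
  qed
  ultimately show ?thesis by simp
qed

text \<open>
  The value of \<open>zeta\<close> is the height of the double cap whose relative measure is \<open>2 s\<close>.
\<close>

lemma zeta_properties:
  assumes n: "n = Suc m" "m > 0" and s: "0 \<le> s" "s < 1 / 2"
  shows "0 < zeta n s" "zeta n s \<le> 1" "reg_inc_beta (1 - (zeta n s)\<^sup>2) (real m / 2) (1 / 2) = 2 * s"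
proof -
  let ?I = "\<lambda>x. reg_inc_beta x (real m / 2) (1 / 2)"
  define x where "x = the_inv_into {0..1} ?I (2 * s)"
  note bij = reg_inc_beta_bij(1)[OF n(2)]
  have inj: "inj_on ?I {0..1}" and img: "?I ` {0..1} = {0..1}" using bij by (auto simp: bij_betw_def)
  have s2: "2 * s \<in> ?I ` {0..1}" unfolding img using s by auto
  have x: "x \<in> {0..1}" unfolding x_def by (rule the_inv_into_into[OF inj s2 order_refl])
  have Ix: "?I x = 2 * s" unfolding x_def by (rule f_the_inv_into_f[OF inj s2])
  have "x \<noteq> 1"
  proof
    assume "x = 1"
    obtain y where y: "y \<in> {0..1}" "?I y = 1" using img by (metis (mono_tags, lifting) atLeastAtMost_iff imageE zero_le_one order_refl)
    then have "y < 1 \<or> y = 1" by auto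
    then have "?I y \<le> ?I 1" using reg_inc_beta_bij(2)[OF n(2), of y 1] y by auto
    then show False using Ix \<open>x = 1\<close> y s by simp
  qed
  then have x1: "0 \<le> x" "x < 1" using x by auto
  have z: "zeta n s = sqrt (1 - x)" using n by (simp add: zeta_def inv_reg_inc_beta_def x_def)
  show "0 < zeta n s" "zeta n s \<le> 1" using x1 by (simp_all add: z)
  have "1 - (zeta n s)\<^sup>2 = x" using x1 by (simp add: z)
  then show "?I (1 - (zeta n s)\<^sup>2) = 2 * s" using Ix by simp
qed

lemma zeta_antimono:
  assumes n: "n = Suc m" "m > 0" and s: "0 \<le> s" "s \<le> t" "t < 1 / 2"
  shows "zeta n t \<le> zeta n s"
proof (rule ccontr)
  note zs = zeta_properties[OF n s(1) le_less_trans[OF s(2,3)]]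
  note zt = zeta_properties[OF n order_trans[OF s(1,2)] s(3)]
  assume "\<not> ?thesis"
  then have lt: "(zeta n s)\<^sup>2 < (zeta n t)\<^sup>2" using zs(1) by (intro power_strict_mono) auto
  have "(zeta n s)\<^sup>2 \<le> 1" "(zeta n t)\<^sup>2 \<le> 1" using zs zt by (simp_all add: power_le_one)
  then have "reg_inc_beta (1 - (zeta n t)\<^sup>2) (real m / 2) (1 / 2) < reg_inc_beta (1 - (zeta n s)\<^sup>2) (real m / 2) (1 / 2)"
    using lt by (intro reg_inc_beta_bij(2)[OF n(2)]) auto
  then show False using zs(3) zt(3) s by simp
qed

lemma pos_def_lambda_min_pos:
  fixes P :: "real^'n^'n"
  assumes "pos_def P"
  shows "0 < lambda_min P"
proof -
  have sym: "transpose P = P" using assms by (simp add: pos_def_def)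
  obtain m where m: "m \<in> eigenvals P" "\<And>x. m * (norm x)\<^sup>2 \<le> x \<bullet> (P *v x)" using rayleigh_min[OF sym] by blast
  have "m \<le> lambda_min P" unfolding eigenvalue_bounds(1)[OF sym] using m(2) by blast
  moreover obtain v where v: "v \<noteq> 0" "P *v v = m *\<^sub>R v" using m(1) by (auto simp: eigenvals_def)
  then have "0 < m * (v \<bullet> v)" using assms by (auto simp: pos_def_def)
  then have "0 < m" using v(1) zero_less_mult_pos2[of m "v \<bullet> v"] by simp
  ultimately show ?thesis by simp
qed

lemma pnorm_bounds:
  fixes P :: "real^'n^'n"
  assumes "pos_def P"
  shows "sqrt (lambda_min P) * norm x \<le> pnorm P x" "pnorm P x \<le> sqrt (lambda_max P) * norm x"
proof -
  have sym: "transpose P = P" using assms by (simp add: pos_def_def)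
  have "lambda_min P * (norm x)\<^sup>2 \<le> x \<bullet> (P *v x)" "x \<bullet> (P *v x) \<le> lambda_max P * (norm x)\<^sup>2"
    using eigenvalue_bounds(1)[OF sym, of "lambda_min P"] eigenvalue_bounds(2)[OF sym, of "lambda_max P"] by auto
  then have "sqrt (lambda_min P * (norm x)\<^sup>2) \<le> pnorm P x" "pnorm P x \<le> sqrt (lambda_max P * (norm x)\<^sup>2)"
    unfolding pnorm_def by (simp_all only: real_sqrt_le_iff)
  then show "sqrt (lambda_min P) * norm x \<le> pnorm P x" "pnorm P x \<le> sqrt (lambda_max P) * norm x"
    by (simp_all add: real_sqrt_mult)
qed

lemma det_scaleR_matrix: "det (q *\<^sub>R (L :: real^'n^'n)) = q ^ CARD('n) * det L"
proof -
  have "q *\<^sub>R L = (\<chi> i. q *s (L $ i))" by (simp add: vec_eq_iff)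
  then show ?thesis using det_rows_mul[of "\<lambda>_. q" "\<lambda>i. L $ i"] by simp
qed

lemma continuous_matrix_vector [continuous_intros]: "continuous_on S (\<lambda>x. (A :: real^'n^'m) *v x)"
  by (intro linear_continuous_on linear_conv_bounded_linear[THEN iffD1]) simp

lemma continuous_pnorm: "continuous_on S (\<lambda>x. pnorm (P :: real^'n^'n) (A *v x))"
  unfolding pnorm_def matrix_vector_mul_assoc by (intro continuous_intros)

lemma pnorm_id_continuous: "continuous_on S (\<lambda>x. pnorm (P :: real^'n^'n) x)"
  unfolding pnorm_def by (intro continuous_intros)

lemma bad_set_borel:
  "{x. norm x \<le> 1 \<and> g * pnorm P x < pnorm P (A *v x)} \<in> sets (borel :: (real^'n) measure)"
proof -
  have [measurable]: "(\<lambda>x. pnorm P (A *v x)) \<in> borel_measurable borel" "(\<lambda>x. pnorm P x) \<in> borel_measurable borel"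
    using continuous_pnorm[of UNIV P A] pnorm_id_continuous[of UNIV P]
    by (auto intro: borel_measurable_continuous_onI)
  show ?thesis by measurable
qed

text \<open>
  In the coordinates \<open>y = L x\<close>, in which the norm of \<open>P\<close> is the Euclidean one, let \<open>u\<close> be the direction of
  the image of \<open>L x\<^sub>0\<close>. Pairing with \<open>u\<close> bounds the norm of every image from below by a linear form \<open>f\<close>
  whose norm exceeds \<open>g / zeta\<close>. So every \<open>y \<noteq> 0\<close> in a double cap around \<open>f\<close>, of a height \<open>c\<close> between
  \<open>g / norm f\<close> and \<open>zeta\<close>, is expanded by more than \<open>g\<close>, and this cap has relative
  measure more than \<open>2 s\<close>. Going back to the coordinate \<open>x\<close> costs at most the factor \<open>kappa P\<close>, since the unit ball of the \<open>P\<close>-norm lies in the ball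
  of radius \<open>1 / sqrt (lambda_min P)\<close>.
\<close>

lemma contraction_defect_measure:
  fixes A P :: "real^'n^'n"
  assumes n: "CARD('n) \<ge> 2" and P: "pos_def P" and g: "0 \<le> g" and s: "0 \<le> s" "s < 1 / 2"
    and x0: "g / zeta CARD('n) s * pnorm P x0 < pnorm P (A *v x0)"
  shows "2 * s * measure lborel (cball 0 1 :: (real^'n) set) <
         kappa P * measure lborel {x. norm x \<le> 1 \<and> g * pnorm P x < pnorm P (A *v x)}"
proof -
  obtain m where m: "CARD('n) = Suc m" "m > 0" using n by (cases "CARD('n)") auto
  let ?z = "zeta CARD('n) s"
  note z = zeta_properties[OF m s]
  obtain L B where LB: "L ** B = mat 1" "B ** L = mat 1" "det P = (det L)\<^sup>2" "\<And>x. pnorm P x = norm (L *v x)"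
    using pos_def_factor[OF P] by metis
  have BL: "B *v (L *v x) = x" "L *v (B *v x) = x" for x by (simp_all add: matrix_vector_mul_assoc LB)
  define A' where "A' = L ** A ** B"
  have A': "A' *v (L *v x) = L *v (A *v x)" for x by (simp add: A'_def matrix_vector_mul_assoc[symmetric] BL)
  define v where "v = L *v x0"
  define w where "w = A' *v v"
  have w: "g / ?z * norm v < norm w" using x0 by (simp add: LB(4) v_def w_def A')
  have wpos: "0 < norm w" using w g z(1) by (smt (verit) divide_nonneg_pos mult_nonneg_nonneg norm_ge_zero)
  have v0: "v \<noteq> 0" using wpos by (auto simp: w_def)
  define u where "u = (1 / norm w) *\<^sub>R w"
  have u: "norm u = 1" "u \<bullet> w = norm w" using wpos by (auto simp: u_def power2_norm_eq_inner[symmetric] power2_eq_square)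
  define f where "f = transpose A' *v u"
  have f: "f \<bullet> y = u \<bullet> (A' *v y)" for y
    unfolding f_def by (metis dot_lmul_matrix inner_commute transpose_matrix_vector)
  have fge: "\<bar>f \<bullet> y\<bar> \<le> norm (A' *v y)" for y
    using Cauchy_Schwarz_ineq2[of u "A' *v y"] u(1) by (simp add: f)
  have "norm w \<le> norm f * norm v" using f[of v] u(2) Cauchy_Schwarz_ineq2[of f v] by (simp add: w_def[symmetric])
  then have "g / ?z * norm v < norm f * norm v" using w by simp
  then have gf: "g / ?z < norm f" by (rule mult_right_less_imp_less) simp
  then have f0: "0 < norm f" using g z(1) by (smt (verit) divide_nonneg_pos)
  define e where "e = (1 / norm f) *\<^sub>R f"
  have e: "norm e = 1" "f = norm f *\<^sub>R e" using f0 by (auto simp: e_def)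
  have c0: "g / norm f < ?z" using gf f0 z(1) by (simp add: field_simps)
  define c where "c = (g / norm f + ?z) / 2"
  have c: "0 \<le> c" "c < ?z" "c < 1" "g < norm f * c"
  proof -
    have "0 \<le> g / norm f" using g by simp
    then show "0 \<le> c" "c < ?z" "c < 1" using c0 z by (auto simp: c_def)
    have "x < (x + y) / 2" if "x < y" for x y :: real using that by simp
    from this[OF c0] have "g / norm f < c" unfolding c_def .
    then show "g < norm f * c" using f0 by (simp add: field_simps)
  qed
  let ?T = "{y :: real^'n. norm y \<le> 1 \<and> c * norm y \<le> \<bar>e \<bullet> y\<bar>}"
  let ?S = "{x. norm x \<le> 1 \<and> g * pnorm P x < pnorm P (A *v x)}"
  let ?V = "measure lborel (cball 0 1 :: (real^'n) set)"
  have V: "0 < ?V" by (rule content_cball_pos) simp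
  have T: "measure lborel ?T = reg_inc_beta (1 - c\<^sup>2) (real m / 2) (1 / 2) * ?V"
    by (rule measure_double_cap[OF m(1) c(1,3) m(2) e(1)])
  have "2 * s < reg_inc_beta (1 - c\<^sup>2) (real m / 2) (1 / 2)"
  proof -
    have "c\<^sup>2 < ?z\<^sup>2" using c by (intro power_strict_mono) auto
    then have "reg_inc_beta (1 - ?z\<^sup>2) (real m / 2) (1 / 2) < reg_inc_beta (1 - c\<^sup>2) (real m / 2) (1 / 2)"
      using z by (intro reg_inc_beta_bij(2)[OF m(2)]) (auto simp: power_le_one)
    then show ?thesis using z(3) by simp
  qed
  then have "2 * s * ?V < measure lborel ?T" unfolding T using V by simp
  also have "measure lborel ?T \<le> kappa P * measure lborel ?S"
  proof -
    define q where "q = 1 / sqrt (lambda_min P)"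
    have lm: "0 < lambda_min P" by (rule pos_def_lambda_min_pos[OF P])
    then have q: "0 < q" by (simp add: q_def)
    let ?h = "\<lambda>x. (q *\<^sub>R L) *v x"
    have hx: "?h x = q *\<^sub>R (L *v x)" for x by (simp add: scaleR_matrix_vector_assoc)
    have lin: "linear ?h" by simp
    have Sm: "?S \<in> lmeasurable" by (rule borel_ball_lmeasurable[OF bad_set_borel, of _ _ _ 1]) auto
    have bT: "?T \<in> sets borel" by measurable
    have sub: "?T - {0} \<subseteq> ?h ` ?S"
    proof
      fix y assume y: "y \<in> ?T - {0}"
      define x where "x = (1 / q) *\<^sub>R (B *v y)"
      have y0: "y \<noteq> 0" using y by simp
      have Lx: "L *v x = (1 / q) *\<^sub>R y" by (simp add: x_def matrix_vector_mult_scaleR BL)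
      have "?h x = y" using q by (simp add: hx Lx)
      moreover have "norm x \<le> 1"
      proof -
        have "sqrt (lambda_min P) * norm x \<le> norm (L *v x)" using pnorm_bounds(1)[OF P, of x] LB(4) by simp
        also have "\<dots> = sqrt (lambda_min P) * norm y" using q by (simp add: Lx q_def)
        also have "\<dots> \<le> sqrt (lambda_min P) * 1" using y lm by (intro mult_left_mono) auto
        finally show ?thesis using lm by simp
      qed
      moreover have "g * pnorm P x < pnorm P (A *v x)"
      proof -
        have "g * norm y < norm f * c * norm y" using c(4) y0 by simp
        also have "\<dots> = norm f * (c * norm y)" by simp
        also have "\<dots> \<le> norm f * \<bar>e \<bullet> y\<bar>" using y by (intro mult_left_mono) auto
        also have "\<dots> = \<bar>f \<bullet> y\<bar>" by (subst (2) e(2)) (simp add: abs_mult)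
        also have "\<dots> \<le> norm (A' *v y)" by (rule fge)
        finally have "(1 / q) * (g * norm y) < (1 / q) * norm (A' *v y)" using q by (intro mult_strict_left_mono) auto
        moreover have "L *v (A *v x) = (1 / q) *\<^sub>R (A' *v y)" unfolding A'[symmetric] Lx by (simp add: matrix_vector_mult_scaleR)
        ultimately show ?thesis using q by (simp add: LB(4) Lx)
      qed
      ultimately show "y \<in> ?h ` ?S" by (intro image_eqI[of _ _ x]) auto
    qed
    have "measure lborel ?T = measure lebesgue (?T - {0})"
    proof -
      have "measure lborel (?T - {0}) = measure lborel ?T"
        by (rule measure_Diff_null_set) (use bT in \<open>auto simp: finite_imp_null_set_lborel\<close>)
      then show ?thesis using bT by simp
    qed
    also have "\<dots> \<le> measure lebesgue (?h ` ?S)"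
      using sub lebesgue_linear_image(1)[OF lin Sm] bT by (intro measure_mono_fmeasurable) auto
    also have "\<dots> = \<bar>det (matrix ?h)\<bar> * measure lebesgue ?S" by (rule lebesgue_linear_image(2)[OF lin Sm])
    also have "\<bar>det (matrix ?h)\<bar> = q ^ CARD('n) * \<bar>det L\<bar>"
      using q by (simp only: matrix_of_matrix_vector_mul det_scaleR_matrix) (simp add: abs_mult)
    also have "q ^ CARD('n) * \<bar>det L\<bar> = kappa P"
    proof -
      have "sqrt (lambda_min P ^ CARD('n)) = sqrt (lambda_min P) ^ CARD('n)" by (rule real_sqrt_power)
      moreover have "sqrt ((det L)\<^sup>2) = \<bar>det L\<bar>" by simp
      ultimately show ?thesis by (simp only: kappa_def LB(3) real_sqrt_divide q_def power_divide power_one) simp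
    qed
    also have "measure lebesgue ?S = measure lborel ?S"
      by (rule measure_completion) (simp only: sets_lborel bad_set_borel)
    finally show ?thesis .
  qed
  finally show ?thesis .
qed

lemma joint_spectral_radius_le:
  fixes A :: "'m \<Rightarrow> real^'n^'n"
  assumes P: "pos_def P" and r: "0 \<le> r" and con: "\<And>j x. pnorm P (A j *v x) \<le> r * pnorm P x"
  shows "joint_spectral_radius (range A) \<le> r"
proof -
  have lm: "0 < lambda_min P" "lambda_min P \<le> lambda_max P"
    using pos_def_lambda_min_pos[OF P] lambda_min_le_lambda_max P by (auto simp: pos_def_def)
  define C where "C = sqrt (lambda_max P) / sqrt (lambda_min P)"
  have C: "1 \<le> C" using lm by (simp add: C_def)
  have "norm (\<xi> t) \<le> C * r ^ t * norm (\<xi> 0)" if "is_trajectory (range A) \<xi>" for \<xi> t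
  proof -
    have step: "pnorm P (\<xi> (Suc t)) \<le> r * pnorm P (\<xi> t)" for t
    proof -
      obtain j where "\<xi> (Suc t) = A j *v \<xi> t" using \<open>is_trajectory (range A) \<xi>\<close> unfolding is_trajectory_def by blast
      then show ?thesis using con by simp
    qed
    have "pnorm P (\<xi> t) \<le> r ^ t * pnorm P (\<xi> 0)"
    proof (induction t)
      case (Suc t)
      have "pnorm P (\<xi> (Suc t)) \<le> r * pnorm P (\<xi> t)" by (rule step)
      also have "\<dots> \<le> r * (r ^ t * pnorm P (\<xi> 0))" using Suc r by (intro mult_left_mono)
      finally show ?case by simp
    qed simp
    then have "sqrt (lambda_min P) * norm (\<xi> t) \<le> r ^ t * (sqrt (lambda_max P) * norm (\<xi> 0))"
      using pnorm_bounds[OF P] r by (meson mult_left_mono order_trans zero_le_power)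
    then show ?thesis using lm by (simp add: C_def field_simps)
  qed
  then have "r \<in> {r. 0 \<le> r \<and> (\<exists>C\<ge>1. \<forall>\<xi>. is_trajectory (range A) \<xi> \<longrightarrow> (\<forall>t. norm (\<xi> t) \<le> C * r ^ t * norm (\<xi> 0)))}"
    using r C by blast
  then show ?thesis unfolding joint_spectral_radius_def by (intro cInf_lower bdd_belowI[of _ 0]) auto
qed

section \<open>The admissible quadratic forms and the uniform law on the sphere\<close>

text \<open>
  The constraint set of the scenario program for the matrix variable.
\<close>

definition spectral_body :: "real \<Rightarrow> (real^'n^'n) set" where
  "spectral_body \<delta> = {P. pos_def P \<and> loewner_le (mat 1) P \<and> loewner_le P (\<delta> *\<^sub>R mat 1)}"

lemma matrix_vector_minus_left: "(P - Q) *v x = P *v x - Q *v (x :: real^'n)"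
  by (simp add: matrix_vector_mult_def vec_eq_iff left_diff_distrib sum_subtractf)

lemma matrix_vector_add_left: "(P + Q) *v x = P *v x + Q *v (x :: real^'n)"
  by (simp add: matrix_vector_mult_def vec_eq_iff distrib_right sum.distrib)

lemma matrix_vector_scaleR_left: "(c *\<^sub>R P) *v x = c *\<^sub>R (P *v (x :: real^'n))"
  by (simp add: matrix_vector_mult_def vec_eq_iff sum_distrib_left mult.assoc)

lemma quadratic_form_linear: "linear (\<lambda>P. y \<bullet> (P *v (x :: real^'n)))"
  by (rule linearI) (simp_all add: matrix_vector_add_left matrix_vector_scaleR_left inner_add_right)

lemma quadratic_form_continuous: "continuous_on S (\<lambda>P. y \<bullet> (P *v (x :: real^'n)))"
  by (intro linear_continuous_on linear_conv_bounded_linear[THEN iffD1] quadratic_form_linear)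

lemma spectral_body_iff:
  "P \<in> spectral_body \<delta> \<longleftrightarrow> transpose P = P \<and> (\<forall>x. x \<bullet> x \<le> x \<bullet> (P *v x) \<and> x \<bullet> (P *v x) \<le> \<delta> * (x \<bullet> x))"
proof -
  have t: "transpose (P - mat 1) = P - mat 1 \<longleftrightarrow> transpose P = P" "transpose (\<delta> *\<^sub>R mat 1 - P) = \<delta> *\<^sub>R mat 1 - P \<longleftrightarrow> transpose P = P"
  proof -
    have "transpose (P - mat 1) = transpose P - mat 1" "transpose (\<delta> *\<^sub>R mat 1 - P) = \<delta> *\<^sub>R mat 1 - transpose P"
      by (auto simp: transpose_def vec_eq_iff mat_def)
    then show "transpose (P - mat 1) = P - mat 1 \<longleftrightarrow> transpose P = P" "transpose (\<delta> *\<^sub>R mat 1 - P) = \<delta> *\<^sub>R mat 1 - P \<longleftrightarrow> transpose P = P"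
      by simp_all
  qed
  have pd: "pos_def P" if "transpose P = P" "\<forall>x. x \<bullet> x \<le> x \<bullet> (P *v x)"
    using that unfolding pos_def_def by (metis inner_gt_zero_iff order_less_le_trans)
  show ?thesis
    unfolding spectral_body_def mem_Collect_eq loewner_le_def pos_semidef_def t
    using pd by (auto simp: matrix_vector_minus_left matrix_vector_scaleR_left inner_diff_right pos_def_def)
qed

lemma spectral_body_entry_sym:
  assumes "P \<in> spectral_body \<delta>"
  shows "P $ i $ j = P $ j $ i"
proof -
  have "transpose P $ j $ i = P $ i $ j" by (simp add: transpose_def)
  moreover have "transpose P = P" using assms by (simp add: spectral_body_iff)
  ultimately show ?thesis by simp
qed

lemma spectral_body_convex: "convex (spectral_body \<delta>)"
proof (rule convexI)
  fix P Q :: "real^'n^'n" and a b :: real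
  assume P: "P \<in> spectral_body \<delta>" and Q: "Q \<in> spectral_body \<delta>" and ab: "0 \<le> a" "0 \<le> b" "a + b = 1"
  have eq: "x \<bullet> ((a *\<^sub>R P + b *\<^sub>R Q) *v x) = a * (x \<bullet> (P *v x)) + b * (x \<bullet> (Q *v x))" for x
    by (simp add: matrix_vector_add_left matrix_vector_scaleR_left inner_add_right)
  have "transpose (a *\<^sub>R P + b *\<^sub>R Q) = a *\<^sub>R transpose P + b *\<^sub>R transpose Q"
    by (simp add: transpose_def vec_eq_iff)
  moreover have "x \<bullet> x \<le> a * (x \<bullet> (P *v x)) + b * (x \<bullet> (Q *v x))" for x
  proof -
    have "a * (x \<bullet> x) + b * (x \<bullet> x) \<le> a * (x \<bullet> (P *v x)) + b * (x \<bullet> (Q *v x))"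
      using P Q ab unfolding spectral_body_iff by (intro add_mono mult_left_mono) auto
    then show ?thesis using ab(3) by (simp add: distrib_right[symmetric])
  qed
  moreover have "a * (x \<bullet> (P *v x)) + b * (x \<bullet> (Q *v x)) \<le> \<delta> * (x \<bullet> x)" for x
  proof -
    have "a * (x \<bullet> (P *v x)) + b * (x \<bullet> (Q *v x)) \<le> a * (\<delta> * (x \<bullet> x)) + b * (\<delta> * (x \<bullet> x))"
      using P Q ab unfolding spectral_body_iff by (intro add_mono mult_left_mono) auto
    then show ?thesis using ab(3) by (simp add: distrib_right[symmetric])
  qed
  ultimately show "a *\<^sub>R P + b *\<^sub>R Q \<in> spectral_body \<delta>"
    using P Q unfolding spectral_body_iff eq by auto
qed

lemma spectral_body_compact: "compact (spectral_body \<delta> :: (real^'n^'n) set)"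
proof -
  have "closed (spectral_body \<delta> :: (real^'n^'n) set)"
  proof -
    have "spectral_body \<delta> = {P :: real^'n^'n. (\<forall>i j. P $ j $ i = P $ i $ j) \<and> (\<forall>x. x \<bullet> x \<le> x \<bullet> (P *v x) \<and> x \<bullet> (P *v x) \<le> \<delta> * (x \<bullet> x))}"
      by (auto simp: spectral_body_iff transpose_def vec_eq_iff)
    moreover have "closed \<dots>"
      by (intro closed_Collect_conj closed_Collect_all closed_Collect_eq closed_Collect_le continuous_intros quadratic_form_continuous)
    ultimately show ?thesis by simp
  qed
  moreover have "bounded (spectral_body \<delta> :: (real^'n^'n) set)"
  proof (rule boundedI)
    fix P :: "real^'n^'n" assume P: "P \<in> spectral_body \<delta>"
    have e: "axis i 1 \<bullet> (P *v axis j 1) = P $ i $ j" for i j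
      by (simp add: matrix_vector_mult_basis inner_axis' column_def)
    have sym: "P $ j $ i = P $ i $ j" for i j
      by (rule spectral_body_entry_sym[OF P])
    have dg: "1 \<le> P $ i $ i" "P $ i $ i \<le> \<delta>" for i
      using P[unfolded spectral_body_iff, THEN conjunct2, rule_format, of "axis i 1"] by (auto simp: e inner_axis_axis)
    have "\<bar>P $ i $ j\<bar> \<le> \<delta>" for i j
    proof (cases "i = j")
      case True then show ?thesis using dg[of i] by simp
    next
      case False
      \<comment> \<open>polarization bounds the entries off the diagonal\<close>
      have "(axis i 1 + axis j 1) \<bullet> (axis i 1 + axis j (1::real)) = 2"
           "(axis i 1 - axis j 1) \<bullet> (axis i 1 - axis j (1::real)) = 2"
        using False by (simp_all add: inner_add_left inner_add_right inner_diff_left inner_diff_right inner_axis_axis)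
      moreover have "(axis i 1 + axis j 1) \<bullet> (P *v (axis i 1 + axis j 1)) = P $ i $ i + 2 * P $ i $ j + P $ j $ j"
           "(axis i 1 - axis j 1) \<bullet> (P *v (axis i 1 - axis j 1)) = P $ i $ i - 2 * P $ i $ j + P $ j $ j"
        by (simp_all add: inner_add_left inner_add_right inner_diff_left inner_diff_right e sym[of j i] matrix_vector_right_distrib matrix_vector_mult_diff_distrib)
      ultimately show ?thesis
        using P[unfolded spectral_body_iff, THEN conjunct2, rule_format, of "axis i 1 + axis j 1"]
          P[unfolded spectral_body_iff, THEN conjunct2, rule_format, of "axis i 1 - axis j 1"] dg[of i] dg[of j] by auto
    qed
    then have "norm (P $ i) \<le> real CARD('n) * \<delta>" for i
      using sum_bounded_above[of UNIV "\<lambda>j. \<bar>P $ i $ j\<bar>" \<delta>] by (intro order_trans[OF norm_le_l1_cart]) simp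
    then have "(\<Sum>i\<in>UNIV. norm (P $ i)) \<le> real CARD('n) * (real CARD('n) * \<delta>)"
      using sum_bounded_above[of UNIV "\<lambda>i. norm (P $ i)" "real CARD('n) * \<delta>"] by simp
    then show "norm P \<le> real CARD('n) * (real CARD('n) * \<delta>)"
      using L2_set_le_sum[of UNIV "\<lambda>i. norm (P $ i)"] unfolding norm_vec_def[of P] by simp
  qed
  ultimately show ?thesis by (simp add: compact_eq_bounded_closed)
qed

lemma spectral_body_nonempty: "1 \<le> \<delta> \<Longrightarrow> mat 1 \<in> spectral_body \<delta>"
  using mult_right_mono[of 1 \<delta> "x \<bullet> x" for x] by (auto simp: spectral_body_iff)

text \<open>
  A symmetric matrix is a combination of matrices \<open>E S\<close>, one for each set \<open>S\<close> of one or two indices.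
\<close>

lemma dim_spectral_body: "dim (spectral_body \<delta> :: (real^'n^'n) set) \<le> CARD('n) * (CARD('n) + 1) div 2"
proof -
  define T where "T = {S :: 'n set. S \<subseteq> UNIV \<and> card S = 1} \<union> {S. S \<subseteq> UNIV \<and> card S = 2}"
  define E :: "'n set \<Rightarrow> real^'n^'n" where "E S = (\<chi> i j. if {i, j} = S then 1 else 0)" for S
  have finT: "finite T" by simp
  have "card T = card {S :: 'n set. S \<subseteq> UNIV \<and> card S = 1} + card {S :: 'n set. S \<subseteq> UNIV \<and> card S = 2}"
    unfolding T_def by (rule card_Un_disjoint) auto
  also have "\<dots> = (CARD('n) choose 1) + (CARD('n) choose 2)" by (simp only: n_subsets[OF finite])
  also have "\<dots> = Suc CARD('n) choose 2" by (simp add: numeral_2_eq_2)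
  also have "\<dots> = CARD('n) * (CARD('n) + 1) div 2" by (simp add: choose_two mult.commute)
  finally have cT: "card T = CARD('n) * (CARD('n) + 1) div 2" .
  have "spectral_body \<delta> \<subseteq> span (E ` T)"
  proof
    fix P :: "real^'n^'n" assume "P \<in> spectral_body \<delta>"
    then have sym: "P $ i $ j = P $ j $ i" for i j by (rule spectral_body_entry_sym)
    define p where "p S = (SOME r. \<exists>i j. S = {i, j} \<and> r = P $ i $ j)" for S
    have p: "p {i, j} = P $ i $ j" for i j
    proof -
      have "\<exists>i' j'. {i, j} = {i', j'} \<and> p {i, j} = P $ i' $ j'"
        unfolding p_def by (rule someI[of _ "P $ i $ j"]) blast
      then show ?thesis using sym by (metis doubleton_eq_iff)
    qed
    have inT: "{i, j} \<in> T" for i j by (cases "i = j") (auto simp: T_def)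
    have "P = (\<Sum>S\<in>T. p S *\<^sub>R E S)"
    proof -
      have "(\<Sum>S\<in>T. p S *\<^sub>R E S) $ i $ j = P $ i $ j" for i j
      proof -
        have "(\<Sum>S\<in>T. p S *\<^sub>R E S) $ i $ j = (\<Sum>S\<in>T. if {i, j} = S then p S else 0)"
          by (simp add: E_def if_distrib cong: if_cong)
        also have "\<dots> = p {i, j}" using inT finT by simp
        finally show ?thesis by (simp add: p)
      qed
      then show ?thesis by (simp add: vec_eq_iff)
    qed
    then show "P \<in> span (E ` T)" by (simp add: span_sum span_scale span_base)
  qed
  then have "dim (spectral_body \<delta> :: (real^'n^'n) set) \<le> card (E ` T)"
    using finT by (intro dim_le_card) auto
  also have "\<dots> \<le> card T" by (rule card_image_le[OF finT])
  finally show ?thesis using cT by simp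
qed

lemma spectral_body_pos_def: "P \<in> spectral_body \<delta> \<Longrightarrow> pos_def P"
  by (simp add: spectral_body_def)

lemma pnorm_triangle:
  assumes "pos_def (P :: real^'n^'n)"
  shows "pnorm P (x + y) \<le> pnorm P x + pnorm P y"
proof -
  obtain L B :: "real^'n^'n" where "L ** B = mat 1" "B ** L = mat 1" "det P = (det L)\<^sup>2" "\<And>x. pnorm P x = norm (L *v x)"
    using pos_def_factor[OF assms] by metis
  then show ?thesis by (simp add: matrix_vector_right_distrib norm_triangle_ineq)
qed

lemma pnorm_scaleR: "pnorm P (c *\<^sub>R (x :: real^'n)) = \<bar>c\<bar> * pnorm P x"
  by (simp add: pnorm_def matrix_vector_mult_scaleR real_sqrt_mult mult.assoc[symmetric])

lemma pnorm_minus: "pnorm P (- x :: real^'n) = pnorm P x"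
  using pnorm_scaleR[of P "-1" x] by simp

lemma pnorm_nonneg: "pos_def P \<Longrightarrow> 0 \<le> pnorm P (x :: real^'n)"
  unfolding pnorm_def pos_def_def by (cases "x = 0") (auto intro: less_imp_le)

text \<open>
  The level set is an affine image of a sphere.
\<close>

lemma pnorm_level_null:
  fixes P :: "real^'n^'n"
  assumes P: "pos_def P"
  shows "{w. (a + w) \<bullet> (P *v (a + w)) = c} \<in> null_sets lborel"
proof -
  obtain L B :: "real^'n^'n" where "L ** B = mat 1" "det P = (det L)\<^sup>2" and LB: "B ** L = mat 1" "\<And>x. pnorm P x = norm (L *v x)"
    using pos_def_factor[OF P] by metis
  let ?S = "{w. (a + w) \<bullet> (P *v (a + w)) = c}"
  have "?S \<subseteq> (+) (- a) ` (\<lambda>y. B *v y) ` sphere 0 (sqrt c)"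
  proof
    fix w assume w: "w \<in> ?S"
    have "norm (L *v (a + w)) = sqrt c" using w LB(2)[of "a + w"] by (simp add: pnorm_def)
    moreover have "w = - a + B *v (L *v (a + w))" by (simp add: matrix_vector_mul_assoc LB(1))
    ultimately show "w \<in> (+) (- a) ` (\<lambda>y. B *v y) ` sphere 0 (sqrt c)"
      by (intro image_eqI[of _ _ "B *v (L *v (a + w))"] imageI) (auto simp: dist_norm)
  qed
  moreover have "negligible ((+) (- a) ` (\<lambda>y. B *v y) ` sphere 0 (sqrt c))"
  proof (rule negligible_translation)
    have S: "sphere (0::real^'n) (sqrt c) \<in> lmeasurable" "measure lebesgue (sphere (0::real^'n) (sqrt c)) = 0"
      using negligible_sphere[of "0::real^'n" "sqrt c"] by (simp_all only: negligible_iff_measure)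
    have "linear (\<lambda>y. B *v y)" by simp
    from lebesgue_linear_image[OF this S(1)] S(2)
    show "negligible ((\<lambda>y. B *v y) ` sphere 0 (sqrt c))" by (simp add: negligible_iff_measure)
  qed
  ultimately have "negligible ?S" by (rule negligible_subset[rotated])
  moreover have "?S \<in> sets borel"
  proof -
    have "continuous_on UNIV (\<lambda>w. (a + w) \<bullet> (P *v (a + w)))"
      by (intro continuous_intros continuous_on_compose2[OF continuous_matrix_vector[of UNIV]]) auto
    then have "closed ?S" by (rule closed_Collect_eq) (rule continuous_on_const)
    then show ?thesis by simp
  qed
  ultimately show ?thesis
    by (simp add: negligible_iff_null_sets null_sets_completion_iff)
qed

lemma uniform_sphere_uminus:
  "distr uniform_sphere uniform_sphere uminus = (uniform_sphere :: (real^'n) measure)"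
proof (rule measure_eqI)
  let ?U = "uniform_sphere :: (real^'n) measure"
  have m: "uminus \<in> ?U \<rightarrow>\<^sub>M ?U"
    unfolding measurable_cong_sets[OF sets_uniform_sphere sets_uniform_sphere]
    by (intro measurable_restrict_space2) (auto simp: space_restrict_space measurable_restrict_space1)
  fix S assume "S \<in> sets (distr ?U ?U uminus)"
  then have S: "S \<in> sets borel" "S \<subseteq> sphere 0 1"
    by (auto simp: sets_uniform_sphere sets_restrict_space)
  have S': "uminus ` S \<in> sets borel" "uminus ` S \<subseteq> sphere 0 1"
  proof -
    have "uminus ` S = uminus -` S \<inter> space borel" by (force simp: image_iff)
    also have "\<dots> \<in> sets borel" using S(1) by (intro measurable_sets[of uminus borel borel]) auto
    finally show "uminus ` S \<in> sets borel" .
  qed (use S(2) in auto)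
  have ref: "distr lborel borel uminus = (lborel :: (real^'n) measure)"
    using lborel_affine_euclidean[of "\<lambda>_. -1" "0 :: real^'n"] lborel_affine[of "-1" "0 :: real^'n"] by (simp add: density_1)
  let ?V = "\<lambda>S. {x :: real^'n. x \<in> cball 0 1 - {0} \<and> sgn x \<in> S}"
  have "emeasure (distr ?U ?U uminus) S = emeasure ?U (uminus -` S \<inter> space ?U)"
    using S by (intro emeasure_distr m) (auto simp: sets_uniform_sphere sets_restrict_space)
  also have "uminus -` S \<inter> space ?U = uminus ` S" using S(2) by (force simp: space_uniform_sphere image_iff)
  also have "emeasure ?U (uminus ` S) = emeasure lborel (?V (uminus ` S)) / emeasure lborel (cball 0 1 :: (real^'n) set)"
    using emeasure_uniform_sphere[OF S'] by simp
  also have "emeasure lborel (?V (uminus ` S)) = emeasure (distr lborel borel uminus) (?V (uminus ` S))" by (simp only: ref)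
  also have "\<dots> = emeasure lborel (uminus -` ?V (uminus ` S) \<inter> space lborel)"
  proof (rule emeasure_distr)
    have "?V (uminus ` S) = (cball 0 1 - {0}) \<inter> (sgn -` (uminus ` S) \<inter> space borel)" by auto
    also have "\<dots> \<in> sets borel" using S'(1) by (intro sets.Int measurable_sets[OF borel_measurable_sgn]) auto
    finally show "?V (uminus ` S) \<in> sets borel" .
  qed simp
  also have "uminus -` ?V (uminus ` S) \<inter> space lborel = ?V S"
    by (force simp: sgn_minus image_iff)
  also have "emeasure lborel (?V S) / emeasure lborel (cball 0 1 :: (real^'n) set) = emeasure ?U S"
    using emeasure_uniform_sphere[OF S] by simp
  finally show "emeasure (distr ?U ?U uminus) S = emeasure ?U S" .
qed simp

lemma nn_integral_uniform_sphere_uminus: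
  assumes "f \<in> borel_measurable (uniform_sphere :: (real^'n) measure)"
  shows "(\<integral>\<^sup>+x. f (- x) \<partial>uniform_sphere) = (\<integral>\<^sup>+x. f x \<partial>uniform_sphere)"
proof -
  let ?U = "uniform_sphere :: (real^'n) measure"
  have m: "uminus \<in> ?U \<rightarrow>\<^sub>M ?U"
    unfolding measurable_cong_sets[OF sets_uniform_sphere sets_uniform_sphere]
    by (intro measurable_restrict_space2) (auto simp: space_restrict_space measurable_restrict_space1)
  have "(\<integral>\<^sup>+x. f x \<partial>?U) = (\<integral>\<^sup>+x. f x \<partial>distr ?U ?U uminus)" by (simp add: uniform_sphere_uminus)
  also have "\<dots> = (\<integral>\<^sup>+x. f (- x) \<partial>?U)" using m assms by (intro nn_integral_distr) simp_all
  finally show ?thesis by simp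
qed

text \<open>
  Being expanded by more than \<open>g\<close> is invariant under scaling, so the cone over the bad part of the sphere
  is the bad part of the ball.
\<close>

lemma emeasure_sphere_bad_set:
  fixes A P :: "real^'n^'n"
  shows "emeasure uniform_sphere {x. norm x = 1 \<and> g * pnorm P x < pnorm P (A *v x)} =
    emeasure lborel {x. norm x \<le> 1 \<and> g * pnorm P x < pnorm P (A *v x)} / emeasure lborel (cball 0 1 :: (real^'n) set)"
proof -
  let ?S = "{x. norm x = 1 \<and> g * pnorm P x < pnorm P (A *v x)}"
  have [measurable]: "(\<lambda>x. pnorm P (A *v x)) \<in> borel_measurable borel" "(\<lambda>x. pnorm P x) \<in> borel_measurable borel"
    using continuous_pnorm[of UNIV P A] pnorm_id_continuous[of UNIV P]
    by (auto intro: borel_measurable_continuous_onI)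
  have hom: "g * pnorm P (sgn x) < pnorm P (A *v sgn x) \<longleftrightarrow> g * pnorm P x < pnorm P (A *v x)" if "x \<noteq> 0" for x
    using that unfolding sgn_div_norm matrix_vector_mult_scaleR pnorm_scaleR
    by (simp add: mult.left_commute[of g] divide_inverse[symmetric])
  have "?S \<in> sets borel" by measurable
  moreover have "?S \<subseteq> sphere 0 1" by auto
  moreover have "{x \<in> cball 0 1 - {0}. sgn x \<in> ?S} = {x. norm x \<le> 1 \<and> g * pnorm P x < pnorm P (A *v x)}"
  proof (intro set_eqI iffI)
    fix x assume x: "x \<in> {x. norm x \<le> 1 \<and> g * pnorm P x < pnorm P (A *v x)}"
    then have "x \<noteq> 0" by (auto simp: pnorm_def)
    then show "x \<in> {x \<in> cball 0 1 - {0}. sgn x \<in> ?S}" using x hom[of x] by (auto simp: norm_sgn)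
  next
    fix x assume x: "x \<in> {x \<in> cball 0 1 - {0}. sgn x \<in> ?S}"
    then show "x \<in> {x. norm x \<le> 1 \<and> g * pnorm P x < pnorm P (A *v x)}" using hom[of x] by auto
  qed
  ultimately show ?thesis using emeasure_uniform_sphere[of ?S] by simp
qed

section \<open>Noisy samples of a switched system\<close>

text \<open>
  The squared norms of the two sides of the constraint of a sample, as functions of the matrix.
\<close>

definition out_form :: "('m \<Rightarrow> real^'n^'n) \<Rightarrow> (real^'n) \<times> 'm \<times> (real^'n) \<Rightarrow> real^'n^'n \<Rightarrow> real" where
  "out_form A z P = (A (fst (snd z)) *v fst z + snd (snd z)) \<bullet> (P *v (A (fst (snd z)) *v fst z + snd (snd z)))"

definition in_form :: "(real^'n) \<times> 'b \<Rightarrow> real^'n^'n \<Rightarrow> real" where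
  "in_form z P = fst z \<bullet> (P *v fst z)"

lemma measurable_quadratic_form:
  assumes "f \<in> M \<rightarrow>\<^sub>M borel"
  shows "(\<lambda>x. f x \<bullet> ((P :: real^'n^'n) *v f x)) \<in> borel_measurable M"
  by (rule measurable_compose[OF assms], rule borel_measurable_continuous_onI) (intro continuous_intros)

locale noisy_samples =
  fixes A :: "'m::finite \<Rightarrow> real^'n^'n" and \<delta> :: real and \<phi> :: "real^'n^'n \<Rightarrow> real"
    and \<mu>_mode :: "'m pmf" and \<W> :: "(real^'n) set" and \<mu>_noise :: "(real^'n) measure"
  assumes bound: "1 \<le> \<delta>"
    and cont_\<phi>: "continuous_on {P. pos_def P} \<phi>"
    and strict_\<phi>: "strictly_convex_on {P. pos_def P} \<phi>"
    and prob_noise: "prob_space \<mu>_noise"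
    and sets_noise: "sets \<mu>_noise = sets (restrict_space borel \<W>)"
    and ac_noise: "absolutely_continuous lborel (distr \<mu>_noise borel (\<lambda>w. w))"
begin

abbreviation "\<nu> \<equiv> \<mu>_noise"
abbreviation "sample_law \<equiv> sample_measure \<mu>_mode \<nu>"

lemma noise_ident: "(\<lambda>w. w) \<in> \<nu> \<rightarrow>\<^sub>M borel"
  unfolding measurable_cong_sets[OF sets_noise refl]
  by (rule measurable_restrict_space1) simp

lemma state_ident: "(\<lambda>x. x) \<in> (uniform_sphere :: (real^'n) measure) \<rightarrow>\<^sub>M borel"
  unfolding measurable_cong_sets[OF sets_uniform_sphere refl]
  by (rule measurable_restrict_space1) simp

lemma sample_measurable:
  "fst \<in> sample_law \<rightarrow>\<^sub>M borel" "(\<lambda>z. fst (snd z)) \<in> sample_law \<rightarrow>\<^sub>M count_space UNIV"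
  "(\<lambda>z. snd (snd z)) \<in> sample_law \<rightarrow>\<^sub>M borel"
proof -
  have 1: "fst \<in> sample_law \<rightarrow>\<^sub>M uniform_sphere" and 2: "snd \<in> sample_law \<rightarrow>\<^sub>M measure_pmf \<mu>_mode \<Otimes>\<^sub>M \<nu>"
    unfolding sample_measure_def by simp_all
  show "fst \<in> sample_law \<rightarrow>\<^sub>M borel" using measurable_compose[OF 1 state_ident] by simp
  have "(\<lambda>z. fst (snd z)) \<in> sample_law \<rightarrow>\<^sub>M measure_pmf \<mu>_mode" using measurable_compose[OF 2 measurable_fst] .
  then show "(\<lambda>z. fst (snd z)) \<in> sample_law \<rightarrow>\<^sub>M count_space UNIV"
    by (simp cong: measurable_cong_sets)
  show "(\<lambda>z. snd (snd z)) \<in> sample_law \<rightarrow>\<^sub>M borel"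
    using measurable_compose[OF measurable_compose[OF 2 measurable_snd] noise_ident] .
qed

lemma space_sample: "z \<in> space sample_law \<Longrightarrow> fst z \<in> sphere 0 1"
  by (auto simp: sample_measure_def space_pair_measure space_uniform_sphere)

sublocale noise: prob_space \<nu> by (rule prob_noise)

sublocale sphere: prob_space "uniform_sphere :: (real^'n) measure" by (rule prob_space_uniform_sphere)

sublocale mode_noise: pair_prob_space "measure_pmf \<mu>_mode" \<nu> ..

sublocale sample: pair_prob_space "uniform_sphere :: (real^'n) measure" "measure_pmf \<mu>_mode \<Otimes>\<^sub>M \<nu>" ..

lemma prob_sample: "prob_space sample_law"
  unfolding sample_measure_def by (rule sample.prob_space_axioms)

lemma measurable_output: "(\<lambda>z. A (fst (snd z)) *v fst z + snd (snd z)) \<in> sample_law \<rightarrow>\<^sub>M borel"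
proof (rule borel_measurable_add)
  show "(\<lambda>z. A (fst (snd z)) *v fst z) \<in> sample_law \<rightarrow>\<^sub>M borel"
  proof (rule measurable_compose_countable'[OF _ sample_measurable(2)])
    fix j
    show "(\<lambda>z. A j *v fst z) \<in> sample_law \<rightarrow>\<^sub>M borel"
      by (rule measurable_compose[OF sample_measurable(1)], rule borel_measurable_continuous_onI)
         (rule continuous_matrix_vector)
  qed (simp add: countable_finite)
qed (rule sample_measurable(3))

lemma measurable_out_form: "(\<lambda>z. out_form A z P) \<in> borel_measurable sample_law"
  unfolding out_form_def by (rule measurable_quadratic_form[OF measurable_output])

lemma measurable_in_form: "(\<lambda>z. in_form z P) \<in> borel_measurable sample_law"
  unfolding in_form_def using sample_measurable(1) by (intro measurable_quadratic_form) simp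

text \<open>
  For fixed state and mode the tight noise values form the boundary of an ellipsoid.
\<close>

lemma AE_not_tight:
  assumes P: "pos_def P"
  shows "AE z in sample_law. out_form A z P \<noteq> c * in_form z P"
proof -
  have meas: "{z \<in> space sample_law. out_form A z P \<noteq> c * in_form z P} \<in> sets sample_law"
    using measurable_out_form[of P] measurable_in_form[of P] by measurable
  have inner: "AE w in \<nu>. out_form A (x, j, w) P \<noteq> c * in_form (x, j, w) P" for x j
  proof -
    let ?T = "{w. (A j *v x + w) \<bullet> (P *v (A j *v x + w)) = c * in_form (x, j, 0 :: real^'n) P}"
    have T: "?T \<in> null_sets lborel" by (rule pnorm_level_null[OF P])
    then have "?T \<in> null_sets (distr \<nu> borel (\<lambda>w. w))" using ac_noise by (auto simp: absolutely_continuous_def)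
    then have "AE w in distr \<nu> borel (\<lambda>w. w). w \<notin> ?T" by (rule AE_not_in)
    then have "AE w in \<nu>. w \<notin> ?T" by (rule AE_distrD[OF noise_ident])
    then show ?thesis by (simp add: out_form_def in_form_def)
  qed
  have "AE p in measure_pmf \<mu>_mode \<Otimes>\<^sub>M \<nu>. out_form A (x, p) P \<noteq> c * in_form (x, p) P" if "x \<in> space uniform_sphere" for x
  proof (rule mode_noise.AE_pair_measure)
    have "Pair x \<in> measure_pmf \<mu>_mode \<Otimes>\<^sub>M \<nu> \<rightarrow>\<^sub>M sample_law"
      unfolding sample_measure_def using that by measurable
    from measurable_sets[OF this meas]
    have "Pair x -` {z \<in> space sample_law. out_form A z P \<noteq> c * in_form z P} \<inter> space (measure_pmf \<mu>_mode \<Otimes>\<^sub>M \<nu>) \<in> sets (measure_pmf \<mu>_mode \<Otimes>\<^sub>M \<nu>)" .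
    moreover have "Pair x -` {z \<in> space sample_law. out_form A z P \<noteq> c * in_form z P} \<inter> space (measure_pmf \<mu>_mode \<Otimes>\<^sub>M \<nu>) =
       {p \<in> space (measure_pmf \<mu>_mode \<Otimes>\<^sub>M \<nu>). out_form A (x, p) P \<noteq> c * in_form (x, p) P}"
      using that by (auto simp: sample_measure_def space_pair_measure)
    ultimately show "{p \<in> space (measure_pmf \<mu>_mode \<Otimes>\<^sub>M \<nu>). out_form A (x, p) P \<noteq> c * in_form (x, p) P} \<in> sets (measure_pmf \<mu>_mode \<Otimes>\<^sub>M \<nu>)" by simp
  qed (use inner in auto)
  then show ?thesis
    unfolding sample_measure_def using meas unfolding sample_measure_def
    by (intro sample.AE_pair_measure) auto
qed

sublocale fractional_scenario sample_law "spectral_body \<delta>" "out_form A" in_form \<phi>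
proof -
  interpret S: prob_space sample_law by (rule prob_sample)
  have sub: "spectral_body \<delta> \<subseteq> {P :: real^'n^'n. pos_def P}" using spectral_body_pos_def by auto
  show "fractional_scenario sample_law (spectral_body \<delta>) (out_form A) in_form \<phi>"
  proof (intro fractional_scenario.intro fractional_program.intro fractional_scenario_axioms.intro prob_sample)
    show "strictly_convex_on (spectral_body \<delta>) \<phi>"
      using strict_\<phi> sub spectral_body_convex unfolding strictly_convex_on_def by (metis (no_types, lifting) subsetD)
    show "linear (out_form A z)" "linear (in_form z)" for z
      unfolding out_form_def [abs_def] in_form_def [abs_def] by (rule quadratic_form_linear)+
    show "0 \<le> out_form A z P" if "P \<in> spectral_body \<delta>" for z P
      using that inner_ge_zero order_trans unfolding spectral_body_iff out_form_def by blast
    show "0 < in_form z P" if "z \<in> space sample_law" "P \<in> spectral_body \<delta>" for z P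
    proof -
      have "fst z \<noteq> 0" using space_sample[OF that(1)] by auto
      then show ?thesis using spectral_body_pos_def[OF that(2)] unfolding in_form_def pos_def_def by blast
    qed
    show "AE z in sample_law. out_form A z P \<noteq> g\<^sup>2 * in_form z P" if "P \<in> spectral_body \<delta>" for g P
      by (rule AE_not_tight[OF spectral_body_pos_def[OF that]])
  qed (use spectral_body_compact spectral_body_convex spectral_body_nonempty[OF bound] continuous_on_subset[OF cont_\<phi> sub]
        measurable_out_form measurable_in_form in auto)
qed

lemma scenario_feasible_iff: "scenario_feasible A \<delta> N \<omega> g P \<longleftrightarrow> feasible (\<omega> ` {1..N}) g P"
proof -
  have "pnorm P (A j *v x + w) \<le> g * pnorm P x \<longleftrightarrow> out_form A (x, j, w) P \<le> g\<^sup>2 * in_form (x, j, w) P"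
    if P: "P \<in> spectral_body \<delta>" and g: "0 \<le> g" for x j w
  proof -
    have "pnorm P (A j *v x + w) \<le> g * pnorm P x \<longleftrightarrow> sqrt (out_form A (x, j, w) P) \<le> sqrt (g\<^sup>2 * in_form (x, j, w) P)"
      using g by (simp add: pnorm_def out_form_def in_form_def real_sqrt_mult)
    then show ?thesis by simp
  qed
  then have c: "(case z of (x, j, w) \<Rightarrow> pnorm P (A j *v x + w) \<le> g * pnorm P x) \<longleftrightarrow> out_form A z P \<le> g\<^sup>2 * in_form z P"
    if "P \<in> spectral_body \<delta>" "0 \<le> g" for z using that by (cases z) simp
  have "scenario_feasible A \<delta> N \<omega> g P \<longleftrightarrow> 0 \<le> g \<and> P \<in> spectral_body \<delta> \<and>
      (\<forall>i\<in>{1..N}. case \<omega> i of (x, j, w) \<Rightarrow> pnorm P (A j *v x + w) \<le> g * pnorm P x)"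
    by (simp add: scenario_feasible_def spectral_body_def)
  also have "\<dots> \<longleftrightarrow> 0 \<le> g \<and> P \<in> spectral_body \<delta> \<and> (\<forall>i\<in>{1..N}. out_form A (\<omega> i) P \<le> g\<^sup>2 * in_form (\<omega> i) P)"
    by (intro conj_cong refl ball_cong c)
  finally show ?thesis by (simp add: feasible_def)
qed

lemma optimum_eq: "gamma_star A \<delta> N \<omega> = opt_value (\<omega> ` {1..N})" "P_star A \<delta> \<phi> N \<omega> = opt_point (\<omega> ` {1..N})"
proof -
  show g: "gamma_star A \<delta> N \<omega> = opt_value (\<omega> ` {1..N})"
    by (simp add: gamma_star_def opt_value_def scenario_feasible_iff)
  then show "P_star A \<delta> \<phi> N \<omega> = opt_point (\<omega> ` {1..N})"
    by (simp add: P_star_def opt_point_def optimal_matrices_def opt_set_def scenario_feasible_iff)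
qed

text \<open>
  A noise of norm at most \<open>W\<close> has \<open>P\<close>-norm at most \<open>W sqrt (kappa_bar P)\<close> times that of \<open>x\<close>, which the
  excess of a bad state compensates. For any noise, \<open>2 A\<^sub>j x\<close> is the difference of the outputs at \<open>x\<close>
  and \<open>-x\<close>, so one of the two outputs is at least as long as \<open>A\<^sub>j x\<close>.
\<close>

lemma bad_state_violations:
  assumes P: "pos_def P" and g: "0 \<le> g" and W: "0 \<le> W" and x: "norm x = 1"
    and bad: "(g + W * sqrt (kappa_bar P)) * pnorm P x < pnorm P (A j *v x)"
  shows "norm w \<le> W \<Longrightarrow> g * pnorm P x < pnorm P (A j *v x + w)"
    and "g * pnorm P x < pnorm P (A j *v x + w) \<or> g * pnorm P x < pnorm P (A j *v (- x) + w)"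
proof -
  have lm: "0 < lambda_min P" "lambda_min P \<le> lambda_max P"
    using pos_def_lambda_min_pos[OF P] lambda_min_le_lambda_max P by (auto simp: pos_def_def)
  have k: "sqrt (lambda_max P) \<le> sqrt (kappa_bar P) * pnorm P x"
  proof -
    have "sqrt (kappa_bar P) * sqrt (lambda_min P) \<le> sqrt (kappa_bar P) * pnorm P x"
      using pnorm_bounds(1)[OF P, of x] x lm by (intro mult_left_mono) (auto simp: kappa_bar_def)
    moreover have "sqrt (kappa_bar P) * sqrt (lambda_min P) = sqrt (lambda_max P)"
      using lm by (simp add: kappa_bar_def real_sqrt_divide)
    ultimately show ?thesis by simp
  qed
  have kb: "0 \<le> sqrt (kappa_bar P)" using lm by (simp add: kappa_bar_def)
  have px: "0 \<le> pnorm P x" by (rule pnorm_nonneg[OF P])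
  show "g * pnorm P x < pnorm P (A j *v x + w)" if w: "norm w \<le> W"
  proof -
    have "pnorm P w \<le> sqrt (lambda_max P) * W"
      using pnorm_bounds(2)[OF P, of w] w lm by (meson mult_left_mono order_trans real_sqrt_ge_zero less_imp_le)
    also have "\<dots> \<le> sqrt (kappa_bar P) * pnorm P x * W" using k W by (rule mult_right_mono)
    finally have pw: "pnorm P w \<le> W * sqrt (kappa_bar P) * pnorm P x" by (simp add: mult_ac)
    have "pnorm P (A j *v x) \<le> pnorm P (A j *v x + w) + pnorm P w"
      using pnorm_triangle[OF P, of "A j *v x + w" "- w"] by (simp add: pnorm_minus)
    then show ?thesis using bad pw by (simp add: distrib_right)
  qed
  show "g * pnorm P x < pnorm P (A j *v x + w) \<or> g * pnorm P x < pnorm P (A j *v (- x) + w)"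
  proof -
    have "g * pnorm P x \<le> (g + W * sqrt (kappa_bar P)) * pnorm P x" using W kb px by (intro mult_right_mono) auto
    then have b: "g * pnorm P x < pnorm P (A j *v x)" using bad by simp
    have "2 * pnorm P (A j *v x) = pnorm P (2 *\<^sub>R (A j *v x))" by (simp add: pnorm_scaleR)
    also have "2 *\<^sub>R (A j *v x) = (A j *v x + w) + - (A j *v (- x) + w)"
    proof -
      have "A j *v (- x) = - (A j *v x)" by (simp add: vec_eq_iff matrix_vector_mult_def sum_negf)
      then show ?thesis by (simp add: scaleR_2)
    qed
    also have "pnorm P \<dots> \<le> pnorm P (A j *v x + w) + pnorm P (A j *v (- x) + w)"
      using pnorm_triangle[OF P, of "A j *v x + w" "- (A j *v (- x) + w)"] by (simp only: pnorm_minus)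
    finally show ?thesis using b by linarith
  qed
qed

lemma violated_iff_pnorm:
  assumes P: "pos_def P" and g: "0 \<le> g"
  shows "violated (g, P) (x, j, w) \<longleftrightarrow> g * pnorm P x < pnorm P (A j *v x + w)"
proof -
  have "g * pnorm P x < pnorm P (A j *v x + w) \<longleftrightarrow> sqrt (g\<^sup>2 * in_form (x, j, w) P) < sqrt (out_form A (x, j, w) P)"
    using g by (simp add: pnorm_def out_form_def in_form_def real_sqrt_mult)
  then show ?thesis by (simp add: violated_def)
qed

lemma measurable_violated: "{z \<in> space sample_law. violated (g, P) z} \<in> sets sample_law"
  unfolding violated_def fst_conv snd_conv using measurable_out_form[of P] measurable_in_form[of P] by measurable

text \<open>
  For a bad \<open>x\<close> the noise values that lead to a violation at \<open>x\<close> and those at \<open>-x\<close> together exhaust the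
  noise space, and both contain the ball of radius \<open>W\<close>. By inclusion and exclusion their probabilities add
  up to at least \<open>2 - q\<close>. The law of the state is symmetric, so on average over the bad states a single
  state leads to a violation with probability at least \<open>1 - q / 2\<close>.
\<close>

lemma bad_states_le_violation:
  assumes P: "pos_def P" and g: "0 \<le> g" and W: "0 \<le> W" and \<alpha>: "0 \<le> \<alpha>" "\<alpha> \<le> pmf \<mu>_mode j"
    and q: "measure (distr \<nu> borel (\<lambda>w. w)) {w. norm w > W} \<le> q" "q \<le> 1"
  shows "\<alpha> * (1 - q / 2) * measure lborel {x. norm x \<le> 1 \<and> (g + W * sqrt (kappa_bar P)) * pnorm P x < pnorm P (A j *v x)}
     \<le> measure sample_law {z \<in> space sample_law. violated (g, P) z} * measure lborel (cball 0 1 :: (real^'n) set)"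
proof -
  let ?\<mu> = "uniform_sphere :: (real^'n) measure"
  let ?Viol = "{z \<in> space sample_law. violated (g, P) z}"
  let ?gb = "g + W * sqrt (kappa_bar P)"
  let ?S = "{x. norm x \<le> 1 \<and> ?gb * pnorm P x < pnorm P (A j *v x)}"
  let ?S' = "{x. norm x = 1 \<and> ?gb * pnorm P x < pnorm P (A j *v x)}"
  define E where "E x = {w \<in> space \<nu>. violated (g, P) (x, j, w)}" for x
  define f where "f x = emeasure \<nu> (E x)" for x
  have sp: "space ?\<mu> = sphere 0 1" by (rule space_uniform_sphere)
  have emb: "(\<lambda>p. (fst p, j, snd p)) \<in> ?\<mu> \<Otimes>\<^sub>M \<nu> \<rightarrow>\<^sub>M sample_law" unfolding sample_measure_def by measurable
  have Violj: "{p \<in> space (?\<mu> \<Otimes>\<^sub>M \<nu>). violated (g, P) (fst p, j, snd p)} \<in> sets (?\<mu> \<Otimes>\<^sub>M \<nu>)"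
  proof -
    have eq: "(\<lambda>p. (fst p, j, snd p)) -` ?Viol \<inter> space (?\<mu> \<Otimes>\<^sub>M \<nu>) = {p \<in> space (?\<mu> \<Otimes>\<^sub>M \<nu>). violated (g, P) (fst p, j, snd p)}"
      using measurable_space[OF emb] by auto
    show ?thesis using measurable_sets[OF emb measurable_violated[of g P]] unfolding eq .
  qed
  have fE: "emeasure \<nu> (Pair x -` {p \<in> space (?\<mu> \<Otimes>\<^sub>M \<nu>). violated (g, P) (fst p, j, snd p)}) = f x" if "x \<in> space ?\<mu>" for x
    using that unfolding f_def E_def by (intro arg_cong[where f="emeasure \<nu>"]) (auto simp: space_pair_measure)
  have fm: "f \<in> borel_measurable ?\<mu>"
    using noise.measurable_emeasure_Pair[OF Violj] fE by (simp cong: measurable_cong)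
  have Em: "E x \<in> sets \<nu>" if "x \<in> space ?\<mu>" for x
  proof -
    have "Pair x -` {p \<in> space (?\<mu> \<Otimes>\<^sub>M \<nu>). violated (g, P) (fst p, j, snd p)} = E x"
      using that by (auto simp: E_def space_pair_measure)
    then show ?thesis using sets_Pair1[OF Violj, of x] by simp
  qed
  have step1: "ennreal \<alpha> * (\<integral>\<^sup>+x. f x \<partial>?\<mu>) \<le> emeasure sample_law ?Viol"
  proof -
    have "ennreal \<alpha> * (\<integral>\<^sup>+x. f x \<partial>?\<mu>) = (\<integral>\<^sup>+x. ennreal \<alpha> * f x \<partial>?\<mu>)" using fm by (simp add: nn_integral_cmult)
    also have "\<dots> \<le> (\<integral>\<^sup>+x. emeasure (measure_pmf \<mu>_mode \<Otimes>\<^sub>M \<nu>) (Pair x -` ?Viol) \<partial>?\<mu>)"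
    proof (rule nn_integral_mono)
      fix x assume x: "x \<in> space ?\<mu>"
      have m: "Pair x -` ?Viol \<in> sets (measure_pmf \<mu>_mode \<Otimes>\<^sub>M \<nu>)"
        using measurable_violated unfolding sample_measure_def by (rule sets_Pair1)
      have "ennreal \<alpha> * f x \<le> f x * emeasure (measure_pmf \<mu>_mode) {j}"
        using \<alpha> by (subst mult.commute) (auto simp: emeasure_pmf_single intro!: mult_left_mono ennreal_leI)
      also have "\<dots> = (\<integral>\<^sup>+k. f x * indicator {j} k \<partial>measure_pmf \<mu>_mode)" by (simp add: nn_integral_cmult_indicator)
      also have "\<dots> \<le> (\<integral>\<^sup>+k. emeasure \<nu> (Pair k -` Pair x -` ?Viol) \<partial>measure_pmf \<mu>_mode)"
      proof (rule nn_integral_mono)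
        fix k
        have "Pair j -` Pair x -` ?Viol = E x" using x by (auto simp: E_def sample_measure_def space_pair_measure)
        then show "f x * indicator {j} k \<le> emeasure \<nu> (Pair k -` Pair x -` ?Viol)"
          by (auto simp: f_def indicator_def)
      qed
      also have "\<dots> = emeasure (measure_pmf \<mu>_mode \<Otimes>\<^sub>M \<nu>) (Pair x -` ?Viol)"
        using m by (rule noise.emeasure_pair_measure_alt[symmetric])
      finally show "ennreal \<alpha> * f x \<le> emeasure (measure_pmf \<mu>_mode \<Otimes>\<^sub>M \<nu>) (Pair x -` ?Viol)" .
    qed
    also have "\<dots> = emeasure sample_law ?Viol"
      using measurable_violated unfolding sample_measure_def by (rule mode_noise.emeasure_pair_measure_alt[symmetric])
    finally show ?thesis .
  qed
  have S'm: "?S' \<in> sets ?\<mu>"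
  proof -
    have [measurable]: "(\<lambda>x. pnorm P (A j *v x)) \<in> borel_measurable borel" "(\<lambda>x. pnorm P x) \<in> borel_measurable borel"
      using continuous_pnorm[of UNIV P "A j"] pnorm_id_continuous[of UNIV P]
      by (auto intro: borel_measurable_continuous_onI)
    have "?S' \<in> sets borel" by measurable
    then show ?thesis unfolding sets_uniform_sphere sets_restrict_space by (intro image_eqI[of _ _ ?S']) auto
  qed
  have smallW: "1 - q \<le> measure \<nu> {w \<in> space \<nu>. norm w \<le> W}"
  proof -
    have "measure (distr \<nu> borel (\<lambda>w. w)) {w. norm w > W} = measure \<nu> {w \<in> space \<nu>. norm w > W}"
      by (subst measure_distr[OF noise_ident]) (auto intro!: arg_cong[where f="measure \<nu>"])
    moreover have "{w \<in> space \<nu>. norm w > W} \<in> sets \<nu>"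
      using measurable_sets[OF noise_ident, of "{w. norm w > W}"] by (simp add: vimage_def Int_def conj_commute)
    then have "measure \<nu> {w \<in> space \<nu>. \<not> norm w > W} = 1 - measure \<nu> {w \<in> space \<nu>. norm w > W}"
      by (rule noise.prob_neg)
    ultimately show ?thesis using q(1) by (simp add: not_less)
  qed
  have step2: "ennreal (2 - q) * indicator ?S' x \<le> f x + f (- x)" if x: "x \<in> space ?\<mu>" for x
  proof (cases "x \<in> ?S'")
    case True
    then have b: "norm x = 1" "?gb * pnorm P x < pnorm P (A j *v x)" by auto
    have b': "norm (- x) = 1" "?gb * pnorm P (- x) < pnorm P (A j *v (- x))"
    proof -
      have "A j *v (- x) = - (A j *v x)" by (simp add: vec_eq_iff matrix_vector_mult_def sum_negf)
      then show "norm (- x) = 1" "?gb * pnorm P (- x) < pnorm P (A j *v (- x))" using b by (simp_all add: pnorm_minus)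
    qed
    have mx: "- x \<in> space ?\<mu>" using x sp by simp
    note Em' = Em[OF x] Em[OF mx]
    have un: "E x \<union> E (- x) = space \<nu>"
      using bad_state_violations(2)[OF P g W b] by (auto simp: E_def violated_iff_pnorm[OF P g] pnorm_minus)
    have "1 + (1 - q) \<le> measure \<nu> (E x \<union> E (- x)) + measure \<nu> (E x \<inter> E (- x))"
    proof (rule add_mono)
      show "1 \<le> measure \<nu> (E x \<union> E (- x))" unfolding un by (simp add: noise.prob_space)
      have "{w \<in> space \<nu>. norm w \<le> W} \<subseteq> E x \<inter> E (- x)"
        using bad_state_violations(1)[OF P g W b] bad_state_violations(1)[OF P g W b']
        by (auto simp: E_def violated_iff_pnorm[OF P g])
      then have "measure \<nu> {w \<in> space \<nu>. norm w \<le> W} \<le> measure \<nu> (E x \<inter> E (- x))"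
        using Em' by (intro noise.finite_measure_mono) auto
      then show "1 - q \<le> measure \<nu> (E x \<inter> E (- x))" using smallW by simp
    qed
    also have "\<dots> = measure \<nu> (E x) + measure \<nu> (E (- x))"
      using measure_Un3[of "E x" \<nu> "E (- x)"] Em' by (simp add: noise.fmeasurable_eq_sets)
    finally have "ennreal (2 - q) \<le> ennreal (measure \<nu> (E x) + measure \<nu> (E (- x)))" by (intro ennreal_leI) simp
    also have "\<dots> = f x + f (- x)" by (simp add: f_def noise.emeasure_eq_measure ennreal_plus)
    finally show ?thesis using True by simp
  qed simp
  have "ennreal (2 - q) * emeasure ?\<mu> ?S' = (\<integral>\<^sup>+x. ennreal (2 - q) * indicator ?S' x \<partial>?\<mu>)"
    using S'm by (simp add: nn_integral_cmult_indicator)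
  also have "\<dots> \<le> (\<integral>\<^sup>+x. f x + f (- x) \<partial>?\<mu>)" by (rule nn_integral_mono) (rule step2)
  also have "\<dots> = (\<integral>\<^sup>+x. f x \<partial>?\<mu>) + (\<integral>\<^sup>+x. f (- x) \<partial>?\<mu>)"
  proof (rule nn_integral_add[OF fm])
    have "uminus \<in> ?\<mu> \<rightarrow>\<^sub>M ?\<mu>"
      unfolding measurable_cong_sets[OF sets_uniform_sphere sets_uniform_sphere]
      by (intro measurable_restrict_space2) (auto simp: space_restrict_space measurable_restrict_space1)
    from measurable_compose[OF this fm] show "(\<lambda>x. f (- x)) \<in> borel_measurable ?\<mu>" .
  qed
  also have "\<dots> = 2 * (\<integral>\<^sup>+x. f x \<partial>?\<mu>)" unfolding nn_integral_uniform_sphere_uminus[OF fm] by (simp add: mult_2)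
  finally have "ennreal \<alpha> * (ennreal (2 - q) * emeasure ?\<mu> ?S') \<le> ennreal \<alpha> * (2 * (\<integral>\<^sup>+x. f x \<partial>?\<mu>))"
    by (rule mult_left_mono) simp
  also have "\<dots> = 2 * (ennreal \<alpha> * (\<integral>\<^sup>+x. f x \<partial>?\<mu>))" by (rule mult.left_commute)
  also have "\<dots> \<le> 2 * emeasure sample_law ?Viol" by (intro mult_left_mono step1) simp
  finally have main: "ennreal \<alpha> * (ennreal (2 - q) * emeasure ?\<mu> ?S') \<le> 2 * emeasure sample_law ?Viol" .
  have V: "0 < measure lborel (cball 0 1 :: (real^'n) set)" by (rule content_cball_pos) simp
  have em: "emeasure lborel ?S = ennreal (measure lborel ?S)" "emeasure lborel (cball 0 1 :: (real^'n) set) = ennreal (measure lborel (cball 0 1 :: (real^'n) set))"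
  proof -
    have "bounded ?S" by (rule bounded_subset[OF bounded_cball[of 0 1]]) auto
    then have "emeasure lborel ?S < \<infinity>" by (rule emeasure_bounded_finite)
    then show "emeasure lborel ?S = ennreal (measure lborel ?S)" by (simp add: emeasure_eq_ennreal_measure less_top)
    show "emeasure lborel (cball 0 1 :: (real^'n) set) = ennreal (measure lborel (cball 0 1 :: (real^'n) set))"
      using emeasure_lborel_cball_finite[of "0 :: real^'n" 1] by (intro emeasure_eq_ennreal_measure) auto
  qed
  have "emeasure ?\<mu> ?S' = ennreal (measure lborel ?S / measure lborel (cball 0 1 :: (real^'n) set))"
    unfolding emeasure_sphere_bad_set em using V by (simp add: divide_ennreal)
  moreover have "emeasure sample_law ?Viol = ennreal (measure sample_law ?Viol)" by (rule emeasure_eq_measure)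
  moreover have "2 * ennreal (measure sample_law ?Viol) = ennreal (2 * measure sample_law ?Viol)" by (simp add: ennreal_mult)
  ultimately have "ennreal (\<alpha> * ((2 - q) * (measure lborel ?S / measure lborel (cball 0 1 :: (real^'n) set)))) \<le> ennreal (2 * measure sample_law ?Viol)"
    using main \<alpha> q by (simp add: ennreal_mult[symmetric])
  then have "\<alpha> * ((2 - q) * (measure lborel ?S / measure lborel (cball 0 1 :: (real^'n) set))) \<le> 2 * measure sample_law ?Viol"
    by (subst (asm) ennreal_le_iff) simp_all
  then show ?thesis using V by (simp add: field_simps)
qed

end

section \<open>The probabilistic bound on the joint spectral radius\<close>

text \<open>
  The binomial tail is continuous and strictly decreasing from 1 to 0, so the description of
  \<open>scenario_eps\<close> has exactly one solution.
\<close>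

lemma scenario_eps_properties:
  assumes "0 < d" "d \<le> N" "0 < \<beta>" "\<beta> < 1"
  shows "0 < scenario_eps d \<beta> N" "scenario_eps d \<beta> N < 1" "binomial_tail d N (scenario_eps d \<beta> N) = \<beta>"
proof -
  let ?P = "\<lambda>q. q \<in> {0..1} \<and> (\<Sum>l=0..d-1. real (N choose l) * q ^ l * (1 - q) ^ (N - l)) = \<beta>"
  have eq: "(\<Sum>l=0..d-1. real (N choose l) * q ^ l * (1 - q) ^ (N - l)) = binomial_tail d N q" for q
    unfolding binomial_tail_def by (rule sum.cong) (use assms(1) in auto)
  have "\<exists>q. 0 \<le> q \<and> q \<le> 1 \<and> binomial_tail d N q = \<beta>"
    by (rule IVT2') (use assms binomial_tail_0[of d N] binomial_tail_1[of d N] continuous_on_binomial_tail in auto)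
  then obtain q where q: "?P q" unfolding eq by auto
  have "?P (THE q. ?P q)"
  proof (rule theI[of ?P q])
    fix r assume r: "?P r"
    show "r = q"
      using binomial_tail_strict_anti[OF assms(1,2), of r q] binomial_tail_strict_anti[OF assms(1,2), of q r] q r
      unfolding eq by (cases r q rule: linorder_cases) auto
  qed (rule q)
  then have e: "scenario_eps d \<beta> N \<in> {0..1}" "binomial_tail d N (scenario_eps d \<beta> N) = \<beta>"
    unfolding scenario_eps_def eq by auto
  have "scenario_eps d \<beta> N \<noteq> 0" "scenario_eps d \<beta> N \<noteq> 1"
    using e(2) binomial_tail_0[OF assms(1), of N] binomial_tail_1[OF assms(2)] assms(3,4) by auto
  then show "0 < scenario_eps d \<beta> N" "scenario_eps d \<beta> N < 1" "binomial_tail d N (scenario_eps d \<beta> N) = \<beta>"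
    using e by auto
qed

lemma binomial_tail_mono:
  assumes "d \<le> d'" "0 \<le> q" "q \<le> 1"
  shows "binomial_tail d N q \<le> binomial_tail d' N q"
  unfolding binomial_tail_def using assms by (intro sum_mono2) auto

text \<open>
  The eigenvalue bounds are conditions on all vectors, and a countable dense set of vectors suffices.
\<close>

lemma measurable_lambda_bounds:
  fixes p :: "'a \<Rightarrow> real^'n^'n"
  assumes p: "p \<in> M \<rightarrow>\<^sub>M borel" and sym: "\<And>\<omega>. \<omega> \<in> space M \<Longrightarrow> transpose (p \<omega>) = p \<omega>"
  shows measurable_lambda_min: "(\<lambda>\<omega>. lambda_min (p \<omega>)) \<in> borel_measurable M"
    and measurable_lambda_max: "(\<lambda>\<omega>. lambda_max (p \<omega>)) \<in> borel_measurable M"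
proof -
  obtain D :: "(real^'n) set" where D: "countable D" "UNIV \<subseteq> closure D" using separable[of UNIV] by metis
  have [measurable]: "(\<lambda>\<omega>. x \<bullet> (p \<omega> *v x)) \<in> borel_measurable M" for x
    by (rule measurable_compose[OF p], rule borel_measurable_continuous_onI, rule quadratic_form_continuous)
  have dense: "(\<forall>x. f x \<le> g x) \<longleftrightarrow> (\<forall>x\<in>D. f x \<le> g x)" if "continuous_on UNIV f" "continuous_on UNIV g" for f g :: "real^'n \<Rightarrow> real"
  proof
    assume *: "\<forall>x\<in>D. f x \<le> g x"
    have "closed {x. f x \<le> g x}" using that by (rule closed_Collect_le)
    moreover have "D \<subseteq> {x. f x \<le> g x}" using * by auto
    ultimately have "closure D \<subseteq> {x. f x \<le> g x}" by (rule closure_minimal[rotated])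
    then show "\<forall>x. f x \<le> g x" using D(2) by blast
  qed simp
  have c: "continuous_on UNIV (\<lambda>x. c * (norm x)\<^sup>2)" "continuous_on UNIV (\<lambda>x. x \<bullet> (P *v x))" for c and P :: "real^'n^'n"
    by (intro continuous_intros)+
  show "(\<lambda>\<omega>. lambda_min (p \<omega>)) \<in> borel_measurable M"
    unfolding borel_measurable_iff_ge
  proof
    fix c
    have "{\<omega> \<in> space M. c \<le> lambda_min (p \<omega>)} = {\<omega> \<in> space M. \<forall>x\<in>D. c * (norm x)\<^sup>2 \<le> x \<bullet> (p \<omega> *v x)}"
      using eigenvalue_bounds(1)[OF sym] dense[OF c] by auto
    also have "\<dots> \<in> sets M" by (rule sets.sets_Collect_countable_All'[OF _ D(1)]) measurable
    finally show "{\<omega> \<in> space M. c \<le> lambda_min (p \<omega>)} \<in> sets M" .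
  qed
  show "(\<lambda>\<omega>. lambda_max (p \<omega>)) \<in> borel_measurable M"
    unfolding borel_measurable_iff_le
  proof
    fix c
    have "{\<omega> \<in> space M. lambda_max (p \<omega>) \<le> c} = {\<omega> \<in> space M. \<forall>x\<in>D. x \<bullet> (p \<omega> *v x) \<le> c * (norm x)\<^sup>2}"
      using eigenvalue_bounds(2)[OF sym] dense[OF c(2,1)] by auto
    also have "\<dots> \<in> sets M" by (rule sets.sets_Collect_countable_All'[OF _ D(1)]) measurable
    finally show "{\<omega> \<in> space M. lambda_max (p \<omega>) \<le> c} \<in> sets M" .
  qed
qed

lemma kappa_nonneg:
  fixes P :: "real^'n^'n"
  assumes "pos_def P"
  shows "0 \<le> kappa P"
proof -
  obtain L B :: "real^'n^'n" where "L ** B = mat 1" "B ** L = mat 1" "det P = (det L)\<^sup>2" "\<And>x. pnorm P x = norm (L *v x)"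
    using pos_def_factor[OF assms] by metis
  then show ?thesis using pos_def_lambda_min_pos[OF assms] by (simp add: kappa_def)
qed

lemma measurable_det:
  fixes p :: "'a \<Rightarrow> real^'n^'n"
  assumes p: "p \<in> M \<rightarrow>\<^sub>M borel"
  shows "(\<lambda>\<omega>. det (p \<omega>)) \<in> borel_measurable M"
proof -
  have "(\<lambda>\<omega>. p \<omega> $ i $ j) \<in> borel_measurable M" for i j
    by (rule measurable_compose[OF p], rule borel_measurable_continuous_onI) (intro continuous_intros)
  then show ?thesis unfolding det_def by (intro borel_measurable_sum borel_measurable_times borel_measurable_prod) auto
qed

lemma measurable_kappas:
  fixes p :: "'a \<Rightarrow> real^'n^'n"
  assumes p: "p \<in> M \<rightarrow>\<^sub>M borel" and sym: "\<And>\<omega>. \<omega> \<in> space M \<Longrightarrow> transpose (p \<omega>) = p \<omega>"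
  shows "(\<lambda>\<omega>. kappa (p \<omega>)) \<in> borel_measurable M" "(\<lambda>\<omega>. kappa_bar (p \<omega>)) \<in> borel_measurable M"
  unfolding kappa_def kappa_bar_def
  using measurable_lambda_bounds[OF p sym] measurable_det[OF p] by measurable

text \<open>
  Extended by constants, \<open>zeta\<close> is antitone on the whole line.
\<close>

lemma measurable_zeta:
  assumes n: "n = Suc m" "m > 0"
  shows "(\<lambda>s. if s < 0 then zeta n 0 else if s < 1 / 2 then zeta n s else 0) \<in> borel_measurable borel"
proof -
  let ?z = "\<lambda>s. if s < 0 then zeta n 0 else if s < 1 / 2 then zeta n s else 0"
  have "mono (\<lambda>s. - ?z s)"
  proof (rule monoI)
    fix s t :: real assume "s \<le> t"
    then show "- ?z s \<le> - ?z t"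
      using zeta_antimono[OF n, of s t] zeta_antimono[OF n, of 0 t] zeta_properties(1)[OF n, of s] zeta_properties(1)[OF n, of 0]
      by (auto simp: less_imp_le)
  qed
  then have "(\<lambda>s. - ?z s) \<in> borel_measurable borel" by (rule borel_measurable_mono)
  then have "(\<lambda>s. - (- ?z s)) \<in> borel_measurable borel" by (rule borel_measurable_uminus)
  then show ?thesis by simp
qed

context noisy_samples
begin

lemma measurable_rho_bar_event:
  fixes r W \<alpha> \<beta> :: real and N :: nat and p :: "real \<Rightarrow> real"
  assumes n: "CARD('n) \<ge> 2" and \<alpha>: "0 < \<alpha>" and p: "p W \<le> 1"
    and \<epsilon>: "0 \<le> scenario_eps (CARD('n) * (CARD('n) + 1) div 2) \<beta> N"
  shows "{\<omega> \<in> space (samples_measure N \<mu>_mode \<nu>). ereal r \<le> rho_bar A \<delta> \<phi> N W \<alpha> \<beta> p \<omega>} \<in> sets (samples_measure N \<mu>_mode \<nu>)"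
proof -
  obtain m where m: "CARD('n) = Suc m" "m > 0" using n by (cases "CARD('n)") auto
  let ?M = "PiM {1..N} (\<lambda>_. sample_law)"
  define P where "P \<omega> = opt_point (\<omega> ` {1..N})" for \<omega>
  define g where "g \<omega> = opt_value (\<omega> ` {1..N})" for \<omega>
  have sv: "finite (\<omega> ` {1..N})" "\<omega> ` {1..N} \<subseteq> space sample_law" if "\<omega> \<in> space ?M" for \<omega>
    using sample_valid[OF _ that, of "{1..N}"] by auto
  have pd: "pos_def (P \<omega>)" if "\<omega> \<in> space ?M" for \<omega>
    unfolding P_def by (rule spectral_body_pos_def[OF opt_point_in[OF sv[OF that]]])
  have Pm: "P \<in> ?M \<rightarrow>\<^sub>M borel" unfolding P_def [abs_def] by (rule measurable_opt_point) simp
  have [measurable]: "g \<in> borel_measurable ?M" unfolding g_def [abs_def] by (rule measurable_opt_value) simp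
  have sym: "transpose (P \<omega>) = P \<omega>" if "\<omega> \<in> space ?M" for \<omega> using pd[OF that] by (simp add: pos_def_def)
  note [measurable] = measurable_kappas[OF Pm sym]
  define s where "s \<omega> = scenario_eps (CARD('n) * (CARD('n) + 1) div 2) \<beta> N * kappa (P \<omega>) / (2 * \<alpha> * (1 - p W / 2))" for \<omega>
  have [measurable]: "s \<in> borel_measurable ?M" unfolding s_def [abs_def] by measurable
  define z where "z s = (if s < 0 then zeta CARD('n) 0 else if s < 1 / 2 then zeta CARD('n) s else 0)" for s
  have [measurable]: "z \<in> borel_measurable borel" unfolding z_def [abs_def] by (rule measurable_zeta[OF m])
  have s0: "0 \<le> s \<omega>" if "\<omega> \<in> space ?M" for \<omega>
  proof -
    have "0 \<le> kappa (P \<omega>)" by (rule kappa_nonneg[OF pd[OF that]])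
    then show ?thesis unfolding s_def using \<epsilon> \<alpha> p by (intro divide_nonneg_nonneg mult_nonneg_nonneg) auto
  qed
  have "{\<omega> \<in> space ?M. ereal r \<le> rho_bar A \<delta> \<phi> N W \<alpha> \<beta> p \<omega>} =
     {\<omega> \<in> space ?M. 1 / 2 \<le> s \<omega> \<or> r \<le> (g \<omega> + W * sqrt (kappa_bar (P \<omega>))) / z (s \<omega>)}"
  proof (rule Collect_cong, rule conj_cong[OF refl])
    fix \<omega> assume w: "\<omega> \<in> space ?M"
    have "rho_bar A \<delta> \<phi> N W \<alpha> \<beta> p \<omega> = (if s \<omega> \<ge> 1 / 2 then \<infinity> else ereal ((g \<omega> + W * sqrt (kappa_bar (P \<omega>))) / zeta CARD('n) (s \<omega>)))"
      by (simp add: rho_bar_def Let_def gamma_bar_def optimum_eq s_def P_def g_def)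
    moreover have "z (s \<omega>) = zeta CARD('n) (s \<omega>)" if "\<not> 1 / 2 \<le> s \<omega>" using that s0[OF w] by (simp add: z_def)
    ultimately show "ereal r \<le> rho_bar A \<delta> \<phi> N W \<alpha> \<beta> p \<omega> \<longleftrightarrow> 1 / 2 \<le> s \<omega> \<or> r \<le> (g \<omega> + W * sqrt (kappa_bar (P \<omega>))) / z (s \<omega>)"
      by auto
  qed
  also have "\<dots> \<in> sets ?M" by measurable
  finally show ?thesis unfolding samples_measure_def .
qed

text \<open>
  If some mode failed to contract with the factor in the bound, the measure of its bad states would
  exceed \<open>2 s / kappa P\<close> relative to the ball, while a small risk keeps it from exceeding that value;
  \<open>s\<close> is chosen so that the two thresholds agree.
\<close>

lemma joint_spectral_radius_le_rho_bar:
  fixes W \<alpha> \<beta> :: real and N :: nat and p :: "real \<Rightarrow> real"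
  assumes n: "CARD('n) \<ge> 2" and W: "0 \<le> W" and \<alpha>: "0 < \<alpha>" "\<And>j. \<alpha> \<le> pmf \<mu>_mode j"
    and p: "0 \<le> p W" "p W \<le> 1" "measure (distr \<nu> borel (\<lambda>w. w)) {w. norm w > W} \<le> p W"
    and \<epsilon>: "0 \<le> scenario_eps (CARD('n) * (CARD('n) + 1) div 2) \<beta> N"
    and \<omega>: "\<omega> \<in> space (samples_measure N \<mu>_mode \<nu>)"
    and risk: "scenario.risk (\<omega> ` {1..N}) \<le> scenario_eps (CARD('n) * (CARD('n) + 1) div 2) \<beta> N"
  shows "ereal (joint_spectral_radius (range A)) \<le> rho_bar A \<delta> \<phi> N W \<alpha> \<beta> p \<omega>"
proof -
  obtain m where m: "CARD('n) = Suc m" "m > 0" using n by (cases "CARD('n)") auto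
  define P where "P = opt_point (\<omega> ` {1..N})"
  define g where "g = opt_value (\<omega> ` {1..N})"
  let ?e = "scenario_eps (CARD('n) * (CARD('n) + 1) div 2) \<beta> N"
  define s where "s = ?e * kappa P / (2 * \<alpha> * (1 - p W / 2))"
  define G where "G = g + W * sqrt (kappa_bar P)"
  have sv: "finite (\<omega> ` {1..N})" "\<omega> ` {1..N} \<subseteq> space sample_law"
    using sample_valid[of "{1..N}" \<omega> "{1..N}"] \<omega> by (auto simp: samples_measure_def)
  have pd: "pos_def P" unfolding P_def by (rule spectral_body_pos_def[OF opt_point_in[OF sv]])
  have g0: "0 \<le> g" unfolding g_def by (rule opt_value_nonneg[OF sv])
  have lm: "0 < lambda_min P" "lambda_min P \<le> lambda_max P"
    using pos_def_lambda_min_pos[OF pd] lambda_min_le_lambda_max pd by (auto simp: pos_def_def)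
  have G0: "0 \<le> G" unfolding G_def using g0 W lm by (simp add: kappa_bar_def)
  have rb: "rho_bar A \<delta> \<phi> N W \<alpha> \<beta> p \<omega> = (if s \<ge> 1 / 2 then \<infinity> else ereal (G / zeta CARD('n) s))"
    by (simp add: rho_bar_def Let_def gamma_bar_def optimum_eq s_def P_def g_def G_def)
  have K: "0 \<le> kappa P" by (rule kappa_nonneg[OF pd])
  have D: "0 < \<alpha> * (1 - p W / 2)" using \<alpha> p by simp
  have s0: "0 \<le> s" unfolding s_def using K \<epsilon> \<alpha> p by (intro divide_nonneg_nonneg mult_nonneg_nonneg) auto
  show ?thesis
  proof (cases "s < 1 / 2")
    case False
    then show ?thesis unfolding rb by simp
  next
    case True
    have z: "0 < zeta CARD('n) s" by (rule zeta_properties(1)[OF m s0 True])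
    have r0: "0 \<le> G / zeta CARD('n) s" using G0 z by simp
    have "pnorm P (A j *v x) \<le> G / zeta CARD('n) s * pnorm P x" for j x
    proof (rule ccontr)
      assume "\<not> ?thesis"
      then have bad: "G / zeta CARD('n) s * pnorm P x < pnorm P (A j *v x)" by simp
      let ?V = "measure lborel (cball 0 1 :: (real^'n) set)"
      let ?S = "measure lborel {x. norm x \<le> 1 \<and> G * pnorm P x < pnorm P (A j *v x)}"
      have V: "0 < ?V" by (rule content_cball_pos) simp
      have 1: "2 * s * ?V < kappa P * ?S" by (rule contraction_defect_measure[OF n pd G0 s0 True bad])
      have "\<alpha> * (1 - p W / 2) * ?S \<le> measure sample_law {z \<in> space sample_law. violated (g, P) z} * ?V"
        unfolding G_def by (rule bad_states_le_violation[OF pd g0 W less_imp_le[OF \<alpha>(1)] \<alpha>(2) p(3,2)])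
      also have "measure sample_law {z \<in> space sample_law. violated (g, P) z} = scenario.risk (\<omega> ` {1..N})"
        by (simp add: scenario.risk_def solution_def g_def P_def)
      also have "\<dots> * ?V \<le> ?e * ?V" using risk V by (intro mult_right_mono) auto
      finally have "kappa P * (\<alpha> * (1 - p W / 2) * ?S) \<le> kappa P * (?e * ?V)" using K by (rule mult_left_mono)
      also have "kappa P * (?e * ?V) = 2 * s * ?V * (\<alpha> * (1 - p W / 2))"
      proof -
        have "2 * (a / (2 * c)) * c = a" if "0 < c" for a c :: real using that by simp
        from this[OF D] have "2 * s * (\<alpha> * (1 - p W / 2)) = ?e * kappa P" unfolding s_def by (simp only: mult.assoc)
        then show ?thesis by (simp add: mult_ac)
      qed
      also have "\<dots> < kappa P * ?S * (\<alpha> * (1 - p W / 2))" using 1 D by (rule mult_strict_right_mono)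
      finally show False by (simp add: mult_ac)
    qed
    from joint_spectral_radius_le[OF pd r0 this] show ?thesis using True unfolding rb by simp
  qed
qed

end

theorem theorem18:
  fixes A :: "'m::finite \<Rightarrow> real^'n^'n"
    and \<alpha> \<beta> \<delta> W :: real
    and N :: nat
    and p :: "real \<Rightarrow> real"
    and \<phi> :: "real^'n^'n \<Rightarrow> real"
    and \<mu>_mode :: "'m pmf"
    and \<W> :: "(real^'n) set"
    and \<mu>_noise :: "(real^'n) measure"
  assumes "CARD('n) \<ge> 2"
    and "0 < \<beta>" and "\<beta> < 1"
    and "\<delta> \<ge> 1"
    and "N \<ge> CARD('n) * (CARD('n) + 1) div 2"
    and "W \<ge> 0"
    and "continuous_on {P. pos_def P} \<phi>"
    and "strictly_convex_on {P. pos_def P} \<phi>"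
    and "\<alpha> > 0" and "\<And>j. pmf \<mu>_mode j \<ge> \<alpha>"
    and "prob_space \<mu>_noise"
    and "sets \<mu>_noise = sets (restrict_space borel \<W>)"
    and "\<And>t. t \<ge> 0 \<Longrightarrow> 0 \<le> p t \<and> p t \<le> 1"
    and "\<And>t. t \<ge> 0 \<Longrightarrow> measure (distr \<mu>_noise borel (\<lambda>w. w)) {w. norm w > t} \<le> p t"
    and "absolutely_continuous lborel (distr \<mu>_noise borel (\<lambda>w. w))"
  shows "measure (samples_measure N \<mu>_mode \<mu>_noise)
           {\<omega> \<in> space (samples_measure N \<mu>_mode \<mu>_noise).
              ereal (joint_spectral_radius (range A)) \<le> rho_bar A \<delta> \<phi> N W \<alpha> \<beta> p \<omega>} \<ge> 1 - \<beta>"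
proof -
  interpret noisy_samples A \<delta> \<phi> \<mu>_mode \<W> \<mu>_noise
    by (rule noisy_samples.intro) (use assms in auto)
  let ?d = "CARD('n) * (CARD('n) + 1) div 2"
  let ?e = "scenario_eps ?d \<beta> N"
  let ?M = "PiM {1..N} (\<lambda>_. sample_law)"
  let ?k = "dim (spectral_body \<delta> :: (real^'n^'n) set)"
  \<comment> \<open>the binomial tail grows with the number of its terms, so the dimension may be replaced by this bound\<close>
  have "?k \<le> ?d" by (rule dim_spectral_body)
  note kd = this
  have "2 * 3 \<le> CARD('n) * (CARD('n) + 1)" using assms(1) by (intro mult_le_mono) auto
  then have d: "0 < ?d" by simp
  note e = scenario_eps_properties[OF d assms(5) assms(2,3)]
  have "mat 1 \<in> spectral_body \<delta>" "mat 1 \<noteq> (0 :: real^'n^'n)"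
    using spectral_body_nonempty[OF assms(4)] by (auto simp: mat_def vec_eq_iff)
  then have "\<not> spectral_body \<delta> \<subseteq> {0 :: real^'n^'n}" by blast
  then have k0: "0 < ?k" using dim_eq_0[of "spectral_body \<delta> :: (real^'n^'n) set"] by linarith
  have "measure ?M {\<omega> \<in> space ?M. scenario.risk (\<omega> ` {1..N}) > ?e} \<le> binomial_tail ?k (card {1..N}) ?e"
    using k0 kd assms(5) e by (intro scenario.risk_tail) auto
  also have "\<dots> \<le> binomial_tail ?d N ?e" using binomial_tail_mono[OF kd, of ?e N] e by (simp only: card_atLeastAtMost diff_Suc_1)
  also have "\<dots> = \<beta>" by (rule e(3))
  finally have tail: "measure ?M {\<omega> \<in> space ?M. scenario.risk (\<omega> ` {1..N}) > ?e} \<le> \<beta>" .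
  interpret PM: prob_space ?M by (rule scenario.prob_space_PM)
  have [measurable]: "(\<lambda>\<omega>. scenario.risk (\<omega> ` {1..N})) \<in> borel_measurable ?M" by (rule scenario.measurable_risk) auto
  have "{\<omega> \<in> space ?M. scenario.risk (\<omega> ` {1..N}) > ?e} \<in> sets ?M" by measurable
  from PM.prob_neg[OF this] tail
  have "1 - \<beta> \<le> measure ?M {\<omega> \<in> space ?M. \<not> scenario.risk (\<omega> ` {1..N}) > ?e}" by simp
  also have "\<dots> \<le> measure ?M {\<omega> \<in> space ?M. ereal (joint_spectral_radius (range A)) \<le> rho_bar A \<delta> \<phi> N W \<alpha> \<beta> p \<omega>}"
  proof (rule PM.finite_measure_mono)
    show "{\<omega> \<in> space ?M. ereal (joint_spectral_radius (range A)) \<le> rho_bar A \<delta> \<phi> N W \<alpha> \<beta> p \<omega>} \<in> sets ?M"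
      using measurable_rho_bar_event[of \<alpha> p W \<beta> N "joint_spectral_radius (range A)"] assms(1,9) assms(13)[OF assms(6)] e(1)
      by (simp add: samples_measure_def)
    show "{\<omega> \<in> space ?M. \<not> scenario.risk (\<omega> ` {1..N}) > ?e} \<subseteq> {\<omega> \<in> space ?M. ereal (joint_spectral_radius (range A)) \<le> rho_bar A \<delta> \<phi> N W \<alpha> \<beta> p \<omega>}"
      using joint_spectral_radius_le_rho_bar[of W \<alpha> p \<beta> N] assms(1,6,9,10) assms(13,14)[OF assms(6)] e(1)
      by (auto simp: samples_measure_def not_less)
  qed
  finally show ?thesis unfolding samples_measure_def .
qed

end
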